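(* Let $n\ge2$ and $u\in C^\infty(S^1,V_n)$. Then $(J_1)_u(\nabla H_j(u))=0$ for $1\le j\le n-1$; that is, $H_1,\ldots,H_{n-1}$ are Casimirs of the Poisson structure $\{\,,\}_1$. Moreover, $\mathrm{Ker}((J_1)_u)$ is equal to the span of $\{\nabla H_1(u),\ldots,\nabla H_{n-1}(u)\}$.
   Context: $b=\sum_{i=1}^{n-1}e_{i+1,i}$, $J=e_{1n}\lambda+b$, $V_n=\bigoplus_{i=1}^{n-1}\mathbb{R}e_{in}$, $V_n^t=\bigoplus_{i=1}^{n-1}\mathbb{R}e_{ni}$, $S^1=\mathbb{R}/2\pi\mathbb{Z}$, $[\partial_x+A,B]=B_x+[A,B]$, $\langle y_1,y_2\rangle=\oint\mathrm{tr}(y_1y_2)\,dx$. The canonical projection is $\pi_0:sl(n,\mathbb{R})\to V_n^t$, $\pi_0(y)=\sum_{i=1}^{n-1}y_{ni}e_{ni}$. For $u\in C^\infty(S^1,V_n)$ and $v\in C^\infty(S^1,V_n^t)$, $P_u(v)=C$ is the unique $sl(n,\mathbb{R})$-valued smooth map with $\pi_0(C)=v$ and $[\partial_x+b+u,C]\in C^\infty(S^1,V_n)$ (its entries are differential polynomials in $u,v$). The gradient $\nabla F(u)\in C^\infty(S^1,V_n^t)$ of a functional $F$ on $C^\infty(S^1,V_n)$ is defined by $dF_u(v)=\langle\nabla F(u),v\rangle$ for all $v\in C^\infty(S^1,V_n)$. The first Poisson structure is $\{F_1,F_2\}_1(u)=\langle[e_{1n},P_u(\nabla F_1(u))],P_u(\nabla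 F_2(u))\rangle$, and its Poisson operator $(J_1)_u:C^\infty(S^1,V_n^t)\to C^\infty(S^1,V_n)$ is the linear differential operator defined by $\langle(J_1)_u(\xi),\eta\rangle=\langle[e_{1n},P_u(\xi)],P_u(\eta)\rangle$. The functionals $H_j$: for $u\in C^\infty(S^1,V_n)$ there is a unique formal series $T=\sum_{i\ge0}T_i\lambda^{-i}$ with $T_0$ valued in the group of upper triangular matrices with $1$'s on the diagonal, the first column of $T$ equal to $e_1=(1,0,\ldots,0)^t$, and $T(\partial_x+J+u)T^{-1}=\partial_x+J+\sum_{i\ge0}f_i(u)J^{-i}$ with scalar functions $f_i(u)\in C^\infty(S^1,\mathbb{R})$. Then $H_j(u)=n\oint f_j(u)\,dx$. *)

theory Defs
  imports
    "HOL-Analysis.Henstock_Kurzweil_Integration"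
    "HOL-Computational_Algebra.Formal_Laurent_Series"
    "Jordan_Normal_Form.Gauss_Jordan_Elimination"
begin

text \<open>
  Matrix indices are zero-based: the matrix unit $e_{ij}$ is \<open>munit n (i - 1) (j - 1)\<close>.
  Maps on $S^1 = \mathbb{R}/2\pi\mathbb{Z}$ are $2\pi$-periodic maps on the real line.
\<close>

definition munit :: "nat \<Rightarrow> nat \<Rightarrow> nat \<Rightarrow> 'a::zero_neq_one mat" where
  "munit n i j = Matrix.mat n n (\<lambda>(r, c). if r = i \<and> c = j then 1 else 0)"

definition bmat :: "nat \<Rightarrow> 'a::zero_neq_one mat" where
  "bmat n = Matrix.mat n n (\<lambda>(r, c). if r = c + 1 then 1 else 0)"

definition mtrace :: "real mat \<Rightarrow> real" where
  "mtrace A = (\<Sum>i<dim_row A. A $$ (i, i))"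

definition mcomm :: "'a::ring mat \<Rightarrow> 'a mat \<Rightarrow> 'a mat" where
  "mcomm A B = A * B - B * A"

definition sl :: "nat \<Rightarrow> real mat set" where
  "sl n = {A \<in> carrier_mat n n. mtrace A = 0}"

definition Vn :: "nat \<Rightarrow> real mat set" where
  "Vn n = {A \<in> carrier_mat n n.
     \<forall>r<n. \<forall>c<n. \<not> (r < n - 1 \<and> c = n - 1) \<longrightarrow> A $$ (r, c) = 0}"

definition Vnt :: "nat \<Rightarrow> real mat set" where
  "Vnt n = {A \<in> carrier_mat n n.
     \<forall>r<n. \<forall>c<n. \<not> (r = n - 1 \<and> c < n - 1) \<longrightarrow> A $$ (r, c) = 0}"

definition proj0 :: "nat \<Rightarrow> real mat \<Rightarrow> real mat" where
  "proj0 n A = Matrix.mat n n (\<lambda>(r, c). if r = n - 1 \<and> c < n - 1 then A $$ (r, c) else 0)"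

definition smooth_S1 :: "(real \<Rightarrow> real) \<Rightarrow> bool" where
  "smooth_S1 f \<longleftrightarrow>
     (\<forall>k x. ((deriv ^^ k) f) differentiable (at x)) \<and> (\<forall>x. f (x + 2 * pi) = f x)"

definition Cinf :: "nat \<Rightarrow> real mat set \<Rightarrow> (real \<Rightarrow> real mat) set" where
  "Cinf n S = {A. (\<forall>x. A x \<in> carrier_mat n n \<inter> S) \<and>
     (\<forall>r<n. \<forall>c<n. smooth_S1 (\<lambda>x. A x $$ (r, c)))}"

definition mderiv :: "nat \<Rightarrow> (real \<Rightarrow> real mat) \<Rightarrow> real \<Rightarrow> real mat" where
  "mderiv n A x = Matrix.mat n n (\<lambda>(r, c). deriv (\<lambda>y. A y $$ (r, c)) x)"

definition pairing :: "(real \<Rightarrow> real mat) \<Rightarrow> (real \<Rightarrow> real mat) \<Rightarrow> real" where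
  "pairing y1 y2 = integral {0..2 * pi} (\<lambda>x. mtrace (y1 x * y2 x))"

text \<open>The commutator $[\partial_x + A, B] = B_x + [A, B]$.\<close>

definition dcomm ::
    "nat \<Rightarrow> (real \<Rightarrow> real mat) \<Rightarrow> (real \<Rightarrow> real mat) \<Rightarrow> real \<Rightarrow> real mat" where
  "dcomm n A B x = mderiv n B x + mcomm (A x) (B x)"

definition Pop :: "nat \<Rightarrow> (real \<Rightarrow> real mat) \<Rightarrow> (real \<Rightarrow> real mat) \<Rightarrow> real \<Rightarrow> real mat" where
  "Pop n u v = (THE C. C \<in> Cinf n (sl n) \<and> (\<forall>x. proj0 n (C x) = v x) \<and>
     dcomm n (\<lambda>x. bmat n + u x) C \<in> Cinf n (Vn n))"

text \<open>The differential $dF_u(v)$ is the derivative of $F(u + \varepsilon v)$ at $\varepsilon = 0$.\<close>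

definition has_gradient ::
    "nat \<Rightarrow> ((real \<Rightarrow> real mat) \<Rightarrow> real) \<Rightarrow> (real \<Rightarrow> real mat) \<Rightarrow> (real \<Rightarrow> real mat) \<Rightarrow> bool" where
  "has_gradient n F u g \<longleftrightarrow> g \<in> Cinf n (Vnt n) \<and>
     (\<forall>v \<in> Cinf n (Vn n).
        ((\<lambda>\<epsilon>. F (\<lambda>x. u x + \<epsilon> \<cdot>\<^sub>m v x)) has_real_derivative pairing g v) (at 0))"

definition gradient ::
    "nat \<Rightarrow> ((real \<Rightarrow> real mat) \<Rightarrow> real) \<Rightarrow> (real \<Rightarrow> real mat) \<Rightarrow> real \<Rightarrow> real mat" where
  "gradient n F u = (THE g. has_gradient n F u g)"

definition form1 ::
    "nat \<Rightarrow> (real \<Rightarrow> real mat) \<Rightarrow> (real \<Rightarrow> real mat) \<Rightarrow> (real \<Rightarrow> real mat) \<Rightarrow> real" where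
  "form1 n u \<xi> \<eta> = pairing (\<lambda>x. mcomm (munit n 0 (n - 1)) (Pop n u \<xi> x)) (Pop n u \<eta>)"

definition poisson1 ::
    "nat \<Rightarrow> ((real \<Rightarrow> real mat) \<Rightarrow> real) \<Rightarrow> ((real \<Rightarrow> real mat) \<Rightarrow> real) \<Rightarrow>
       (real \<Rightarrow> real mat) \<Rightarrow> real" where
  "poisson1 n F1 F2 u = form1 n u (gradient n F1 u) (gradient n F2 u)"

definition J1op :: "nat \<Rightarrow> (real \<Rightarrow> real mat) \<Rightarrow> (real \<Rightarrow> real mat) \<Rightarrow> real \<Rightarrow> real mat" where
  "J1op n u \<xi> = (THE w. w \<in> Cinf n (Vn n) \<and>
     (\<forall>\<eta> \<in> Cinf n (Vnt n). pairing w \<eta> = form1 n u \<xi> \<eta>))"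

definition J1ker :: "nat \<Rightarrow> (real \<Rightarrow> real mat) \<Rightarrow> (real \<Rightarrow> real mat) set" where
  "J1ker n u = {\<xi> \<in> Cinf n (Vnt n). J1op n u \<xi> = (\<lambda>x. 0\<^sub>m n n)}"

text \<open>
  Formal series in $\lambda^{-1}$ with finitely many positive powers of $\lambda$ are the formal
  Laurent series in the variable $\lambda^{-1}$, so $\lambda$ is \<open>fls_X_inv\<close> and the coefficient
  of $\lambda^{-k}$ is \<open>fls_nth _ k\<close>.
\<close>

definition Jmat :: "nat \<Rightarrow> real fls mat" where
  "Jmat n = fls_X_inv \<cdot>\<^sub>m munit n 0 (n - 1) + bmat n"

definition minv :: "'a::field mat \<Rightarrow> 'a mat" where
  "minv A = the (mat_inverse A)"

text \<open>The series $\sum_{i \ge 0} T_i(x) \lambda^{-i}$.\<close>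

definition mseries :: "nat \<Rightarrow> (nat \<Rightarrow> real \<Rightarrow> real mat) \<Rightarrow> real \<Rightarrow> real fls mat" where
  "mseries n T x =
     Matrix.mat n n (\<lambda>(r, c). fps_to_fls (Abs_fps (\<lambda>i. T i x $$ (r, c))))"

text \<open>
  The potential of the conjugated operator:
  $T(\partial_x + J + u)T^{-1} = \partial_x + T(J + u)T^{-1} - T_x T^{-1}$.
\<close>

definition gauge ::
    "nat \<Rightarrow> (real \<Rightarrow> real mat) \<Rightarrow> (nat \<Rightarrow> real \<Rightarrow> real mat) \<Rightarrow> real \<Rightarrow> real fls mat" where
  "gauge n u T x =
     mseries n T x * (Jmat n + map_mat fls_const (u x)) * minv (mseries n T x)
     - mseries n (\<lambda>i. mderiv n (T i)) x * minv (mseries n T x)"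

text \<open>
  The coefficient of $\lambda^{-k}$ in the entry $(r,c)$ of $\sum_{i \ge 0} f_i J^{-i}$. Only
  finitely many $J^{-i}$ contribute to it, because $J^{-n} = \lambda^{-1} I$.
\<close>

definition Jseries_coeff :: "nat \<Rightarrow> (nat \<Rightarrow> real) \<Rightarrow> nat \<Rightarrow> nat \<Rightarrow> int \<Rightarrow> real" where
  "Jseries_coeff n f r c k =
     (\<Sum>i | fls_nth ((minv (Jmat n) ^\<^sub>m i) $$ (r, c)) k \<noteq> 0.
        f i * fls_nth ((minv (Jmat n) ^\<^sub>m i) $$ (r, c)) k)"

definition normalizes ::
    "nat \<Rightarrow> (real \<Rightarrow> real mat) \<Rightarrow> (nat \<Rightarrow> real \<Rightarrow> real mat) \<Rightarrow> (nat \<Rightarrow> real \<Rightarrow> real) \<Rightarrow> bool" where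
  "normalizes n u T f \<longleftrightarrow>
     (\<forall>i. T i \<in> Cinf n (carrier_mat n n)) \<and>
     (\<forall>i. smooth_S1 (f i)) \<and>
     (\<forall>x. upper_triangular (T 0 x) \<and> (\<forall>r<n. T 0 x $$ (r, r) = 1)) \<and>
     (\<forall>x. col (mseries n T x) 0 = unit_vec n 0) \<and>
     (\<forall>x. \<forall>r<n. \<forall>c<n. \<forall>k.
        fls_nth (gauge n u T x $$ (r, c)) k =
        fls_nth (Jmat n $$ (r, c)) k + Jseries_coeff n (\<lambda>i. f i x) r c k)"

definition Tser :: "nat \<Rightarrow> (real \<Rightarrow> real mat) \<Rightarrow> nat \<Rightarrow> real \<Rightarrow> real mat" where
  "Tser n u = (THE T. \<exists>f. normalizes n u T f)"

definition fcoeff :: "nat \<Rightarrow> (real \<Rightarrow> real mat) \<Rightarrow> nat \<Rightarrow> real \<Rightarrow> real" where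
  "fcoeff n u = (THE f. normalizes n u (Tser n u) f)"

definition Hfun :: "nat \<Rightarrow> nat \<Rightarrow> (real \<Rightarrow> real mat) \<Rightarrow> real" where
  "Hfun n j u = real n * integral {0..2 * pi} (fcoeff n u j)"

text \<open>
  The real span of a finite family of matrix-valued functions, written out because the
  type of matrices (of all dimensions) is not a vector space.
\<close>

definition fun_span :: "nat \<Rightarrow> nat set \<Rightarrow> (nat \<Rightarrow> real \<Rightarrow> real mat) \<Rightarrow> (real \<Rightarrow> real mat) set" where
  "fun_span n I G = {\<lambda>x. Matrix.mat n n (\<lambda>(r, c). \<Sum>j\<in>I. a j * G j x $$ (r, c)) | a. True}"

end

theory Submission
  imports
    Defs
    "HOL-Analysis.Equivalence_Lebesgue_Henstock_Integration"
    "Jordan_Normal_Form.Determinant"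
begin

text \<open>
  With \<open>z\<^sup>n = \<lambda>\<close> the gauge equation for \<open>T\<close> becomes a scalar Riccati equation for
  \<open>h = \<Sum> f\<^sub>i z\<^sup>-\<^sup>i\<close>, uniquely solvable because it is a contraction in the \<open>z\<^sup>-\<^sup>1\<close>-adic topology; column
  \<open>c\<close> of \<open>T\<close> is a series \<open>Q\<^sub>c\<close>. Solving the adjoint of the linearized equation gives a row vector
  \<open>R\<close>, and the \<open>z\<^sup>-\<^sup>j\<close>-coefficients \<open>C\<^sub>j\<close> of the rank-one matrix \<open>n R\<^sub>r Q\<^sub>c\<close> satisfy
  \<open>[\<partial>\<^sub>x + b + u, C\<^sub>j] + [e\<^sub>1\<^sub>n, C\<^sub>j\<^sub>+\<^sub>n] = 0\<close>. The gradient of \<open>H\<^sub>j\<close> is the last row of \<open>C\<^sub>j\<close>, and for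
  \<open>0 < j < n\<close> the matrix \<open>C\<^sub>j\<^sub>-\<^sub>n\<close> is strictly upper triangular, so \<open>\<nabla>H\<^sub>j\<close> is killed by \<open>J\<^sub>1\<close>.

  Conversely \<open>J\<^sub>1\<close> is triangular: if \<open>\<xi>\<close> vanishes in the columns before \<open>k\<close> (counted from zero) and
  \<open>J\<^sub>1 \<xi> = 0\<close>, then \<open>n \<xi>\<^sub>k' = 0\<close>. As the first nonzero entry of \<open>\<nabla>H\<^sub>n\<^sub>-\<^sub>1\<^sub>-\<^sub>k\<close> is a \<open>1\<close> in column \<open>k\<close>,
  subtracting constant multiples of the gradients exhausts the kernel.
\<close>

section \<open>Smooth periodic functions as a differential ring\<close>

text \<open>The Riccati equation is treated over any commutative ring with a derivation in which n
  is invertible, because two rings are needed: smooth functions on the circle, and polynomials over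
  them in a formal parameter \<epsilon>. The second ring contains the solution for the deformed
  potential u + \<epsilon>v. Hence each f_j is polynomial in \<epsilon>, and the differential of H_j
  can be read off as a coefficient, without differentiating under the integral sign.
  \<open>Pop\<close>, \<open>gradient\<close>, \<open>J1op\<close>, \<open>Tser\<close> and
  \<open>fcoeff\<close> are definite descriptions, so each of them carries an existence and a
  uniqueness obligation. Uniqueness rests on nondegeneracy of the pairing, on the triangular shape
  of the conditions for \<open>Pop\<close>, or on the contraction. The term n \<xi>_k' is isolated
  by testing the form with the row that carries \<xi>_k' in column n - 2 - k and vanishes elsewhere:
  the value is then n times the integral of the square of \<xi>_k'. Such a test row is admissible
  because \<open>Pop\<close> exists for every right-hand side.\<close>

primrec times_differentiable :: "nat \<Rightarrow> (real \<Rightarrow> real) \<Rightarrow> bool" where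
  "times_differentiable 0 f \<longleftrightarrow> (\<forall>x. f differentiable at x)"
| "times_differentiable (Suc k) f \<longleftrightarrow>
     (\<forall>x. f differentiable at x) \<and> times_differentiable k (deriv f)"

lemma times_differentiable_imp_differentiable:
  "times_differentiable k f \<Longrightarrow> f differentiable at x"
  by (cases k) auto

lemma differentiable_iff_DERIV:
  fixes f :: "real \<Rightarrow> real"
  shows "f differentiable at x \<longleftrightarrow> DERIV f x :> deriv f x"
  using DERIV_deriv_iff_real_differentiable by blast

lemma deriv_add_fun:
  fixes f g :: "real \<Rightarrow> real"
  assumes "\<And>x. f differentiable at x" "\<And>x. g differentiable at x"
  shows "deriv (\<lambda>x. f x + g x) = (\<lambda>x. deriv f x + deriv g x)"
  using assms by (auto simp: differentiable_iff_DERIV intro!: DERIV_imp_deriv derivative_eq_intros)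

lemma deriv_mult_fun:
  fixes f g :: "real \<Rightarrow> real"
  assumes "\<And>x. f differentiable at x" "\<And>x. g differentiable at x"
  shows "deriv (\<lambda>x. f x * g x) = (\<lambda>x. deriv f x * g x + f x * deriv g x)"
proof
  fix x
  show "deriv (\<lambda>x. f x * g x) x = deriv f x * g x + f x * deriv g x"
    using DERIV_mult[OF assms(1)[of x, unfolded differentiable_iff_DERIV]
        assms(2)[of x, unfolded differentiable_iff_DERIV]]
    by (simp add: DERIV_imp_deriv mult.commute add.commute)
qed

lemma times_differentiable_Suc_imp:
  "times_differentiable (Suc k) f \<Longrightarrow> times_differentiable k f"
  by (induction k arbitrary: f) auto

lemma times_differentiable_add:
  "times_differentiable k f \<Longrightarrow> times_differentiable k g \<Longrightarrow>
    times_differentiable k (\<lambda>x. f x + g x)"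
proof (induction k arbitrary: f g)
  case (Suc k)
  then show ?case by (simp add: deriv_add_fun)
qed simp

lemma times_differentiable_mult:
  "times_differentiable k f \<Longrightarrow> times_differentiable k g \<Longrightarrow>
    times_differentiable k (\<lambda>x. f x * g x)"
proof (induction k arbitrary: f g)
  case (Suc k)
  then have "times_differentiable k f" "times_differentiable k g"
    using times_differentiable_Suc_imp by blast+
  with Suc show ?case
    by (simp add: deriv_mult_fun times_differentiable_add)
qed simp

lemma times_differentiable_const: "times_differentiable k (\<lambda>x. c)"
  by (induction k arbitrary: c) simp_all

text \<open>Induction over sums and products needs the innermost derivative split off, as in
  \<open>times_differentiable\<close>, whereas the iterates in \<open>smooth_S1\<close> split off
  the outermost one. Comparing all orders up to \<open>k\<close> at once makes the two
  match.\<close>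

lemma higher_deriv_differentiable_iff:
  "(\<forall>k x. ((deriv ^^ k) f) differentiable (at x)) \<longleftrightarrow> (\<forall>k. times_differentiable k f)"
proof -
  have "(\<forall>i\<le>k. \<forall>x. ((deriv ^^ i) f) differentiable (at x)) \<longleftrightarrow> times_differentiable k f" for k
  proof (induction k arbitrary: f)
    case (Suc k)
    have "(\<forall>i\<le>Suc k. \<forall>x. ((deriv ^^ i) f) differentiable (at x)) \<longleftrightarrow>
      (\<forall>x. f differentiable (at x)) \<and>
      (\<forall>i\<le>k. \<forall>x. ((deriv ^^ i) (deriv f)) differentiable (at x))"
    proof safe
      fix i x assume i: "i \<le> Suc k" and f: "\<forall>x. f differentiable at x"
        and f': "\<forall>i\<le>k. \<forall>x. (deriv ^^ i) (deriv f) differentiable at x"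
      show "(deriv ^^ i) f differentiable at x"
        using i f f' by (cases i) (auto simp: funpow_swap1)
    next
      fix i x assume "i \<le> k" and f: "\<forall>i\<le>Suc k. \<forall>x. (deriv ^^ i) f differentiable at x"
      then show "(deriv ^^ i) (deriv f) differentiable at x"
        using f[rule_format, of "Suc i" x] by (simp add: funpow_swap1)
    next
      fix x assume f: "\<forall>i\<le>Suc k. \<forall>x. (deriv ^^ i) f differentiable at x"
      show "f differentiable at x"
        using f[rule_format, of 0 x] by simp
    qed
    then show ?case by (simp add: Suc)
  qed simp
  then show ?thesis by blast
qed

lemma smooth_S1_iff:
  "smooth_S1 f \<longleftrightarrow> (\<forall>k. times_differentiable k f) \<and> (\<forall>x. f (x + 2 * pi) = f x)"
  unfolding smooth_S1_def higher_deriv_differentiable_iff ..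

lemma smooth_S1_add: "smooth_S1 f \<Longrightarrow> smooth_S1 g \<Longrightarrow> smooth_S1 (\<lambda>x. f x + g x)"
  by (simp add: smooth_S1_iff times_differentiable_add)

lemma smooth_S1_mult: "smooth_S1 f \<Longrightarrow> smooth_S1 g \<Longrightarrow> smooth_S1 (\<lambda>x. f x * g x)"
  by (simp add: smooth_S1_iff times_differentiable_mult)

lemma smooth_S1_const: "smooth_S1 (\<lambda>x. c)"
  by (simp add: smooth_S1_iff times_differentiable_const)

lemma smooth_S1_minus: "smooth_S1 f \<Longrightarrow> smooth_S1 (\<lambda>x. - f x)"
  using smooth_S1_mult[OF smooth_S1_const[of "-1"]] by simp

lemma smooth_S1_differentiable: "smooth_S1 f \<Longrightarrow> f differentiable at x"
  by (auto simp: smooth_S1_iff dest: times_differentiable_imp_differentiable)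

lemma smooth_S1_deriv: "smooth_S1 f \<Longrightarrow> smooth_S1 (deriv f)"
proof -
  assume f: "smooth_S1 f"
  have "deriv f (x + 2 * pi) = deriv f x" for x
  proof -
    have "DERIV (\<lambda>y. f (y + 2 * pi)) x :> deriv f (x + 2 * pi)"
      using smooth_S1_differentiable[OF f, of "x + 2 * pi"]
      by (simp add: differentiable_iff_DERIV DERIV_shift)
    moreover have "(\<lambda>y. f (y + 2 * pi)) = f" using f by (auto simp: smooth_S1_def)
    ultimately show ?thesis using DERIV_imp_deriv by metis
  qed
  moreover have "times_differentiable k (deriv f)" for k
    using f by (auto simp: smooth_S1_iff dest: spec[of _ "Suc k"])
  ultimately show ?thesis by (simp add: smooth_S1_iff)
qed

text \<open>As a type of class \<open>comm_ring_1\<close>, smooth periodic functions can serve as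
  coefficients of \<open>fps\<close> and \<open>poly\<close>.\<close>

typedef smooth_fun = "{f :: real \<Rightarrow> real. smooth_S1 f}"
  morphisms val Smooth
  using smooth_S1_const by blast

setup_lifting type_definition_smooth_fun

instantiation smooth_fun :: comm_ring_1
begin

lift_definition zero_smooth_fun :: smooth_fun is "\<lambda>x. 0" by (rule smooth_S1_const)
lift_definition one_smooth_fun :: smooth_fun is "\<lambda>x. 1" by (rule smooth_S1_const)
lift_definition plus_smooth_fun :: "smooth_fun \<Rightarrow> smooth_fun \<Rightarrow> smooth_fun"
  is "\<lambda>f g x. f x + g x" by (rule smooth_S1_add)
lift_definition times_smooth_fun :: "smooth_fun \<Rightarrow> smooth_fun \<Rightarrow> smooth_fun"
  is "\<lambda>f g x. f x * g x" by (rule smooth_S1_mult)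
lift_definition uminus_smooth_fun :: "smooth_fun \<Rightarrow> smooth_fun"
  is "\<lambda>f x. - f x" by (rule smooth_S1_minus)
lift_definition minus_smooth_fun :: "smooth_fun \<Rightarrow> smooth_fun \<Rightarrow> smooth_fun"
  is "\<lambda>f g x. f x - g x"
  using smooth_S1_add[OF _ smooth_S1_minus] by simp

instance
  by standard (transfer; auto simp: algebra_simps fun_eq_iff)+

end

lift_definition const_fun :: "real \<Rightarrow> smooth_fun" is "\<lambda>c x. c" by (rule smooth_S1_const)

lift_definition dx :: "smooth_fun \<Rightarrow> smooth_fun" is deriv by (rule smooth_S1_deriv)

lift_definition circ_integral :: "smooth_fun \<Rightarrow> real" is "\<lambda>f. integral {0..2 * pi} f" .

lemma val_simps [simp]:
  "val 0 x = 0" "val 1 x = 1" "val (f + g) x = val f x + val g x"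
  "val (f * g) x = val f x * val g x" "val (- f) x = - val f x"
  "val (f - g) x = val f x - val g x" "val (const_fun c) x = c"
  by (transfer; simp)+

lemma val_sum [simp]: "val (sum f A) x = (\<Sum>i\<in>A. val (f i) x)"
  by (induction A rule: infinite_finite_induct) auto

lemma val_of_nat [simp]: "val (of_nat k) x = of_nat k"
  by (induction k) auto

lemma val_power [simp]: "val (f ^ k) x = val f x ^ k"
  by (induction k) auto

lemma smooth_fun_eqI: "(\<And>x. val f x = val g x) \<Longrightarrow> f = g"
  by (transfer; auto)

lemma smooth_S1_val [simp]: "smooth_S1 (val f)"
  using val by blast

lemma val_Smooth [simp]: "smooth_S1 f \<Longrightarrow> val (Smooth f) = f"
  by (simp add: Smooth_inverse)

lemma val_dx: "val (dx f) x = deriv (val f) x"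
  by (simp add: dx.rep_eq)

lemma val_DERIV: "DERIV (val f) x :> val (dx f) x"
  using smooth_S1_differentiable[OF smooth_S1_val[of f], of x]
  by (simp add: differentiable_iff_DERIV val_dx)

lemma dx_add: "dx (f + g) = dx f + dx g"
  by (transfer; simp add: deriv_add_fun smooth_S1_differentiable)

lemma dx_mult: "dx (f * g) = dx f * g + f * dx g"
  by (transfer; simp add: deriv_mult_fun smooth_S1_differentiable)

lemma dx_const_fun [simp]: "dx (const_fun c) = 0"
  by (transfer; simp)

lemma const_fun_hom:
  "const_fun 1 = 1" "const_fun 0 = 0" "const_fun (a + b) = const_fun a + const_fun b"
  "const_fun (a * b) = const_fun a * const_fun b" "const_fun (a ^ k) = const_fun a ^ k"
  "const_fun (of_nat k) = of_nat k"
  by (auto intro!: smooth_fun_eqI)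

lemma val_continuous_on: "continuous_on S (val f)"
  using val_DERIV by (meson DERIV_continuous_on has_field_derivative_at_within)

lemma val_integrable: "val f integrable_on {0..2 * pi}"
  by (rule integrable_continuous_interval[OF val_continuous_on])

lemma circ_integral_add: "circ_integral (f + g) = circ_integral f + circ_integral g"
  using integral_add[OF val_integrable val_integrable, of f g]
  by (simp add: circ_integral.rep_eq plus_smooth_fun.rep_eq)

lemma circ_integral_cmult: "circ_integral (const_fun c * f) = c * circ_integral f"
  by (simp add: circ_integral.rep_eq times_smooth_fun.rep_eq const_fun.rep_eq)

lemma circ_integral_0 [simp]: "circ_integral 0 = 0"
  by (simp add: circ_integral.rep_eq zero_smooth_fun.rep_eq)

lemma circ_integral_minus: "circ_integral (- f) = - circ_integral f"
  using circ_integral_add[of f "- f"] by simp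

lemma circ_integral_diff: "circ_integral (f - g) = circ_integral f - circ_integral g"
  using circ_integral_add[of f "- g"] by (simp add: circ_integral_minus)

lemma circ_integral_sum: "circ_integral (sum f A) = (\<Sum>i\<in>A. circ_integral (f i))"
  by (induction A rule: infinite_finite_induct) (auto simp: circ_integral_add)

lemma val_periodic: "val f (x + 2 * pi) = val f x"
  using smooth_S1_val[of f] by (simp add: smooth_S1_def)

lemma circ_integral_dx [simp]: "circ_integral (dx f) = 0"
proof -
  have "(val (dx f) has_integral val f (2 * pi) - val f 0) {0..2 * pi}"
    by (rule fundamental_theorem_of_calculus)
      (auto simp: has_real_derivative_iff_has_vector_derivative[symmetric]
        intro!: has_field_derivative_at_within val_DERIV)
  then show ?thesis
    using val_periodic[of f 0] by (simp add: circ_integral.rep_eq integral_unique)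
qed

lemma val_periodic_int: "val f (x + 2 * pi * of_int k) = val f x"
proof -
  have nat: "val f (x + 2 * pi * of_nat m) = val f x" for m x
  proof (induction m)
    case (Suc m)
    then show ?case using val_periodic[of f "x + 2 * pi * of_nat m"] by (simp add: algebra_simps)
  qed simp
  show ?thesis
  proof (cases k)
    case (nonneg m)
    then show ?thesis using nat[of x m] by simp
  next
    case (neg m)
    then have "x + 2 * pi * of_int k + 2 * pi * of_nat (Suc m) = x"
      by (simp only: of_int_minus of_int_of_nat_eq)
    then show ?thesis
      using nat[of "x + 2 * pi * of_int k" "Suc m"] by (simp only:)
  qed
qed

text \<open>Continuity makes the square vanish on one period; periodicity carries this to every real
  number.\<close>

lemma circ_integral_square_eq_0:
  assumes "circ_integral (f * f) = 0"
  shows "f = 0"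
proof (rule smooth_fun_eqI)
  fix x :: real
  let ?k = "\<lfloor>x / (2 * pi)\<rfloor>"
  \<comment> \<open>The translate of \<open>x\<close> by a multiple of the period that falls into
    the interval of integration.\<close>
  define y where "y = x + 2 * pi * of_int (- ?k)"
  have "of_int ?k * (2 * pi) \<le> x"
    by (simp flip: pos_le_divide_eq)
  moreover have "x \<le> (of_int ?k + 1) * (2 * pi)"
    by (simp flip: pos_divide_le_eq)
  ultimately have y: "y \<in> {0..2 * pi}"
    by (auto simp: y_def algebra_simps)
  have "\<forall>t\<in>{0..2 * pi}. val (f * f) t = 0"
    using assms val_continuous_on[of _ "f * f"]
    by (subst integral_eq_0_iff[symmetric]) (auto simp: circ_integral.rep_eq)
  then have "val (f * f) y = 0" using y by blast
  then show "val f x = val 0 x"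
    using val_periodic_int[of f x "- ?k"] by (simp add: y_def)
qed

section \<open>The Riccati equation over a differential ring\<close>

text \<open>Instances are \<open>dx\<close>, its coefficientwise extension to power series, and its
  extension to polynomials whose indeterminate is treated as a constant.\<close>

locale derivation =
  fixes D :: "'a::comm_ring_1 \<Rightarrow> 'a"
  assumes D_add: "D (a + b) = D a + D b"
    and D_mult: "D (a * b) = D a * b + a * D b"
begin

lemma D_0 [simp]: "D 0 = 0"
  using D_add[of 0 0] by simp

lemma D_1 [simp]: "D 1 = 0"
  using D_mult[of 1 1] by simp

lemma D_minus: "D (- a) = - D a"
  using D_add[of a "- a"] by (simp add: eq_neg_iff_add_eq_0 add.commute)

lemma D_diff: "D (a - b) = D a - D b"
  using D_add[of a "- b"] by (simp add: D_minus)

lemma D_sum: "D (sum f A) = (\<Sum>i\<in>A. D (f i))"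
  by (induction A rule: infinite_finite_induct) (auto simp: D_add)

end

section \<open>Coefficientwise maps and contractions of power series\<close>

definition coeffwise :: "('a::zero \<Rightarrow> 'b::zero) \<Rightarrow> 'a fps \<Rightarrow> 'b fps" where
  "coeffwise \<phi> f = Abs_fps (\<lambda>k. \<phi> (fps_nth f k))"

lemma coeffwise_nth [simp]: "fps_nth (coeffwise \<phi> f) k = \<phi> (fps_nth f k)"
  by (simp add: coeffwise_def)

lemma (in derivation) derivation_coeffwise: "derivation (coeffwise D)"
  by standard (auto simp: fps_eq_iff D_add fps_mult_nth D_sum D_mult sum.distrib)

text \<open>Congruence modulo \<open>fps_X ^ k\<close>, the relation in which contractivity is
  expressed.\<close>

definition agree :: "nat \<Rightarrow> 'a fps \<Rightarrow> 'a fps \<Rightarrow> bool" where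
  "agree k f g \<longleftrightarrow> (\<forall>i<k. fps_nth f i = fps_nth g i)"

lemma agree_refl [simp]: "agree k f f"
  by (simp add: agree_def)

lemma agree_mono: "agree l f g \<Longrightarrow> k \<le> l \<Longrightarrow> agree k f g"
  by (simp add: agree_def)

lemma agree_add: "agree k f f' \<Longrightarrow> agree k g g' \<Longrightarrow> agree k (f + g) (f' + g')"
  by (simp add: agree_def)

lemma agree_diff:
  fixes f :: "'a::ring_1 fps"
  shows "agree k f f' \<Longrightarrow> agree k g g' \<Longrightarrow> agree k (f - g) (f' - g')"
  by (simp add: agree_def)

lemma agree_mult:
  fixes f :: "'a::comm_ring_1 fps"
  shows "agree k f f' \<Longrightarrow> agree k g g' \<Longrightarrow> agree k (f * g) (f' * g')"
  by (auto simp: agree_def fps_mult_nth intro!: sum.cong)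

lemma agree_sum: "(\<And>i. i \<in> A \<Longrightarrow> agree k (f i) (g i)) \<Longrightarrow> agree k (sum f A) (sum g A)"
  by (simp add: agree_def fps_sum_nth)

lemma agree_coeffwise: "agree k f g \<Longrightarrow> agree k (coeffwise \<phi> f) (coeffwise \<phi> g)"
  by (simp add: agree_def)

lemma agree_X_mult:
  fixes f :: "'a::comm_ring_1 fps"
  shows "agree k f g \<Longrightarrow> agree (Suc k) (fps_X * f) (fps_X * g)"
  by (auto simp: agree_def)

text \<open>Coefficient \<open>k\<close> of \<open>\<Phi> f\<close> depends only on the coefficients
  of \<open>f\<close> before \<open>k\<close>, so the coefficients of a fixed point are forced one
  after the other.\<close>

lemma fps_contraction_fixpoint:
  fixes \<Phi> :: "'a::zero fps \<Rightarrow> 'a fps"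
  assumes contr: "\<And>k f g. agree k f g \<Longrightarrow> agree (Suc k) (\<Phi> f) (\<Phi> g)"
  shows "\<exists>!f. \<Phi> f = f"
proof -
  \<comment> \<open>Coefficient \<open>k\<close> is stable from iterate \<open>Suc k\<close>
    on.\<close>
  define h where "h = Abs_fps (\<lambda>k. fps_nth ((\<Phi> ^^ Suc k) 0) k)"
  have iter: "agree m ((\<Phi> ^^ m) 0) h" for m
  proof (induction m rule: less_induct)
    case (less m)
    show ?case unfolding agree_def
    proof (intro allI impI)
      fix i assume "i < m"
      then obtain m' where m: "m = Suc m'" "i \<le> m'" by (cases m) auto
      have "agree i ((\<Phi> ^^ m') 0) ((\<Phi> ^^ i) 0)"
        using less[of m'] less[of i] m by (auto simp: agree_def)
      then have "fps_nth ((\<Phi> ^^ m) 0) i = fps_nth ((\<Phi> ^^ Suc i) 0) i"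
        using contr[of i "(\<Phi> ^^ m') 0" "(\<Phi> ^^ i) 0"] m by (simp add: agree_def)
      then show "fps_nth ((\<Phi> ^^ m) 0) i = fps_nth h i" by (simp add: h_def)
    qed
  qed
  have "\<Phi> h = h"
  proof (rule fps_ext)
    fix k
    have "agree (Suc k) (\<Phi> ((\<Phi> ^^ k) 0)) (\<Phi> h)" by (rule contr[OF iter])
    then show "fps_nth (\<Phi> h) k = fps_nth h k" by (simp add: agree_def h_def)
  qed
  moreover have "f = g" if "\<Phi> f = f" "\<Phi> g = g" for f g
  proof -
    have "agree k f g" for k
    proof (induction k)
      case (Suc k)
      then show ?case using contr[of k f g] that by simp
    qed (simp add: agree_def)
    then show ?thesis by (auto simp: agree_def fps_eq_iff)
  qed
  ultimately show ?thesis by blast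
qed

lemma fps_X_mult_cancel:
  fixes f :: "'a::comm_ring_1 fps"
  assumes "fps_X * f = fps_X * g"
  shows "f = g"
proof (rule fps_ext)
  fix k
  show "fps_nth f k = fps_nth g k"
    using arg_cong[OF assms, of "\<lambda>f. fps_nth f (Suc k)"] by simp
qed

text \<open>
  With \<open>s = z\<inverse>\<close> and \<open>z\<^sup>n = \<lambda>\<close>, identify \<open>\<lambda>\<^sup>-\<^sup>k e\<^sub>r\<close> with \<open>z\<^sup>r\<^sup>-\<^sup>n\<^sup>k\<close>, so that \<open>J\<close> becomes
  multiplication by \<open>z\<close>. Column \<open>c\<close> of \<open>T\<close> is then \<open>z\<^sup>c\<close> times the power series
  \<open>fdb D h c\<close> in \<open>s\<close> (a Faa di Bruno polynomial in \<open>h = \<Sum> f\<^sub>i s\<^sup>i\<close>), and the last column of the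
  gauge equation is \<open>riccati\<close>.
\<close>

definition zstep :: "('a::comm_ring_1 \<Rightarrow> 'a) \<Rightarrow> 'a fps \<Rightarrow> 'a fps \<Rightarrow> 'a fps" where
  "zstep D h f = f + fps_X * (h * f + coeffwise D f)"

primrec fdb :: "('a::comm_ring_1 \<Rightarrow> 'a) \<Rightarrow> 'a fps \<Rightarrow> nat \<Rightarrow> 'a fps" where
  "fdb D h 0 = 1"
| "fdb D h (Suc c) = zstep D h (fdb D h c)"

text \<open>The last column of T(J + u) is z^n Q_0 plus the sum of all u_i z^i Q_i, with Q_i the
  power series of column i; dividing by z^n leaves the power n - i of s.\<close>

definition pot :: "nat \<Rightarrow> (nat \<Rightarrow> 'a::comm_ring_1) \<Rightarrow> nat \<Rightarrow> 'a fps" where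
  "pot n u i = fps_const (u i) * fps_X ^ (n - i)"

definition riccati :: "('a::comm_ring_1 \<Rightarrow> 'a) \<Rightarrow> nat \<Rightarrow> (nat \<Rightarrow> 'a) \<Rightarrow> 'a fps \<Rightarrow> bool" where
  "riccati D n u h \<longleftrightarrow> fdb D h n = 1 + (\<Sum>i<n. pot n u i * fdb D h i)"

text \<open>Splits off \<open>of_nat c * h\<close>, the only term of its order in which the newest
  coefficient of \<open>h\<close> occurs; the remainder sees earlier coefficients only, which is
  \<open>agree_fdb_rem\<close>.\<close>

primrec fdb_rem :: "('a::comm_ring_1 \<Rightarrow> 'a) \<Rightarrow> 'a fps \<Rightarrow> nat \<Rightarrow> 'a fps" where
  "fdb_rem D h 0 = 0"
| "fdb_rem D h (Suc c) =
     fdb_rem D h c + fps_X * (h * (of_nat c * h + fdb_rem D h c)) + coeffwise D (fdb D h c)"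

lemma fdb_expand: "fdb D h c = 1 + fps_X * (of_nat c * h + fdb_rem D h c)"
proof (induction c)
  case (Suc c)
  have "fdb D h (Suc c) = fdb D h c + fps_X * (h * fdb D h c) + fps_X * coeffwise D (fdb D h c)"
    by (simp add: zstep_def algebra_simps)
  also have "h * fdb D h c = h + fps_X * (h * (of_nat c * h + fdb_rem D h c))"
    by (subst Suc) (simp add: algebra_simps)
  finally have "fdb D h (Suc c) - fdb D h c =
      fps_X * (h + fps_X * (h * (of_nat c * h + fdb_rem D h c)) + coeffwise D (fdb D h c))"
    by (simp add: algebra_simps)
  moreover have "fdb D h (Suc c) = fdb D h c + (fdb D h (Suc c) - fdb D h c)" by simp
  ultimately show ?case
    using Suc by (simp add: algebra_simps)
qed simp

lemma fdb_nth_0 [simp]: "fps_nth (fdb D h c) 0 = 1"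
  by (subst fdb_expand) simp

lemma agree_fdb_rem: "agree k h h' \<Longrightarrow> agree (Suc k) (fdb_rem D h c) (fdb_rem D h' c)"
  and agree_fdb: "agree k h h' \<Longrightarrow> agree (Suc k) (fdb D h c) (fdb D h' c)"
proof -
  have *: "agree (Suc k) (fdb_rem D h c) (fdb_rem D h' c) \<Longrightarrow>
      agree (Suc k) (fdb D h c) (fdb D h' c)" if "agree k h h'" for c
    unfolding fdb_expand[of D h c] fdb_expand[of D h' c]
    by (intro agree_add agree_X_mult agree_mult agree_refl that) (rule agree_mono, assumption, simp)
  show rem: "agree (Suc k) (fdb_rem D h c) (fdb_rem D h' c)" if "agree k h h'" for c
  proof (induction c)
    case (Suc c)
    have "agree k (fdb_rem D h c) (fdb_rem D h' c)" using Suc by (rule agree_mono) simp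
    then show ?case unfolding fdb_rem.simps
      by (intro agree_add agree_X_mult agree_mult agree_coeffwise agree_refl that Suc * )
  qed simp
  show "agree (Suc k) (fdb D h c) (fdb D h' c)" if "agree k h h'"
    by (rule *[OF that rem[OF that]])
qed

lemma fps_const_inverse_of_nat:
  fixes \<nu> :: "'a::comm_ring_1"
  assumes "of_nat n * \<nu> = 1"
  shows "of_nat n * fps_const \<nu> = 1"
  using assms by (simp add: fps_eq_iff fps_mult_nth flip: fps_of_nat)

text \<open>Both sides have constant term 1, so a factor s cancels and leaves
  \<open>of_nat n * h = S h - fdb_rem D h n\<close>. Coefficient \<open>k\<close> of the right side
  involves only earlier coefficients of \<open>h\<close>; division by n turns this into a
  contraction. The inverse of n is a hypothesis on the ring so that polynomial coefficients are
  covered.\<close>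

lemma riccati_unique_solution:
  fixes D :: "'a::comm_ring_1 \<Rightarrow> 'a" and \<nu> :: 'a
  assumes \<nu>: "of_nat n * \<nu> = 1"
  shows "\<exists>!h. riccati D n u h"
proof -
  define S :: "'a fps \<Rightarrow> 'a fps" where "S h = (\<Sum>i<n. fps_const (u i) * fps_X ^ (n - i - 1) * fdb D h i)" for h
  have S: "(\<Sum>i<n. pot n u i * fdb D h i) = fps_X * S h" for h
    unfolding S_def sum_distrib_left pot_def
  proof (intro sum.cong refl)
    fix i assume "i \<in> {..<n}"
    then have "(fps_X :: 'a fps) ^ (n - i) = fps_X * fps_X ^ (n - i - 1)"
      by (subst power_Suc[symmetric]) (simp add: Suc_diff_Suc)
    then show "fps_const (u i) * fps_X ^ (n - i) * fdb D h i =
        fps_X * (fps_const (u i) * fps_X ^ (n - i - 1) * fdb D h i)" by (simp only: mult_ac)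
  qed
  have \<nu>': "fps_const \<nu> * (of_nat n * f) = f" "of_nat n * (fps_const \<nu> * f) = f" for f
    using fps_const_inverse_of_nat[OF \<nu>] by (simp_all flip: mult.assoc) (simp add: mult.commute)
  have "riccati D n u h \<longleftrightarrow> fps_const \<nu> * (S h - fdb_rem D h n) = h" for h
  proof -
    have "riccati D n u h \<longleftrightarrow> fps_X * (of_nat n * h + fdb_rem D h n) = fps_X * S h"
      unfolding riccati_def S by (subst fdb_expand) simp
    also have "\<dots> \<longleftrightarrow> of_nat n * h + fdb_rem D h n = S h"
      by (rule iffI, erule fps_X_mult_cancel) simp
    also have "\<dots> \<longleftrightarrow> of_nat n * h = S h - fdb_rem D h n"
      by (auto simp: algebra_simps)
    also have "\<dots> \<longleftrightarrow> fps_const \<nu> * (S h - fdb_rem D h n) = h"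
    proof
      assume "of_nat n * h = S h - fdb_rem D h n"
      then show "fps_const \<nu> * (S h - fdb_rem D h n) = h" using \<nu>'(1)[of h] by simp
    next
      assume "fps_const \<nu> * (S h - fdb_rem D h n) = h"
      then show "of_nat n * h = S h - fdb_rem D h n"
        using \<nu>'(2)[of "S h - fdb_rem D h n"] by simp
    qed
    finally show ?thesis .
  qed
  moreover have "\<exists>!h. fps_const \<nu> * (S h - fdb_rem D h n) = h"
  proof (rule fps_contraction_fixpoint)
    fix k and f g :: "'a fps" assume "agree k f g"
    then show "agree (Suc k) (fps_const \<nu> * (S f - fdb_rem D f n)) (fps_const \<nu> * (S g - fdb_rem D g n))"
      unfolding S_def by (intro agree_mult agree_diff agree_sum agree_refl agree_fdb_rem agree_fdb)
  qed
  ultimately show ?thesis by simp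
qed

text \<open>
  \<open>R k\<close> is \<open>z\<^sup>k\<close> times the \<open>k\<close>-th entry of the row vector dual to the Baker function; the matrices
  \<open>R r * fdb D h c\<close> assemble the resolvent of \<open>\<partial>\<^sub>x + J + u\<close>.
\<close>

definition dual_rows ::
    "('a::comm_ring_1 \<Rightarrow> 'a) \<Rightarrow> nat \<Rightarrow> (nat \<Rightarrow> 'a) \<Rightarrow> 'a fps \<Rightarrow> (nat \<Rightarrow> 'a fps) \<Rightarrow> bool" where
  "dual_rows D n u h R \<longleftrightarrow>
     (\<forall>k. Suc k < n \<longrightarrow> R k + pot n u (Suc k) * R (n - 1) =
        R (Suc k) + fps_X * (h * R (Suc k) - coeffwise D (R (Suc k)))) \<and>
     (\<Sum>k<n. fdb D h k * R k) = 1 \<and>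
     of_nat n * fps_nth (R (n - 1)) 0 = 1"

text \<open>Runs the recursion of \<open>dual_rows\<close> downwards from
  \<open>R (n - 1) = q\<close>; stage \<open>j\<close> is \<open>R (n - 1 - j)\<close>, and
  \<open>fps_X * fps_X ^ j\<close> is the power occurring in \<open>pot\<close> at index
  \<open>n - 1 - j\<close>.\<close>

primrec dual_iter ::
    "('a::comm_ring_1 \<Rightarrow> 'a) \<Rightarrow> nat \<Rightarrow> (nat \<Rightarrow> 'a) \<Rightarrow> 'a fps \<Rightarrow> 'a fps \<Rightarrow> nat \<Rightarrow> 'a fps" where
  "dual_iter D n u h q 0 = q"
| "dual_iter D n u h q (Suc j) = dual_iter D n u h q j +
     fps_X * (h * dual_iter D n u h q j - coeffwise D (dual_iter D n u h q j)
       - fps_const (u (n - 1 - j)) * fps_X ^ j * q)"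

primrec dual_rem ::
    "('a::comm_ring_1 \<Rightarrow> 'a) \<Rightarrow> nat \<Rightarrow> (nat \<Rightarrow> 'a) \<Rightarrow> 'a fps \<Rightarrow> 'a fps \<Rightarrow> nat \<Rightarrow> 'a fps" where
  "dual_rem D n u h q 0 = 0"
| "dual_rem D n u h q (Suc j) = dual_rem D n u h q j +
     (h * dual_iter D n u h q j - coeffwise D (dual_iter D n u h q j)
       - fps_const (u (n - 1 - j)) * fps_X ^ j * q)"

lemma dual_iter_expand: "dual_iter D n u h q j = q + fps_X * dual_rem D n u h q j"
  by (induction j) (simp_all add: algebra_simps)

lemma agree_dual_iter: "agree k q q' \<Longrightarrow> agree k (dual_iter D n u h q j) (dual_iter D n u h q' j)"
proof (induction j)
  case (Suc j)
  then show ?case unfolding dual_iter.simps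
    by (intro agree_add agree_mult agree_diff agree_coeffwise agree_refl)
qed simp

lemma agree_dual_rem: "agree k q q' \<Longrightarrow> agree k (dual_rem D n u h q j) (dual_rem D n u h q' j)"
proof (induction j)
  case (Suc j)
  then show ?case unfolding dual_rem.simps
    by (intro agree_add agree_mult agree_diff agree_coeffwise agree_refl agree_dual_iter)
qed simp

text \<open>The recursion leaves only \<open>q\<close> free. Since every summand of the
  normalization is \<open>q\<close> up to a multiple of s, it reads
  \<open>of_nat n * q = 1 - fps_X * F q\<close>, a contraction after division by n; its constant
  term is the last condition of \<open>dual_rows\<close>.\<close>

lemma dual_rows_exist:
  fixes D :: "'a::comm_ring_1 \<Rightarrow> 'a" and \<nu> :: 'a
  assumes \<nu>: "of_nat n * \<nu> = 1"
  shows "\<exists>R. dual_rows D n u h R"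
proof -
  define A where "A k = of_nat k * h + fdb_rem D h k" for k
  define F :: "'a fps \<Rightarrow> 'a fps" where "F q = (\<Sum>k<n. dual_rem D n u h q (n - 1 - k) + A k * dual_iter D n u h q (n - 1 - k))" for q
  have sum: "(\<Sum>k<n. fdb D h k * dual_iter D n u h q (n - 1 - k)) = of_nat n * q + fps_X * F q" for q
  proof -
    have "fdb D h k * dual_iter D n u h q (n - 1 - k) =
        q + fps_X * (dual_rem D n u h q (n - 1 - k) + A k * dual_iter D n u h q (n - 1 - k))" for k
    proof -
      have "fdb D h k * dual_iter D n u h q (n - 1 - k) =
          dual_iter D n u h q (n - 1 - k) + fps_X * (A k * dual_iter D n u h q (n - 1 - k))"
        unfolding A_def by (subst fdb_expand) (simp add: algebra_simps)
      then show ?thesis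
        by (subst (asm) (2) dual_iter_expand) (simp add: algebra_simps)
    qed
    then have "(\<Sum>k<n. fdb D h k * dual_iter D n u h q (n - 1 - k)) = (\<Sum>k<n. q +
        fps_X * (dual_rem D n u h q (n - 1 - k) + A k * dual_iter D n u h q (n - 1 - k)))"
      by (intro sum.cong refl)
    then show ?thesis by (simp only: F_def sum.distrib[of "\<lambda>k. q"] sum_distrib_left[symmetric]) simp
  qed
  have \<nu>': "fps_const \<nu> * (of_nat n * f) = f" "of_nat n * (fps_const \<nu> * f) = f" for f
    using fps_const_inverse_of_nat[OF \<nu>] by (simp_all flip: mult.assoc) (simp add: mult.commute)
  have "\<exists>!q. fps_const \<nu> * (1 - fps_X * F q) = q"
  proof (rule fps_contraction_fixpoint)
    fix k and f g :: "'a fps" assume "agree k f g"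
    then show "agree (Suc k) (fps_const \<nu> * (1 - fps_X * F f)) (fps_const \<nu> * (1 - fps_X * F g))"
      unfolding F_def by (intro agree_mult agree_diff agree_X_mult agree_sum agree_add agree_refl
          agree_dual_rem agree_dual_iter)
  qed
  then obtain q where q: "fps_const \<nu> * (1 - fps_X * F q) = q" by blast
  have nq: "of_nat n * q = 1 - fps_X * F q"
    using \<nu>'(2)[of "1 - fps_X * F q"] q by simp
  have "dual_rows D n u h (\<lambda>k. dual_iter D n u h q (n - 1 - k))"
    unfolding dual_rows_def
  proof (intro conjI allI impI)
    fix k assume k: "Suc k < n"
    define j where "j = n - 1 - Suc k"
    have "n - 1 - k = Suc j" "n - Suc k = Suc j" "n - 1 - j = Suc k" "n - 1 - Suc k = j"
      using k by (auto simp: j_def)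
    then show "dual_iter D n u h q (n - 1 - k) + pot n u (Suc k) * dual_iter D n u h q (n - 1 - (n - 1)) =
        dual_iter D n u h q (n - 1 - Suc k) + fps_X * (h * dual_iter D n u h q (n - 1 - Suc k) -
          coeffwise D (dual_iter D n u h q (n - 1 - Suc k)))"
      by (simp add: pot_def algebra_simps)
  next
    show "(\<Sum>k<n. fdb D h k * dual_iter D n u h q (n - 1 - k)) = 1"
      unfolding sum nq by simp
    show "of_nat n * fps_nth (dual_iter D n u h q (n - 1 - (n - 1))) 0 = 1"
      using arg_cong[OF nq, of "\<lambda>f. fps_nth f 0"] by (simp add: fps_mult_nth flip: fps_of_nat)
  qed
  then show ?thesis by blast
qed

text \<open>Summation by parts: the recursion for \<open>R\<close> matches each term with the next
  one, leaving the two ends and the contribution of the potential.\<close>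

lemma dual_rows_telescope:
  fixes Y :: "nat \<Rightarrow> 'a::comm_ring_1 fps"
  assumes R: "dual_rows D n u h R" and n: "n > 0"
  shows "(\<Sum>c<n. Y (Suc c) * R c - Y c * (R c + fps_X * (h * R c - coeffwise D (R c)))) =
    Y n * R (n - 1) - Y 0 * (R 0 + fps_X * (h * R 0 - coeffwise D (R 0)) - pot n u 0 * R (n - 1))
    - (\<Sum>i<n. pot n u i * Y i) * R (n - 1)"
proof -
  obtain m where m: "n = Suc m" using n by (cases n) auto
  define B where "B c = R c + fps_X * (h * R c - coeffwise D (R c))" for c
  have B: "B (Suc k) = R k + pot n u (Suc k) * R m" if "k < m" for k
    using R that m unfolding dual_rows_def B_def by auto
  have pot: "(\<Sum>i<n. pot n u i * Y i) = pot n u 0 * Y 0 + (\<Sum>k<m. pot n u (Suc k) * Y (Suc k))"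
    unfolding m by (rule sum.lessThan_Suc_shift)
  have "(\<Sum>c<n. Y (Suc c) * R c - Y c * B c) =
      (\<Sum>c<n. Y (Suc c) * R c) - (\<Sum>c<n. Y c * B c)"
    by (rule sum_subtractf)
  also have "(\<Sum>c<n. Y c * B c) = Y 0 * B 0 + (\<Sum>k<m. Y (Suc k) * (R k + pot n u (Suc k) * R m))"
    unfolding m sum.lessThan_Suc_shift by (simp add: B m[symmetric])
  also have "(\<Sum>k<m. Y (Suc k) * (R k + pot n u (Suc k) * R m)) =
      (\<Sum>k<m. Y (Suc k) * R k) + (\<Sum>k<m. pot n u (Suc k) * Y (Suc k)) * R m"
    by (simp add: algebra_simps sum.distrib sum_distrib_left)
  also have "(\<Sum>c<n. Y (Suc c) * R c) = (\<Sum>k<m. Y (Suc k) * R k) + Y n * R m"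
    by (simp add: m)
  finally show ?thesis
    using pot unfolding B_def[symmetric] by (simp add: m algebra_simps)
qed

context derivation
begin

lemma coeffwise_D_mult: "coeffwise D (f * g) = coeffwise D f * g + f * coeffwise D g"
  using derivation.D_mult[OF derivation_coeffwise] .

lemma coeffwise_D_sum: "coeffwise D (sum f A) = (\<Sum>i\<in>A. coeffwise D (f i))"
  using derivation.D_sum[OF derivation_coeffwise] .

text \<open>The relation that closes the recursion into a cycle. It is not imposed in
  \<open>dual_rows\<close> but follows by differentiating the normalization and inserting the
  Riccati equation at the upper end of the telescoping sum.\<close>

lemma dual_rows_0:
  assumes h: "riccati D n u h" and R: "dual_rows D n u h R" and n: "n > 0"
  shows "R 0 + fps_X * (h * R 0 - coeffwise D (R 0)) = R (n - 1) + pot n u 0 * R (n - 1)"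
proof -
  have "0 = fps_X * coeffwise D (\<Sum>k<n. fdb D h k * R k)"
    using R derivation.D_1[OF derivation_coeffwise] by (simp add: dual_rows_def)
  also have "\<dots> = (\<Sum>c<n. fdb D h (Suc c) * R c -
      fdb D h c * (R c + fps_X * (h * R c - coeffwise D (R c))))"
    unfolding coeffwise_D_sum sum_distrib_left
    by (intro sum.cong refl) (simp add: coeffwise_D_mult zstep_def algebra_simps)
  also have "\<dots> = R (n - 1)
      - (R 0 + fps_X * (h * R 0 - coeffwise D (R 0)) - pot n u 0 * R (n - 1))"
    unfolding dual_rows_telescope[OF R n] h[unfolded riccati_def] by (simp add: algebra_simps)
  finally show ?thesis by (simp add: algebra_simps)
qed

text \<open>\<open>Y\<close> is the first-order change of \<open>fdb\<close> when \<open>h\<close>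
  changes by \<open>g\<close> and \<open>u\<close> by \<open>w\<close>; the hypotheses linearize
  \<open>zstep\<close> and \<open>riccati\<close>. Pairing with the dual row \<open>R\<close>
  eliminates \<open>Y\<close> up to a total derivative.\<close>

lemma variation_identity:
  assumes R: "dual_rows D n u h R" and n: "n > 0"
    and Y0: "Y 0 = 0"
    and Y: "\<And>c. c < n \<Longrightarrow> Y (Suc c) = zstep D h (Y c) + fps_X * g * fdb D h c"
    and Yn: "Y n = (\<Sum>i<n. pot n w i * fdb D h i) + (\<Sum>i<n. pot n u i * Y i)"
  shows "fps_X * g = (\<Sum>i<n. pot n w i * (R (n - 1) * fdb D h i))
    - fps_X * coeffwise D (\<Sum>c<n. Y c * R c)"
proof -
  have "fps_X * g = (\<Sum>c<n. fps_X * g * (fdb D h c * R c))"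
    using R by (simp add: dual_rows_def flip: sum_distrib_left)
  also have "\<dots> = (\<Sum>c<n. (Y (Suc c) * R c - Y c * (R c + fps_X * (h * R c - coeffwise D (R c))))
      - fps_X * coeffwise D (Y c * R c))"
    by (intro sum.cong refl) (simp add: Y coeffwise_D_mult zstep_def algebra_simps)
  also have "\<dots> = (\<Sum>c<n. Y (Suc c) * R c - Y c * (R c + fps_X * (h * R c - coeffwise D (R c))))
      - fps_X * coeffwise D (\<Sum>c<n. Y c * R c)"
    unfolding coeffwise_D_sum sum_distrib_left by (rule sum_subtractf)
  also have "\<dots> = (\<Sum>i<n. pot n w i * fdb D h i) * R (n - 1) - fps_X * coeffwise D (\<Sum>c<n. Y c * R c)"
    unfolding dual_rows_telescope[OF R n] by (simp add: Y0 Yn algebra_simps)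
  also have "(\<Sum>i<n. pot n w i * fdb D h i) * R (n - 1) =
      (\<Sum>i<n. pot n w i * (R (n - 1) * fdb D h i))"
    by (simp add: sum_distrib_left sum_distrib_right algebra_simps)
  finally show ?thesis .
qed

text \<open>One entry of the statement that the rank-one matrix formed from \<open>R\<close> and
  \<open>fdb\<close> commutes with the operator with potential J + u. For \<open>r = 0\<close>,
  where J wraps around to the last row, the relation is \<open>dual_rows_0\<close>.\<close>

lemma resolvent_step:
  assumes h: "riccati D n u h" and R: "dual_rows D n u h R" and r: "r < n"
  shows "(if r = 0 then R (n - 1) else R (r - 1)) * fdb D h c + pot n u r * (R (n - 1) * fdb D h c)
    + fps_X * coeffwise D (R r * fdb D h c) = R r * fdb D h (Suc c)"
proof -
  have "(if r = 0 then R (n - 1) else R (r - 1)) + pot n u r * R (n - 1) =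
      R r + fps_X * (h * R r - coeffwise D (R r))"
    using dual_rows_0[OF h R] R r unfolding dual_rows_def by (cases r) auto
  from arg_cong[OF this, of "\<lambda>f. f * fdb D h c"] show ?thesis
    by (simp add: coeffwise_D_mult zstep_def algebra_simps)
qed

end

section \<open>The operators \<open>P\<^sub>u\<close> and \<open>J\<^sub>1\<close>\<close>

interpretation dx: derivation dx
  by standard (rule dx_add, rule dx_mult)

lemmas dx_simps = dx.D_add dx.D_mult dx.D_minus dx.D_diff dx.D_sum

type_synonym fmat = "nat \<Rightarrow> nat \<Rightarrow> smooth_fun"

definition fmat_mult :: "nat \<Rightarrow> fmat \<Rightarrow> fmat \<Rightarrow> fmat" where
  "fmat_mult n X Y r c = (\<Sum>k<n. X r k * Y k c)"

definition fmat_trace :: "nat \<Rightarrow> fmat \<Rightarrow> smooth_fun" where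
  "fmat_trace n X = (\<Sum>k<n. X k k)"

definition bu_mat :: "nat \<Rightarrow> (nat \<Rightarrow> smooth_fun) \<Rightarrow> fmat" where
  "bu_mat n u r c = (if r = Suc c then 1 else 0) + (if c = n - 1 then u r else 0)"

definition dcom :: "nat \<Rightarrow> (nat \<Rightarrow> smooth_fun) \<Rightarrow> fmat \<Rightarrow> fmat" where
  "dcom n u X r c = dx (X r c) + (fmat_mult n (bu_mat n u) X r c - fmat_mult n X (bu_mat n u) r c)"

definition corner :: "nat \<Rightarrow> fmat" where
  "corner n r c = (if r = 0 \<and> c = n - 1 then 1 else 0)"

definition ecom :: "nat \<Rightarrow> fmat \<Rightarrow> fmat" where
  "ecom n X r c = fmat_mult n (corner n) X r c - fmat_mult n X (corner n) r c"

lemma fmat_mult_assoc: "fmat_mult n (fmat_mult n X Y) Z r c = fmat_mult n X (fmat_mult n Y Z) r c"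
proof -
  have "fmat_mult n (fmat_mult n X Y) Z r c = (\<Sum>k<n. \<Sum>l<n. X r l * Y l k * Z k c)"
    by (simp add: fmat_mult_def sum_distrib_right)
  also have "\<dots> = (\<Sum>l<n. \<Sum>k<n. X r l * Y l k * Z k c)" by (rule sum.swap)
  also have "\<dots> = fmat_mult n X (fmat_mult n Y Z) r c" by (simp add: fmat_mult_def sum_distrib_left mult.assoc)
  finally show ?thesis .
qed

lemma fmat_trace_mult_commute: "fmat_trace n (fmat_mult n X Y) = fmat_trace n (fmat_mult n Y X)"
  unfolding fmat_trace_def fmat_mult_def by (subst sum.swap) (simp add: mult.commute)

text \<open>Leibniz rule plus invariance of the trace form under commutators. After integration it
  makes \<open>dcom\<close> skew-adjoint.\<close>

lemma fmat_trace_mult_dcom: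
  "fmat_trace n (fmat_mult n (dcom n u X) Y) + fmat_trace n (fmat_mult n X (dcom n u Y)) = dx (fmat_trace n (fmat_mult n X Y))"
proof -
  let ?B = "bu_mat n u"
  have 1: "fmat_trace n (fmat_mult n (dcom n u X) Y) = fmat_trace n (fmat_mult n (\<lambda>r c. dx (X r c)) Y)
      + fmat_trace n (fmat_mult n (fmat_mult n ?B X) Y) - fmat_trace n (fmat_mult n (fmat_mult n X ?B) Y)"
    by (simp add: fmat_trace_def fmat_mult_def[of n _ Y] dcom_def algebra_simps sum.distrib sum_subtractf)
  have 2: "fmat_trace n (fmat_mult n X (dcom n u Y)) = fmat_trace n (fmat_mult n X (\<lambda>r c. dx (Y r c)))
      + fmat_trace n (fmat_mult n X (fmat_mult n ?B Y)) - fmat_trace n (fmat_mult n X (fmat_mult n Y ?B))"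
    by (simp add: fmat_trace_def fmat_mult_def[of n X] dcom_def algebra_simps sum.distrib sum_subtractf)
  have 3: "dx (fmat_trace n (fmat_mult n X Y)) = fmat_trace n (fmat_mult n (\<lambda>r c. dx (X r c)) Y) + fmat_trace n (fmat_mult n X (\<lambda>r c. dx (Y r c)))"
    by (simp add: fmat_trace_def fmat_mult_def dx_simps sum.distrib)
  have 4: "fmat_trace n (fmat_mult n (fmat_mult n X ?B) Y) = fmat_trace n (fmat_mult n X (fmat_mult n ?B Y))"
    by (simp add: fmat_trace_def fmat_mult_assoc)
  have "fmat_trace n (fmat_mult n X (fmat_mult n Y ?B)) = fmat_trace n (fmat_mult n (fmat_mult n X Y) ?B)"
    by (simp add: fmat_trace_def fmat_mult_assoc)
  also have "\<dots> = fmat_trace n (fmat_mult n ?B (fmat_mult n X Y))" by (rule fmat_trace_mult_commute)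
  also have "\<dots> = fmat_trace n (fmat_mult n (fmat_mult n ?B X) Y)" by (simp add: fmat_trace_def fmat_mult_assoc)
  finally show ?thesis using 1 2 3 4 by simp
qed

lemma fmat_mult_bu_left:
  assumes "r < n"
  shows "fmat_mult n (bu_mat n u) X r c = (if r = 0 then 0 else X (r - 1) c) + u r * X (n - 1) c"
proof -
  have "fmat_mult n (bu_mat n u) X r c =
      (\<Sum>k<n. if r = Suc k then X k c else 0) + (\<Sum>k<n. if k = n - 1 then u r * X k c else 0)"
    unfolding fmat_mult_def sum.distrib[symmetric] by (intro sum.cong) (auto simp: bu_mat_def algebra_simps)
  also have "(\<Sum>k<n. if r = Suc k then X k c else 0) = (if r = 0 then 0 else X (r - 1) c)"
  proof (cases r)
    case (Suc r')
    then have "(\<Sum>k<n. if r = Suc k then X k c else 0) = (\<Sum>k<n. if k = r' then X k c else 0)"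
      by (intro sum.cong) auto
    then show ?thesis using assms Suc by simp
  qed simp
  also have "(\<Sum>k<n. if k = n - 1 then u r * X k c else 0) = u r * X (n - 1) c"
    using assms by simp
  finally show ?thesis .
qed

lemma fmat_mult_bu_right:
  assumes "c < n"
  shows "fmat_mult n X (bu_mat n u) r c = (if c = n - 1 then (\<Sum>k<n. X r k * u k) else X r (Suc c))"
proof -
  have "fmat_mult n X (bu_mat n u) r c =
      (\<Sum>k<n. if k = Suc c then X r k else 0) + (\<Sum>k<n. if c = n - 1 then X r k * u k else 0)"
    unfolding fmat_mult_def sum.distrib[symmetric] by (intro sum.cong) (auto simp: bu_mat_def algebra_simps)
  then show ?thesis using assms by auto
qed

lemma ecom_eq:
  assumes "r < n"
  shows "ecom n X r c = (if r = 0 then X (n - 1) c else 0) - (if c = n - 1 then X r 0 else 0)"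
proof -
  have "fmat_mult n (corner n) X r c = (\<Sum>k<n. if k = n - 1 then (if r = 0 then X k c else 0) else 0)"
    unfolding fmat_mult_def corner_def by (intro sum.cong) auto
  moreover have "fmat_mult n X (corner n) r c = (\<Sum>k<n. if k = 0 then (if c = n - 1 then X r k else 0) else 0)"
    unfolding fmat_mult_def corner_def by (intro sum.cong) auto
  ultimately show ?thesis using assms by (simp add: ecom_def)
qed

text \<open>Only last rows and first columns enter, so either matrix may be exchanged for one that
  agrees there.\<close>

lemma fmat_trace_mult_ecom:
  assumes "n > 0"
  shows "fmat_trace n (fmat_mult n (ecom n X) Y) = (\<Sum>c<n. X (n - 1) c * Y c 0 - Y (n - 1) c * X c 0)"
proof -
  have "fmat_trace n (fmat_mult n (ecom n X) Y) = (\<Sum>r<n. \<Sum>c<n.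
      (if r = 0 then X (n - 1) c * Y c r else 0) - (if c = n - 1 then X r 0 * Y c r else 0))"
    unfolding fmat_trace_def fmat_mult_def by (intro sum.cong refl) (auto simp: ecom_eq algebra_simps)
  also have "\<dots> = (\<Sum>r<n. if r = 0 then (\<Sum>c<n. X (n - 1) c * Y c r) else 0)
      - (\<Sum>r<n. X r 0 * Y (n - 1) r)"
    unfolding sum_subtractf using assms
    by (intro arg_cong2[of _ _ _ _ minus] sum.cong refl) auto
  also have "\<dots> = (\<Sum>c<n. X (n - 1) c * Y c 0) - (\<Sum>c<n. Y (n - 1) c * X c 0)"
    using assms by (simp add: mult.commute)
  finally show ?thesis by (simp add: sum_subtractf)
qed

lemma fmat_trace_dcom: "fmat_trace n (dcom n u X) = dx (fmat_trace n X)"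
  using fmat_trace_mult_commute[of n "bu_mat n u" X]
  by (simp add: fmat_trace_def dcom_def sum.distrib sum_subtractf dx_simps)

lemma fmat_trace_ecom: "fmat_trace n (ecom n X) = 0"
  using fmat_trace_mult_commute[of n "corner n" X]
  by (simp add: fmat_trace_def ecom_def sum_subtractf)

section \<open>Matrices generated by their first column\<close>

definition gstep :: "nat \<Rightarrow> (nat \<Rightarrow> smooth_fun) \<Rightarrow> (nat \<Rightarrow> smooth_fun) \<Rightarrow> nat \<Rightarrow> smooth_fun" where
  "gstep n u y r = dx (y r) + (if r = 0 then 0 else y (r - 1)) + u r * y (n - 1)"

abbreviation giter :: "nat \<Rightarrow> (nat \<Rightarrow> smooth_fun) \<Rightarrow> (nat \<Rightarrow> smooth_fun) \<Rightarrow> fmat" where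
  "giter n u p \<equiv> \<lambda>r c. (gstep n u ^^ c) p r"

text \<open>Right multiplication by b shifts columns, so vanishing of the commutator in a column
  before the last determines the next column by \<open>gstep\<close>.\<close>

lemma dcom_column:
  assumes "r < n" "Suc c < n"
  shows "dcom n u X r c = gstep n u (\<lambda>r. X r c) r - X r (Suc c)"
  using assms by (simp add: dcom_def gstep_def fmat_mult_bu_left fmat_mult_bu_right)

lemma gstep_cong: "(\<And>i. i < n \<Longrightarrow> y i = y' i) \<Longrightarrow> r < n \<Longrightarrow> gstep n u y r = gstep n u y' r"
  by (simp add: gstep_def)

lemma giter_add: "giter n u (\<lambda>r. p r + q r) r c = giter n u p r c + giter n u q r c"
proof (induction c arbitrary: r)
  case (Suc c)
  then show ?case by (simp add: gstep_def dx_simps algebra_simps)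
qed simp

lemma of_nat_smooth_cancel:
  assumes "n > 0" "of_nat n * (f :: smooth_fun) = 0"
  shows "f = 0"
proof (rule smooth_fun_eqI)
  fix x show "val f x = val 0 x"
    using assms(1) arg_cong[OF assms(2), of "\<lambda>g. val g x"] by simp
qed

text \<open>The defining conditions of P_u(v) = C on entries: traceless, prescribed last row, and
  commutator in V_n. Entries outside the n by n block are left unconstrained.\<close>

definition is_P :: "nat \<Rightarrow> (nat \<Rightarrow> smooth_fun) \<Rightarrow> (nat \<Rightarrow> smooth_fun) \<Rightarrow> fmat \<Rightarrow> bool" where
  "is_P n u v C \<longleftrightarrow> fmat_trace n C = 0 \<and> (\<forall>c<n - 1. C (n - 1) c = v c) \<and>
     (\<forall>r<n. \<forall>c<n. \<not> (r < n - 1 \<and> c = n - 1) \<longrightarrow> dcom n u C r c = 0)"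

locale potential =
  fixes n :: nat and u :: "nat \<Rightarrow> smooth_fun"
  assumes n_pos: "n > 0" and u_last: "u (n - 1) = 0"
begin

text \<open>Each step moves a column down by one and adds its derivative. The lowest band therefore
  stays \<open>p m\<close>, and the band above it gains one copy of \<open>dx (p m)\<close> per
  step.\<close>

lemma giter_band:
  assumes m: "m < n" and p: "\<And>i. i < n \<Longrightarrow> m < i \<Longrightarrow> p i = 0"
  shows giter_band_0: "r < n \<Longrightarrow> c + m < r \<Longrightarrow> giter n u p r c = 0"
    and giter_band_1: "c + m < n \<Longrightarrow> giter n u p (c + m) c = p m"
    and giter_band_2: "c + m \<le> n \<Longrightarrow> 0 < m \<Longrightarrow>
      giter n u p (c + m - 1) c = of_nat c * dx (p m) + p (m - 1)"
proof -
  have "(\<forall>r<n. c + m < r \<longrightarrow> giter n u p r c = 0) \<and> (c + m < n \<longrightarrow> giter n u p (c + m) c = p m) \<and>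
     (c + m \<le> n \<and> 0 < m \<longrightarrow> giter n u p (c + m - 1) c = of_nat c * dx (p m) + p (m - 1))" for c
  proof (induction c)
    case 0
    then show ?case using p by auto
  next
    case (Suc c)
    \<comment> \<open>On these rows the potential is invisible: above the last row the bottom entry
      of the column is still zero, and in the last row \<open>u_last\<close> applies.\<close>
    have uz: "u r * giter n u p (n - 1) c = 0" if "c + m \<le> r" "r < n" for r
      using Suc that u_last by (cases "r = n - 1") auto
    have step: "giter n u p r (Suc c) = dx (giter n u p r c) + giter n u p (r - 1) c"
      if "c + m \<le> r" "r < n" "0 < r" for r
      using uz[OF that(1,2)] that by (simp add: gstep_def)
    have "giter n u p r (Suc c) = 0" if "r < n" "Suc c + m < r" for r
      using Suc that by (subst step) auto
    moreover have "giter n u p (Suc c + m) (Suc c) = p m" if "Suc c + m < n"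
      using Suc that by (subst step) auto
    moreover have "giter n u p (Suc c + m - 1) (Suc c) = of_nat (Suc c) * dx (p m) + p (m - 1)"
      if "Suc c + m \<le> n" "0 < m"
      using Suc that by (subst step) (auto simp: algebra_simps)
    ultimately show ?case by blast
  qed
  then show "r < n \<Longrightarrow> c + m < r \<Longrightarrow> giter n u p r c = 0"
    "c + m < n \<Longrightarrow> giter n u p (c + m) c = p m"
    "c + m \<le> n \<Longrightarrow> 0 < m \<Longrightarrow> giter n u p (c + m - 1) c = of_nat c * dx (p m) + p (m - 1)"
    by blast+
qed

lemma is_P_giter:
  assumes C: "is_P n u v C" and "r < n" "c < n"
  shows "C r c = giter n u (\<lambda>r. C r 0) r c"
  using assms(2,3)
proof (induction c arbitrary: r)
  case (Suc c)
  have "\<not> (r < n - 1 \<and> c = n - 1)" using Suc.prems by auto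
  then have "dcom n u C r c = 0"
    using C Suc.prems Suc_lessD unfolding is_P_def by blast
  then have "C r (Suc c) = gstep n u (\<lambda>r. C r c) r"
    using Suc by (simp add: dcom_column)
  also have "\<dots> = gstep n u (\<lambda>r. giter n u (\<lambda>r. C r 0) r c) r"
    using Suc by (intro gstep_cong) auto
  finally show ?case by simp
qed simp

text \<open>The columns before the last are correct by construction. The corner entry of the
  commutator then comes for free: the trace of the commutator is the derivative of the trace, hence
  zero, and all other diagonal entries vanish.\<close>

lemma is_P_giterI:
  assumes v: "\<And>c. c < n - 1 \<Longrightarrow> giter n u p (n - 1) c = v c"
    and trace: "fmat_trace n (giter n u p) = 0"
  shows "is_P n u v (giter n u p)"
proof -
  have z: "dcom n u (giter n u p) r c = 0" if "r < n" "Suc c < n" for r c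
    using that by (simp add: dcom_column)
  have "0 = fmat_trace n (dcom n u (giter n u p))" by (simp add: fmat_trace_dcom trace)
  also have "\<dots> = (\<Sum>k<n. if k = n - 1 then dcom n u (giter n u p) k k else 0)"
    unfolding fmat_trace_def
  proof (intro sum.cong refl)
    fix k assume "k \<in> {..<n}"
    then show "dcom n u (giter n u p) k k = (if k = n - 1 then dcom n u (giter n u p) k k else 0)"
      using z[of k k] by auto
  qed
  also have "\<dots> = dcom n u (giter n u p) (n - 1) (n - 1)" using n_pos by simp
  finally have last: "dcom n u (giter n u p) (n - 1) (n - 1) = 0" by simp
  have "dcom n u (giter n u p) r c = 0" if "r < n" "c < n" "\<not> (r < n - 1 \<and> c = n - 1)" for r c
  proof (cases "Suc c < n")
    case False
    with that have "c = n - 1" "r = n - 1" by auto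
    then show ?thesis using last by simp
  qed (use z that in auto)
  then show ?thesis using v trace by (simp add: is_P_def)
qed

lemma fmat_trace_giter_single:
  assumes "\<And>i. i < n \<Longrightarrow> 0 < i \<Longrightarrow> p i = 0"
  shows "fmat_trace n (giter n u p) = of_nat n * p 0"
proof -
  have "giter n u p c c = p 0" if "c < n" for c
    using giter_band_1[of 0 p c] assms that n_pos by auto
  then show ?thesis by (simp add: fmat_trace_def)
qed

lemma is_P_diff:
  assumes "is_P n u v C" "is_P n u v' C'"
  shows "is_P n u (\<lambda>c. v c - v' c) (\<lambda>r c. C r c - C' r c)"
proof -
  have "dcom n u (\<lambda>r c. C r c - C' r c) r c = dcom n u C r c - dcom n u C' r c" for r c
    by (simp add: dcom_def fmat_mult_def dx_simps algebra_simps sum_subtractf)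
  then show ?thesis using assms by (auto simp: is_P_def fmat_trace_def sum_subtractf)
qed

lemma is_P_cmult:
  assumes "is_P n u v C"
  shows "is_P n u (\<lambda>c. const_fun a * v c) (\<lambda>r c. const_fun a * C r c)"
proof -
  have "dcom n u (\<lambda>r c. const_fun a * C r c) r c = const_fun a * dcom n u C r c" for r c
    by (simp add: dcom_def fmat_mult_def dx_simps algebra_simps sum_distrib_left)
  then show ?thesis using assms by (auto simp: is_P_def fmat_trace_def simp flip: sum_distrib_left)
qed

text \<open>Once the lower entries of the first column vanish, \<open>giter_band_1\<close>
  identifies the next entry upwards with the next entry of the last row.\<close>

lemma is_P_first_column_0:
  assumes C: "is_P n u v C"
    and v: "\<And>c. c < k \<Longrightarrow> v c = 0" and k: "k \<le> n - 1" and r: "n - 1 - k < r" "r < n"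
  shows "C r 0 = 0"
  using k r v
proof (induction k arbitrary: r)
  case (Suc k)
  show ?case
  proof (cases "r = n - 1 - k")
    case True
    then have kr: "k + r = n - 1" "r < n" "k < n - 1" using Suc.prems by auto
    have "C i 0 = 0" if "i < n" "r < i" for i
      using Suc.IH[of i] Suc.prems True that by simp
    then have "giter n u (\<lambda>r. C r 0) (k + r) k = C r 0"
      using kr by (intro giter_band_1) auto
    moreover have "C (n - 1) k = giter n u (\<lambda>r. C r 0) (n - 1) k"
      using kr by (intro is_P_giter[OF C]) auto
    moreover have "C (n - 1) k = v k" using C kr(3) unfolding is_P_def by blast
    ultimately show ?thesis using kr(1) Suc.prems(4)[of k] by simp
  next
    case False
    then show ?thesis using Suc.IH[of r] Suc.prems by simp
  qed
qed auto

text \<open>For the difference of two solutions the zero last row kills the first column below its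
  top entry, and the trace is n times that top entry.\<close>

lemma is_P_unique:
  assumes C: "is_P n u v C" "is_P n u v C'"
    and r: "r < n" "c < n"
  shows "C r c = C' r c"
proof -
  define E where "E r c = C r c - C' r c" for r c
  have E: "is_P n u (\<lambda>c. 0) E"
    using is_P_diff[OF C] by (simp add: E_def[abs_def])
  have p: "E i 0 = 0" if "i < n" "0 < i" for i
    using that by (intro is_P_first_column_0[OF E, of "n - 1"]) auto
  have "0 = fmat_trace n E" using E by (simp add: is_P_def)
  also have "\<dots> = fmat_trace n (giter n u (\<lambda>r. E r 0))"
    unfolding fmat_trace_def by (intro sum.cong refl is_P_giter[OF E]) auto
  also have "\<dots> = of_nat n * E 0 0" using p by (intro fmat_trace_giter_single) auto
  finally have E0: "E 0 0 = 0" using of_nat_smooth_cancel[OF n_pos] by metis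
  have "giter n u (\<lambda>r. E r 0) r c = 0" if "r < n" for r
    using that
  proof (induction c arbitrary: r)
    case 0
    then show ?case using p E0 by (cases "r = 0") auto
  next
    case (Suc c)
    then show ?case using n_pos by (simp add: gstep_def)
  qed
  then show ?thesis
    using is_P_giter[OF E r] r by (simp add: E_def)
qed

text \<open>The last row is adjusted column by column: changing row \<open>n - 1 - k\<close> of the
  first column alters column \<open>k\<close> by exactly that amount and no earlier one. A change of
  the top entry leaves the prescribed part of the last row alone and repairs the trace.\<close>

lemma is_P_exists: "\<exists>C. is_P n u v C"
proof -
  have "\<exists>p. \<forall>c<k. giter n u p (n - 1) c = v c" if "k \<le> n - 1" for k
    using that
  proof (induction k)
    case (Suc k)
    then obtain p where p: "\<forall>c<k. giter n u p (n - 1) c = v c" by auto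
    define m where "m = n - 1 - k"
    define e where "e i = (if i = m then v k - giter n u p (n - 1) k else 0)" for i
    have m: "m < n" "n - 1 = k + m" using Suc n_pos by (auto simp: m_def)
    have e: "\<And>i. i < n \<Longrightarrow> m < i \<Longrightarrow> e i = 0" by (simp add: e_def)
    have "giter n u (\<lambda>r. p r + e r) (n - 1) c = v c" if "c < Suc k" for c
    proof (cases "c = k")
      case True
      have "giter n u e (k + m) k = e m"
        using m n_pos by (intro giter_band_1 e) auto
      then show ?thesis
        using True m(2) unfolding giter_add by (simp add: e_def[of m])
    next
      case False
      then have "giter n u e (n - 1) c = 0"
        using that m by (intro giter_band_0[OF m(1) e]) auto
      then show ?thesis using p that False unfolding giter_add by simp
    qed
    then show ?case by blast
  qed simp
  then obtain p where p: "\<forall>c<n - 1. giter n u p (n - 1) c = v c" by blast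
  \<comment> \<open>The top entry is repeated n times on the diagonal, hence the factor 1/n.\<close>
  define a where "a = - (const_fun (1 / of_nat n) * fmat_trace n (giter n u p))"
  define e where "e i = (if i = 0 then a else 0)" for i :: nat
  have "is_P n u v (giter n u (\<lambda>r. p r + e r))"
  proof (rule is_P_giterI)
    fix c assume "c < n - 1"
    then have "giter n u e (n - 1) c = 0"
      using n_pos by (intro giter_band_0[of 0]) (auto simp: e_def)
    then show "giter n u (\<lambda>r. p r + e r) (n - 1) c = v c"
      using p \<open>c < n - 1\<close> unfolding giter_add by simp
  next
    have "fmat_trace n (giter n u (\<lambda>r. p r + e r)) = fmat_trace n (giter n u p) + fmat_trace n (giter n u e)"
      unfolding giter_add by (simp add: fmat_trace_def sum.distrib)
    also have "fmat_trace n (giter n u e) = of_nat n * e 0"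
      by (rule fmat_trace_giter_single) (simp add: e_def)
    also have "fmat_trace n (giter n u p) + of_nat n * e 0 = 0"
      using n_pos by (intro smooth_fun_eqI) (simp add: e_def a_def)
    finally show "fmat_trace n (giter n u (\<lambda>r. p r + e r)) = 0" .
  qed
  then show ?thesis by blast
qed

section \<open>The first Poisson form\<close>

lemma circ_integral_trace_dcom:
  "circ_integral (fmat_trace n (fmat_mult n (dcom n u X) Y)) = - circ_integral (fmat_trace n (fmat_mult n X (dcom n u Y)))"
  using arg_cong[OF fmat_trace_mult_dcom, of circ_integral n u X Y] by (simp add: circ_integral_add)

text \<open>The commutator lies in V_n, which under the trace pairs only with the last row of
  \<open>X\<close> before the corner.\<close>

lemma fmat_trace_mult_dcom_is_P:
  assumes C: "is_P n u v C" and X: "\<And>c. c < n - 1 \<Longrightarrow> X (n - 1) c = 0"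
  shows "fmat_trace n (fmat_mult n X (dcom n u C)) = 0"
proof -
  have "X r c * dcom n u C c r = 0" if "r < n" "c < n" for r c
    using C X that by (cases "c < n - 1 \<and> r = n - 1") (auto simp: is_P_def)
  then show ?thesis by (simp add: fmat_trace_def fmat_mult_def)
qed

primrec J1_corr :: "nat \<Rightarrow> (nat \<Rightarrow> smooth_fun) \<Rightarrow> fmat \<Rightarrow> nat \<Rightarrow> nat \<Rightarrow> smooth_fun" where
  "J1_corr n u C 0 = (\<lambda>r. 0)"
| "J1_corr n u C (Suc c) =
     (\<lambda>r. gstep n u (J1_corr n u C c) r + (if r = 0 then C (n - 1) c else 0))"

lemma J1_corr_lower: "c \<le> r \<Longrightarrow> r < n \<Longrightarrow> c < n \<Longrightarrow> J1_corr n u C c r = 0"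
  by (induction c arbitrary: r) (auto simp: gstep_def)

text \<open>
  \<open>J1_corr\<close> is the \<open>\<lambda>\<close>-derivative of \<open>P\<close> at the potential \<open>u + \<lambda>e\<^sub>1\<^sub>n\<close>, so the matrix \<open>W\<close> below is
  the \<open>\<lambda>\<close>-derivative of the second Poisson operator \<open>[\<partial>\<^sub>x + b + u, P\<^sub>u(\<xi>)]\<close>.
\<close>

lemma first_form_representation:
  assumes C: "is_P n u \<xi> C"
  obtains w where "\<And>\<eta> C'. is_P n u \<eta> C' \<Longrightarrow>
    circ_integral (fmat_trace n (fmat_mult n (ecom n C) C')) = circ_integral (\<Sum>r<n - 1. w r * \<eta> r)"
proof -
  define K where "K r c = J1_corr n u C c r" for r c
  define W where "W r c = dcom n u K r c + ecom n C r c" for r c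
  \<comment> \<open>The term added in row 0 of \<open>J1_corr\<close> is precisely what cancels
    \<open>ecom\<close> outside the last column.\<close>
  have Wz: "W r c = 0" if "r < n" "Suc c < n" for r c
    using that by (auto simp: W_def dcom_column ecom_eq K_def)
  have "fmat_trace n K = 0" by (simp add: fmat_trace_def K_def J1_corr_lower)
  then have "0 = fmat_trace n W"
    using fmat_trace_dcom[of n u K] fmat_trace_ecom[of n C] by (simp add: W_def fmat_trace_def sum.distrib)
  also have "\<dots> = (\<Sum>k<n. if k = n - 1 then W k k else 0)"
    unfolding fmat_trace_def
  proof (intro sum.cong refl)
    fix k assume "k \<in> {..<n}"
    then show "W k k = (if k = n - 1 then W k k else 0)" using Wz[of k k] by auto
  qed
  also have "\<dots> = W (n - 1) (n - 1)" using n_pos by simp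
  finally have Wn: "W (n - 1) (n - 1) = 0" by simp
  have "circ_integral (fmat_trace n (fmat_mult n (ecom n C) C')) = circ_integral (\<Sum>r<n - 1. W r (n - 1) * \<eta> r)"
    if C': "is_P n u \<eta> C'" for \<eta> C'
  proof -
    have "fmat_trace n (fmat_mult n (ecom n C) C') = fmat_trace n (fmat_mult n W C') - fmat_trace n (fmat_mult n (dcom n u K) C')"
      by (simp add: fmat_trace_def fmat_mult_def W_def algebra_simps sum.distrib)
    \<comment> \<open>\<open>K\<close> is strictly upper triangular, so after integration by parts
      it contributes nothing and \<open>W\<close>, supported in the last column, represents the
      form.\<close>
    moreover have "fmat_trace n (fmat_mult n K (dcom n u C')) = 0"
      using n_pos by (intro fmat_trace_mult_dcom_is_P[OF C']) (simp add: K_def J1_corr_lower)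
    moreover have "fmat_trace n (fmat_mult n W C') = (\<Sum>r<n - 1. W r (n - 1) * \<eta> r)"
    proof -
      obtain m where m: "n = Suc m" using n_pos by (cases n) auto
      have "fmat_trace n (fmat_mult n W C') = (\<Sum>r<n. W r m * C' m r)"
        unfolding fmat_trace_def fmat_mult_def using Wz by (intro sum.cong refl) (simp add: m)
      also have "\<dots> = (\<Sum>r<m. W r m * \<eta> r)"
        using Wn C' by (simp add: m is_P_def)
      finally show ?thesis by (simp add: m)
    qed
    ultimately show ?thesis using circ_integral_trace_dcom[of K C'] by (simp add: circ_integral_diff)
  qed
  then show thesis by (rule that)
qed

text \<open>For such \<open>\<xi>\<close> and \<open>\<eta>\<close> only the two outermost bands of each matrix contribute to the form.\<close>

lemma first_form_leading:
  assumes k: "k < n - 1"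
    and C: "is_P n u \<xi> C" and \<xi>: "\<And>c. c < k \<Longrightarrow> \<xi> c = 0"
    and C': "is_P n u \<eta> C'" and \<eta>: "\<And>c. c < n - 2 - k \<Longrightarrow> \<eta> c = 0"
  shows "circ_integral (fmat_trace n (fmat_mult n (ecom n C) C')) =
    of_nat n * circ_integral (dx (\<xi> k) * \<eta> (n - 2 - k))"
proof -
  \<comment> \<open>\<open>m\<close> is the lowest possibly nonzero row in the first column of
    \<open>C\<close>; for \<open>C'\<close> the corresponding row is \<open>Suc k\<close>.\<close>
  define m where "m = n - 1 - k"
  have m: "n = k + m + 1" "0 < m" "m < n" using k by (auto simp: m_def)
  define p where "p r = C r 0" for r
  define q where "q r = C' r 0" for r
  have p0: "p i = 0" if "i < n" "m < i" for i
    unfolding p_def using that m \<xi> by (intro is_P_first_column_0[OF C, of k]) auto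
  have q0: "q i = 0" if "i < n" "Suc k < i" for i
    unfolding q_def using that m \<eta> by (intro is_P_first_column_0[OF C', of "n - 2 - k"]) auto
  have row: "C (n - 1) c = giter n u p (n - 1) c" "C' (n - 1) c = giter n u q (n - 1) c"
    if "c < n" for c
    using is_P_giter[OF C, of "n - 1" c] is_P_giter[OF C', of "n - 1" c] n_pos that
    by (simp_all add: p_def[abs_def] q_def[abs_def])
  have k1: "Suc k < n" using k by simp
  have idx: "k + m = n - 1" "Suc k + m - 1 = n - 1" "m - 1 + Suc k = n - 1" "m + Suc k - 1 = n - 1"
    using m by auto
  have le: "Suc k + m \<le> n" "m + Suc k \<le> n" using m by auto
  have a: "C (n - 1) k = p m"
    using giter_band_1[OF m(3), of p k, OF p0] row(1)[of k] k1 m(1) unfolding idx by simp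
  have a': "C (n - 1) (Suc k) = of_nat (Suc k) * dx (p m) + p (m - 1)"
    using giter_band_2[OF m(3), of p "Suc k", OF p0] row(1)[OF k1] le m(2) unfolding idx by simp
  have b: "C' (n - 1) (m - 1) = q (Suc k)"
    using giter_band_1[OF k1, of q "m - 1", OF q0] row(2)[of "m - 1"] m unfolding idx by simp
  have b': "C' (n - 1) m = of_nat m * dx (q (Suc k)) + q k"
    using giter_band_2[OF k1, of q m, OF q0] row(2)[OF m(3)] le unfolding idx by simp
  have z: "C (n - 1) c = 0" if "c < k" for c
    using \<xi> C that k by (simp add: is_P_def)
  have z': "C' (n - 1) c = 0" if "c < m - 1" for c
    using \<eta> C' that m by (simp add: is_P_def)
  \<comment> \<open>Columns before \<open>k\<close> vanish in the last row of \<open>C\<close>, rows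
    after \<open>Suc k\<close> in the first column of \<open>C'\<close>; two terms survive.\<close>
  have "(\<Sum>c<n. C (n - 1) c * q c) = (\<Sum>c\<in>{k, Suc k}. C (n - 1) c * q c)"
  proof (rule sum.mono_neutral_right)
    show "\<forall>i\<in>{..<n} - {k, Suc k}. C (n - 1) i * q i = 0"
    proof
      fix i assume "i \<in> {..<n} - {k, Suc k}"
      then consider "i < k" | "i < n" "Suc k < i" by fastforce
      then show "C (n - 1) i * q i = 0" by cases (use z[of i] q0[of i] in auto)
    qed
  qed (use k in auto)
  also have "\<dots> = p m * q k + (of_nat (Suc k) * dx (p m) + p (m - 1)) * q (Suc k)"
    using a a' by simp
  finally have 1: "(\<Sum>c<n. C (n - 1) c * q c) = \<dots>" .
  have "(\<Sum>c<n. C' (n - 1) c * p c) = (\<Sum>c\<in>{m - 1, m}. C' (n - 1) c * p c)"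
  proof (rule sum.mono_neutral_right)
    show "\<forall>i\<in>{..<n} - {m - 1, m}. C' (n - 1) i * p i = 0"
    proof
      fix i assume "i \<in> {..<n} - {m - 1, m}"
      then consider "i < m - 1" | "i < n" "m < i" by fastforce
      then show "C' (n - 1) i * p i = 0" by cases (use z'[of i] p0[of i] in auto)
    qed
  qed (use m in auto)
  also have "\<dots> = q (Suc k) * p (m - 1) + (of_nat m * dx (q (Suc k)) + q k) * p m"
    using b b' m by simp
  finally have 2: "(\<Sum>c<n. C' (n - 1) c * p c) = \<dots>" .
  \<comment> \<open>The terms with \<open>q k\<close> and \<open>p (m - 1)\<close> cancel. Moving
    the derivative off \<open>q (Suc k)\<close> adds its weight \<open>m\<close> to the weight
    \<open>Suc k\<close>, which makes n.\<close>
  have "fmat_trace n (fmat_mult n (ecom n C) C') = of_nat n * (dx (p m) * q (Suc k)) - of_nat m * dx (p m * q (Suc k))"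
    unfolding fmat_trace_mult_ecom[OF n_pos] sum_subtractf
    using 1 2 unfolding p_def[symmetric] q_def[symmetric]
    by (subst m(1)) (simp add: dx_simps algebra_simps)
  then have "circ_integral (fmat_trace n (fmat_mult n (ecom n C) C')) = of_nat n * circ_integral (dx (p m) * q (Suc k))"
    using circ_integral_cmult[of "of_nat n" "dx (p m) * q (Suc k)"]
      circ_integral_cmult[of "of_nat m" "dx (p m * q (Suc k))"]
    by (simp add: circ_integral_diff const_fun_hom)
  moreover have "p m = \<xi> k" "q (Suc k) = \<eta> (n - 2 - k)"
    using a b C C' m k by (auto simp: is_P_def)
  ultimately show ?thesis by simp
qed

end

lemma circ_integral_square_nonneg: "circ_integral (f * f) \<ge> 0"
  by (simp add: circ_integral.rep_eq times_smooth_fun.rep_eq integral_nonneg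
      val_integrable[of "f * f", unfolded times_smooth_fun.rep_eq])

lemma circ_integral_sum_squares_eq_0:
  assumes "circ_integral (\<Sum>i<m. d i * d i) = 0" "i < (m::nat)"
  shows "d i = 0"
  using assms circ_integral_square_eq_0[of "d i"] circ_integral_square_nonneg
  by (simp add: circ_integral_sum sum_nonneg_eq_0_iff)

section \<open>Matrix-valued functions as matrices of smooth functions\<close>

definition entry :: "(real \<Rightarrow> real mat) \<Rightarrow> fmat" where
  "entry A r c = Smooth (\<lambda>x. A x $$ (r, c))"

definition fun_mat :: "nat \<Rightarrow> fmat \<Rightarrow> real \<Rightarrow> real mat" where
  "fun_mat n X x = Matrix.mat n n (\<lambda>(r, c). val (X r c) x)"

lemma fun_mat_carrier [simp]: "fun_mat n X x \<in> carrier_mat n n"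
  and fun_mat_dim [simp]: "dim_row (fun_mat n X x) = n" "dim_col (fun_mat n X x) = n"
  by (simp_all add: fun_mat_def)

lemma fun_mat_index [simp]: "r < n \<Longrightarrow> c < n \<Longrightarrow> fun_mat n X x $$ (r, c) = val (X r c) x"
  by (simp add: fun_mat_def)

lemma val_entry: "A \<in> Cinf n S \<Longrightarrow> r < n \<Longrightarrow> c < n \<Longrightarrow> val (entry A r c) x = A x $$ (r, c)"
  by (simp add: entry_def Cinf_def)

lemma fun_mat_entry:
  assumes "A \<in> Cinf n S"
  shows "fun_mat n (entry A) = A"
proof
  fix x
  have "A x \<in> carrier_mat n n" using assms by (simp add: Cinf_def)
  then show "fun_mat n (entry A) x = A x"
    by (intro eq_matI) (auto simp: val_entry[OF assms])
qed

lemma entry_fun_mat: "r < n \<Longrightarrow> c < n \<Longrightarrow> entry (fun_mat n X) r c = X r c"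
  by (simp add: entry_def val_inverse)

lemma fun_mat_in_Cinf: "(\<And>x. fun_mat n X x \<in> S) \<Longrightarrow> fun_mat n X \<in> Cinf n S"
  by (simp add: Cinf_def)

lemma fun_mat_cong: "(\<And>r c. r < n \<Longrightarrow> c < n \<Longrightarrow> X r c = Y r c) \<Longrightarrow> fun_mat n X = fun_mat n Y"
  by (rule ext, rule eq_matI) auto

lemma mtrace_fun_mat: "mtrace (fun_mat n X x) = val (fmat_trace n X) x"
  by (simp add: mtrace_def fmat_trace_def)

lemma index_mult_mat_sum:
  assumes "A \<in> carrier_mat n n" "B \<in> carrier_mat n n" "r < n" "c < n"
  shows "(A * B) $$ (r, c) = (\<Sum>k<n. A $$ (r, k) * B $$ (k, c))"
  using assms by (auto simp: scalar_prod_def atLeast0LessThan intro!: sum.cong)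

lemma fun_mat_mult: "fun_mat n X x * fun_mat n Y x = fun_mat n (fmat_mult n X Y) x"
  by (rule eq_matI) (auto simp: index_mult_mat_sum[of _ n] fmat_mult_def simp del: index_mult_mat(1))

lemma fun_mat_diff: "fun_mat n X x - fun_mat n Y x = fun_mat n (\<lambda>r c. X r c - Y r c) x"
  by (rule eq_matI) auto

lemma fun_mat_add: "fun_mat n X x + fun_mat n Y x = fun_mat n (\<lambda>r c. X r c + Y r c) x"
  by (rule eq_matI) auto

lemma mderiv_fun_mat: "mderiv n (fun_mat n X) x = fun_mat n (\<lambda>r c. dx (X r c)) x"
  by (rule eq_matI) (auto simp: mderiv_def val_dx)

lemma pairing_fun_mat: "pairing (fun_mat n X) (fun_mat n Y) = circ_integral (fmat_trace n (fmat_mult n X Y))"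
  unfolding pairing_def fun_mat_mult mtrace_fun_mat circ_integral.rep_eq ..

lemma fun_mat_in_sl: "fun_mat n X \<in> Cinf n (sl n) \<longleftrightarrow> fmat_trace n X = 0"
proof
  assume "fun_mat n X \<in> Cinf n (sl n)"
  then show "fmat_trace n X = 0"
    by (intro smooth_fun_eqI) (simp add: Cinf_def sl_def mtrace_fun_mat)
qed (auto intro!: fun_mat_in_Cinf simp: sl_def mtrace_fun_mat)

lemma fun_mat_in_Vn: "fun_mat n X \<in> Cinf n (Vn n) \<longleftrightarrow>
  (\<forall>r<n. \<forall>c<n. \<not> (r < n - 1 \<and> c = n - 1) \<longrightarrow> X r c = 0)" (is "?L \<longleftrightarrow> ?R")
proof
  assume L: ?L
  show ?R
  proof (intro allI impI smooth_fun_eqI)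
    fix r c x assume "r < n" "c < n" "\<not> (r < n - 1 \<and> c = n - 1)"
    moreover have "fun_mat n X x \<in> Vn n" using L by (simp add: Cinf_def)
    ultimately have "fun_mat n X x $$ (r, c) = 0" unfolding Vn_def by blast
    then show "val (X r c) x = val 0 x" using \<open>r < n\<close> \<open>c < n\<close> by simp
  qed
qed (intro fun_mat_in_Cinf, auto simp: Vn_def)

lemma fun_mat_in_Vnt: "fun_mat n X \<in> Cinf n (Vnt n) \<longleftrightarrow>
  (\<forall>r<n. \<forall>c<n. \<not> (r = n - 1 \<and> c < n - 1) \<longrightarrow> X r c = 0)" (is "?L \<longleftrightarrow> ?R")
proof
  assume L: ?L
  show ?R
  proof (intro allI impI smooth_fun_eqI)
    fix r c x assume "r < n" "c < n" "\<not> (r = n - 1 \<and> c < n - 1)"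
    moreover have "fun_mat n X x \<in> Vnt n" using L by (simp add: Cinf_def)
    ultimately have "fun_mat n X x $$ (r, c) = 0" unfolding Vnt_def by blast
    then show "val (X r c) x = val 0 x" using \<open>r < n\<close> \<open>c < n\<close> by simp
  qed
qed (intro fun_mat_in_Cinf, auto simp: Vnt_def)

definition last_col :: "nat \<Rightarrow> (real \<Rightarrow> real mat) \<Rightarrow> nat \<Rightarrow> smooth_fun" where
  "last_col n A r = entry A r (n - 1)"

definition last_row :: "nat \<Rightarrow> (real \<Rightarrow> real mat) \<Rightarrow> nat \<Rightarrow> smooth_fun" where
  "last_row n A c = entry A (n - 1) c"

definition of_col :: "nat \<Rightarrow> (nat \<Rightarrow> smooth_fun) \<Rightarrow> real \<Rightarrow> real mat" where
  "of_col n a = fun_mat n (\<lambda>r c. if r < n - 1 \<and> c = n - 1 then a r else 0)"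

definition of_row :: "nat \<Rightarrow> (nat \<Rightarrow> smooth_fun) \<Rightarrow> real \<Rightarrow> real mat" where
  "of_row n a = fun_mat n (\<lambda>r c. if r = n - 1 \<and> c < n - 1 then a c else 0)"

lemma of_col_in_Vn: "of_col n a \<in> Cinf n (Vn n)"
  unfolding of_col_def fun_mat_in_Vn by auto

lemma of_row_in_Vnt: "of_row n a \<in> Cinf n (Vnt n)"
  unfolding of_row_def fun_mat_in_Vnt by auto

lemma last_col_of_col: "r < n - 1 \<Longrightarrow> last_col n (of_col n a) r = a r"
  by (simp add: last_col_def of_col_def entry_fun_mat)

lemma last_row_of_row: "c < n - 1 \<Longrightarrow> last_row n (of_row n a) c = a c"
  by (simp add: last_row_def of_row_def entry_fun_mat)

lemma entry_Vn:
  assumes "A \<in> Cinf n (Vn n)" "r < n" "c < n" "\<not> (r < n - 1 \<and> c = n - 1)"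
  shows "entry A r c = 0"
  using assms fun_mat_in_Vn[of n "entry A"] fun_mat_entry[OF assms(1)] by auto

lemma entry_Vnt:
  assumes "A \<in> Cinf n (Vnt n)" "r < n" "c < n" "\<not> (r = n - 1 \<and> c < n - 1)"
  shows "entry A r c = 0"
  using assms fun_mat_in_Vnt[of n "entry A"] fun_mat_entry[OF assms(1)] by auto

lemma of_col_last_col:
  assumes "A \<in> Cinf n (Vn n)"
  shows "of_col n (last_col n A) = A"
proof -
  have "of_col n (last_col n A) = fun_mat n (entry A)"
    unfolding of_col_def last_col_def using entry_Vn[OF assms] by (intro fun_mat_cong) auto
  then show ?thesis using fun_mat_entry[OF assms] by simp
qed

lemma of_row_last_row:
  assumes "A \<in> Cinf n (Vnt n)"
  shows "of_row n (last_row n A) = A"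
proof -
  have "of_row n (last_row n A) = fun_mat n (entry A)"
    unfolding of_row_def last_row_def using entry_Vnt[OF assms] by (intro fun_mat_cong) auto
  then show ?thesis using fun_mat_entry[OF assms] by simp
qed

lemma of_col_cong: "(\<And>r. r < n - 1 \<Longrightarrow> a r = b r) \<Longrightarrow> of_col n a = of_col n b"
  unfolding of_col_def by (intro fun_mat_cong) auto

lemma of_row_cong: "(\<And>r. r < n - 1 \<Longrightarrow> a r = b r) \<Longrightarrow> of_row n a = of_row n b"
  unfolding of_row_def by (intro fun_mat_cong) auto

lemma pairing_of_col_of_row:
  assumes "n > 0"
  shows "pairing (of_col n a) (of_row n b) = circ_integral (\<Sum>r<n - 1. a r * b r)"
proof -
  obtain m where m: "n = Suc m" using assms by (cases n) auto
  have "fmat_trace n (fmat_mult n (\<lambda>r c. if r < n - 1 \<and> c = n - 1 then a r else 0)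
      (\<lambda>r c. if r = n - 1 \<and> c < n - 1 then b c else 0)) = (\<Sum>r<m. a r * b r)"
    by (simp add: fmat_trace_def fmat_mult_def m)
  then show ?thesis by (simp add: of_col_def of_row_def pairing_fun_mat m)
qed

lemma pairing_of_row_of_col:
  assumes "n > 0"
  shows "pairing (of_row n b) (of_col n a) = circ_integral (\<Sum>r<n - 1. b r * a r)"
  using pairing_of_col_of_row[OF assms, of a b]
  by (simp add: of_col_def of_row_def pairing_fun_mat fmat_trace_mult_commute[of n _ "\<lambda>r c. if r < n - Suc 0 \<and> c = n - Suc 0 then a r else 0"] mult.commute)

lemma munit_eq_fun_mat: "munit n 0 (n - 1) = fun_mat n (corner n) x"
  by (rule eq_matI) (auto simp: munit_def corner_def)

lemma mcomm_corner: "mcomm (munit n 0 (n - 1)) (fun_mat n X x) = fun_mat n (ecom n X) x"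
  unfolding mcomm_def munit_eq_fun_mat[of n x] fun_mat_mult fun_mat_diff
  by (simp add: ecom_def[abs_def])

lemma bmat_plus:
  assumes "u \<in> Cinf n (Vn n)"
  shows "bmat n + u x = fun_mat n (bu_mat n (last_col n u)) x"
proof -
  have "u x \<in> carrier_mat n n" using assms by (simp add: Cinf_def)
  moreover have "u x $$ (r, c) = (if c = n - 1 then val (last_col n u r) x else 0)"
    if "r < n" "c < n" for r c
    using val_entry[OF assms that, of x] entry_Vn[OF assms that] by (auto simp: last_col_def)
  ultimately show ?thesis
    by (intro eq_matI) (auto simp: bmat_def bu_mat_def)
qed

lemma dcomm_fun_mat:
  assumes "u \<in> Cinf n (Vn n)"
  shows "dcomm n (\<lambda>x. bmat n + u x) (fun_mat n X) = fun_mat n (dcom n (last_col n u) X)"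
  by (rule ext) (simp add: dcomm_def mcomm_def bmat_plus[OF assms] mderiv_fun_mat fun_mat_mult
      fun_mat_diff fun_mat_add dcom_def[abs_def])

lemma potential_last_col:
  assumes "n > 0" "u \<in> Cinf n (Vn n)"
  shows "potential n (last_col n u)"
  using assms entry_Vn[OF assms(2), of "n - 1" "n - 1"] by unfold_locales (auto simp: last_col_def)

section \<open>The operators and gradients expressed on entries\<close>

lemma Pop_condition_iff:
  assumes n: "n > 0" and u: "u \<in> Cinf n (Vn n)" and v: "v \<in> Cinf n (Vnt n)"
  shows "fun_mat n C \<in> Cinf n (sl n) \<and> (\<forall>x. proj0 n (fun_mat n C x) = v x) \<and>
     dcomm n (\<lambda>x. bmat n + u x) (fun_mat n C) \<in> Cinf n (Vn n) \<longleftrightarrow>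
     is_P n (last_col n u) (last_row n v) C"
proof -
  have "proj0 n (fun_mat n C x) = of_row n (\<lambda>c. C (n - 1) c) x" for x
    unfolding of_row_def by (rule eq_matI) (auto simp: proj0_def)
  then have "(\<forall>x. proj0 n (fun_mat n C x) = v x) \<longleftrightarrow> of_row n (\<lambda>c. C (n - 1) c) = v"
    by auto
  also have "\<dots> \<longleftrightarrow> (\<forall>c<n - 1. C (n - 1) c = last_row n v c)"
    using last_row_of_row[of _ n "\<lambda>c. C (n - 1) c"] of_row_cong[of n "\<lambda>c. C (n - 1) c" "last_row n v"]
      of_row_last_row[OF v] by auto
  finally show ?thesis
    by (simp add: is_P_def fun_mat_in_sl dcomm_fun_mat[OF u] fun_mat_in_Vn)
qed

lemma Pop_eq:
  assumes n: "n > 0" and u: "u \<in> Cinf n (Vn n)" and v: "v \<in> Cinf n (Vnt n)"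
    and C: "is_P n (last_col n u) (last_row n v) C"
  shows "Pop n u v = fun_mat n C"
  unfolding Pop_def
proof (rule the_equality)
  show "fun_mat n C \<in> Cinf n (sl n) \<and> (\<forall>x. proj0 n (fun_mat n C x) = v x) \<and>
     dcomm n (\<lambda>x. bmat n + u x) (fun_mat n C) \<in> Cinf n (Vn n)"
    using Pop_condition_iff[OF n u v] C by blast
next
  fix A assume A: "A \<in> Cinf n (sl n) \<and> (\<forall>x. proj0 n (A x) = v x) \<and>
     dcomm n (\<lambda>x. bmat n + u x) A \<in> Cinf n (Vn n)"
  interpret potential n "last_col n u" by (rule potential_last_col[OF n u])
  have eq: "fun_mat n (entry A) = A" using A fun_mat_entry by blast
  then have "is_P n (last_col n u) (last_row n v) (entry A)"
    using A Pop_condition_iff[OF n u v, of "entry A"] by simp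
  then have "fun_mat n (entry A) = fun_mat n C"
    by (intro fun_mat_cong is_P_unique[OF _ C])
  then show "A = fun_mat n C" using eq by simp
qed

lemma form1_eq:
  assumes n: "n > 0" and u: "u \<in> Cinf n (Vn n)"
    and \<xi>: "\<xi> \<in> Cinf n (Vnt n)" and \<eta>: "\<eta> \<in> Cinf n (Vnt n)"
    and C: "is_P n (last_col n u) (last_row n \<xi>) C" and C': "is_P n (last_col n u) (last_row n \<eta>) C'"
  shows "form1 n u \<xi> \<eta> = circ_integral (fmat_trace n (fmat_mult n (ecom n C) C'))"
  unfolding form1_def Pop_eq[OF n u \<xi> C] Pop_eq[OF n u \<eta> C'] mcomm_corner
  by (rule pairing_fun_mat)

text \<open>Testing with the transposed difference yields the integral of a sum of squares.\<close>

lemma Vn_eqI: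
  assumes n: "n > 0" and w: "w \<in> Cinf n (Vn n)" "w' \<in> Cinf n (Vn n)"
    and eq: "\<And>\<eta>. \<eta> \<in> Cinf n (Vnt n) \<Longrightarrow> pairing w \<eta> = pairing w' \<eta>"
  shows "w = w'"
proof -
  define d where "d r = last_col n w r - last_col n w' r" for r
  have "pairing (of_col n (last_col n w)) (of_row n d) = pairing (of_col n (last_col n w')) (of_row n d)"
    using eq[OF of_row_in_Vnt] w by (simp add: of_col_last_col)
  then have "circ_integral (\<Sum>r<n - 1. d r * d r) = 0"
    unfolding pairing_of_col_of_row[OF n]
    by (subst d_def) (simp add: algebra_simps sum_subtractf circ_integral_diff)
  then have "d r = 0" if "r < n - 1" for r
    using circ_integral_sum_squares_eq_0 that by blast
  then have "of_col n (last_col n w) = of_col n (last_col n w')"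
    by (intro of_col_cong) (simp add: d_def)
  then show ?thesis using w by (simp add: of_col_last_col)
qed

lemma Vnt_eqI:
  assumes n: "n > 0" and w: "w \<in> Cinf n (Vnt n)" "w' \<in> Cinf n (Vnt n)"
    and eq: "\<And>v. v \<in> Cinf n (Vn n) \<Longrightarrow> pairing w v = pairing w' v"
  shows "w = w'"
proof -
  define d where "d r = last_row n w r - last_row n w' r" for r
  have "pairing (of_row n (last_row n w)) (of_col n d) = pairing (of_row n (last_row n w')) (of_col n d)"
    using eq[OF of_col_in_Vn] w by (simp add: of_row_last_row)
  then have "circ_integral (\<Sum>r<n - 1. d r * d r) = 0"
    unfolding pairing_of_row_of_col[OF n]
    by (subst d_def) (simp add: algebra_simps sum_subtractf circ_integral_diff)
  then have "d r = 0" if "r < n - 1" for r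
    using circ_integral_sum_squares_eq_0 that by blast
  then have "of_row n (last_row n w) = of_row n (last_row n w')"
    by (intro of_row_cong) (simp add: d_def)
  then show ?thesis using w by (simp add: of_row_last_row)
qed

lemma gradient_eq:
  assumes "n > 0" "has_gradient n F u g"
  shows "gradient n F u = g"
  unfolding gradient_def
proof (rule the_equality[where P = "has_gradient n F u"])
  fix g' assume "has_gradient n F u g'"
  then show "g' = g"
    using assms by (intro Vnt_eqI[OF assms(1)]) (auto simp: has_gradient_def intro: DERIV_unique)
qed fact

text \<open>\<open>first_form_representation\<close> supplies the element that \<open>J1op\<close>
  describes and nondegeneracy makes it unique, so the kernel of J_1 is the radical of the
  form.\<close>

lemma J1op_eq_0_iff:
  assumes n: "n > 0" and u: "u \<in> Cinf n (Vn n)" and \<xi>: "\<xi> \<in> Cinf n (Vnt n)"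
  shows "J1op n u \<xi> = (\<lambda>x. 0\<^sub>m n n) \<longleftrightarrow> (\<forall>\<eta>\<in>Cinf n (Vnt n). form1 n u \<xi> \<eta> = 0)"
proof -
  interpret potential n "last_col n u" by (rule potential_last_col[OF n u])
  have zero: "(\<lambda>x. 0\<^sub>m n n) = of_col n (\<lambda>r. 0)"
    unfolding of_col_def by (rule ext, rule eq_matI) auto
  obtain C where C: "is_P n (last_col n u) (last_row n \<xi>) C"
    using is_P_exists by blast
  obtain w where w: "\<And>\<eta> C'. is_P n (last_col n u) \<eta> C' \<Longrightarrow>
    circ_integral (fmat_trace n (fmat_mult n (ecom n C) C')) = circ_integral (\<Sum>r<n - 1. w r * \<eta> r)"
    using first_form_representation[OF C] by blast
  have pair: "pairing (of_col n w) \<eta> = form1 n u \<xi> \<eta>" if \<eta>: "\<eta> \<in> Cinf n (Vnt n)" for \<eta>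
  proof -
    obtain C' where C': "is_P n (last_col n u) (last_row n \<eta>) C'"
      using is_P_exists by blast
    have "pairing (of_col n w) \<eta> = pairing (of_col n w) (of_row n (last_row n \<eta>))"
      by (simp add: of_row_last_row[OF \<eta>])
    also have "\<dots> = form1 n u \<xi> \<eta>"
      unfolding pairing_of_col_of_row[OF n] form1_eq[OF n u \<xi> \<eta> C C'] w[OF C'] ..
    finally show ?thesis .
  qed
  have J1: "J1op n u \<xi> = of_col n w"
    unfolding J1op_def
  proof (rule the_equality)
    fix w' assume w': "w' \<in> Cinf n (Vn n) \<and> (\<forall>\<eta>\<in>Cinf n (Vnt n). pairing w' \<eta> = form1 n u \<xi> \<eta>)"
    then show "w' = of_col n w"
      using pair by (intro Vn_eqI[OF n _ of_col_in_Vn]) auto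
  qed (use pair of_col_in_Vn in auto)
  have pair0: "pairing (of_col n (\<lambda>r. 0)) \<eta> = 0" if "\<eta> \<in> Cinf n (Vnt n)" for \<eta>
    using pairing_of_col_of_row[OF n, of "\<lambda>r. 0" "last_row n \<eta>"] of_row_last_row[OF that] by simp
  show ?thesis
    unfolding J1 zero
  proof
    assume "of_col n w = of_col n (\<lambda>r. 0)"
    then show "\<forall>\<eta>\<in>Cinf n (Vnt n). form1 n u \<xi> \<eta> = 0" using pair pair0 by metis
  next
    assume "\<forall>\<eta>\<in>Cinf n (Vnt n). form1 n u \<xi> \<eta> = 0"
    then show "of_col n w = of_col n (\<lambda>r. 0)"
      using pair pair0 by (intro Vn_eqI[OF n of_col_in_Vn of_col_in_Vn]) auto
  qed
qed

section \<open>The normalizing series\<close>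

lemma minv_props:
  fixes A :: "'a::field mat"
  assumes A: "A \<in> carrier_mat n n" and det: "det A \<noteq> 0"
  shows "A * minv A = 1\<^sub>m n" "minv A * A = 1\<^sub>m n" "minv A \<in> carrier_mat n n"
proof -
  have "A \<in> Units (ring_mat TYPE('a) n n)" by (rule det_non_zero_imp_unit[OF A det])
  then obtain B where "mat_inverse A = Some B"
    using mat_inverse(1)[OF A, where b = n] by (cases "mat_inverse A") auto
  then show "A * minv A = 1\<^sub>m n" "minv A * A = 1\<^sub>m n" "minv A \<in> carrier_mat n n"
    using mat_inverse(2)[OF A] by (auto simp: minv_def)
qed

lemma minv_eqI:
  fixes A :: "'a::field mat"
  assumes A: "A \<in> carrier_mat n n" and B: "B \<in> carrier_mat n n" and AB: "A * B = 1\<^sub>m n"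
  shows "minv A = B"
proof -
  have "det A * det B = 1" using det_mult[OF A B] AB by simp
  then have "det A \<noteq> 0" by auto
  note m = minv_props[OF A this]
  have "minv A = minv A * (A * B)" using m AB by simp
  also have "\<dots> = (minv A * A) * B" by (rule assoc_mult_mat[symmetric]) (use m A B in auto)
  also have "\<dots> = B" using m B by simp
  finally show ?thesis .
qed

lemma fls_nth_X_mult:
  fixes f :: "'a::comm_ring_1 fps"
  shows "fls_nth (fps_to_fls (fps_X * f)) m = fls_nth (fps_to_fls f) (m - 1)"
  by (auto simp: nat_diff_distrib)

lemma fls_nth_pot_mult:
  "fls_nth (fps_to_fls (pot n a i * f)) m = a i * fls_nth (fps_to_fls f) (m - int (n - i))"
  by (auto simp: pot_def mult.assoc fps_X_power_mult_nth nat_diff_distrib)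

text \<open>The convolution may be summed over any finite window that contains the possible support,
  which makes windows of different entries uniform.\<close>

lemma fls_times_nth_superset:
  fixes f g :: "'a::comm_ring_1 fls"
  assumes f: "\<And>i. i < a \<Longrightarrow> fls_nth f i = 0" and g: "\<And>i. i < b \<Longrightarrow> fls_nth g i = 0"
    and S: "finite S" "{a..m - b} \<subseteq> S"
  shows "fls_nth (f * g) m = (\<Sum>i\<in>S. fls_nth f i * fls_nth g (m - i))"
  unfolding fls_times_nth(2)
proof (rule sum.mono_neutral_cong)
  fix i assume "i \<in> S - {fls_subdegree f..m - fls_subdegree g}"
  then have "i < fls_subdegree f \<or> m - i < fls_subdegree g" by auto
  then show "fls_nth f i * fls_nth g (m - i) = 0" by auto
next
  fix i assume "i \<in> {fls_subdegree f..m - fls_subdegree g} - S"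
  then have "i \<notin> {a..m - b}" using S(2) by blast
  then have "i < a \<or> m - i < b" by auto
  then show "fls_nth f i * fls_nth g (m - i) = 0" using f g by auto
qed (use S in auto)

text \<open>Division with remainder by n: a power of \<lambda> together with a matrix index is the
  same datum as a power of z.\<close>

lemma sum_int_blocks:
  fixes F :: "int \<Rightarrow> 'a::comm_monoid_add"
  assumes "n > 0"
  shows "(\<Sum>l<n. \<Sum>j\<in>{a..<b}. F (int n * j + int l)) = (\<Sum>t\<in>{int n * a..<int n * b}. F t)"
proof -
  have "(\<Sum>l<n. \<Sum>j\<in>{a..<b}. F (int n * j + int l)) =
      (\<Sum>(l, j)\<in>{..<n} \<times> {a..<b}. F (int n * j + int l))"
    by (rule sum.cartesian_product)
  also have "\<dots> = (\<Sum>t\<in>{int n * a..<int n * b}. F t)"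
  proof (rule sum.reindex_bij_witness[of _ "\<lambda>t. (nat (t mod int n), t div int n)"
        "\<lambda>(l, j). int n * j + int l"]; clarsimp simp: assms)
    fix l :: nat and j assume l: "l < n" and j: "a \<le> j" "j < b"
    have "int n * a \<le> int n * j" using j by (simp add: mult_left_mono)
    moreover have "int n * (j + 1) \<le> int n * b" using j by (intro mult_left_mono) auto
    moreover have "int n * (j + 1) = int n * j + int n" by (simp add: algebra_simps)
    ultimately show "int n * a \<le> int n * j + int l \<and> int n * j + int l < int n * b"
      using l by linarith
  next
    fix t assume t: "int n * a \<le> t" "t < int n * b"
    have "a = (int n * a) div int n" using assms by simp
    also have "\<dots> \<le> t div int n" using t assms by (intro zdiv_mono1) auto
    finally have "a \<le> t div int n" .
    moreover have "t div int n < b"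
    proof (rule ccontr)
      assume "\<not> t div int n < b"
      then have "int n * b \<le> int n * (t div int n)" by (intro mult_left_mono) auto
      moreover have "0 \<le> t mod int n" using assms by simp
      ultimately show False using t mult_div_mod_eq[of "int n" t] by linarith
    qed
    ultimately show "nat (t mod int n) < n \<and> a \<le> t div int n \<and> t div int n < b"
      using assms by (simp add: nat_less_iff)
  qed
  finally show ?thesis .
qed

text \<open>
  \<open>shape n s M q\<close>: column \<open>c\<close> of \<open>M\<close>, read as a Laurent series in \<open>z\<^sup>-\<^sup>1\<close>, is \<open>z\<^sup>c\<^sup>+\<^sup>s\<close> times \<open>q c\<close>.
\<close>

definition shape :: "nat \<Rightarrow> int \<Rightarrow> real fls mat \<Rightarrow> (nat \<Rightarrow> real fps) \<Rightarrow> bool" where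
  "shape n s M q \<longleftrightarrow> M \<in> carrier_mat n n \<and> (\<forall>r<n. \<forall>c<n. \<forall>k.
     fls_nth (M $$ (r, c)) k = fls_nth (fps_to_fls (q c)) (int n * k + int c - int r + s))"

lemma shape_nth:
  "shape n s M q \<Longrightarrow> r < n \<Longrightarrow> c < n \<Longrightarrow>
    fls_nth (M $$ (r, c)) k = fls_nth (fps_to_fls (q c)) (int n * k + int c - int r + s)"
  by (simp add: shape_def)

text \<open>Every exponent of the series occurs in some entry of the column: its residue modulo n
  selects the row, its quotient the power of \<lambda>. A column thus encodes its series
  faithfully.\<close>

lemma shape_col_eq_iff:
  assumes n: "n > 0" and A: "shape n s A a" and B: "shape n s B b" and c: "c < n"
  shows "col A c = col B c \<longleftrightarrow> a c = b c"
proof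
  have dim: "dim_row A = n" "dim_row B = n" "dim_col A = n" "dim_col B = n"
    using A B by (auto simp: shape_def)
  assume eq: "col A c = col B c"
  show "a c = b c"
  proof (rule fps_ext)
    fix m
    define t where "t = int c + s - int m"
    define r where "r = nat (t mod int n)"
    have r: "r < n" using n by (simp add: r_def nat_less_iff)
    have "int r = t mod int n" using n by (simp add: r_def)
    then have "int n * - (t div int n) + int c - int r + s = int m"
      using mult_div_mod_eq[of "int n" t] t_def unfolding mult_minus_right by linarith
    moreover have "A $$ (r, c) = B $$ (r, c)"
      using arg_cong[OF eq, of "\<lambda>v. vec_index v r"] dim r c by simp
    ultimately show "fps_nth (a c) m = fps_nth (b c) m"
      using shape_nth[OF A r c, of "- (t div int n)"] shape_nth[OF B r c, of "- (t div int n)"]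
      by simp
  qed
next
  assume "a c = b c"
  then show "col A c = col B c"
    using A B c by (intro eq_vecI) (auto simp: shape_def fls_eq_iff)
qed

lemma shape_eq_iff:
  assumes n: "n > 0" and A: "shape n s A a" and B: "shape n s B b"
  shows "A = B \<longleftrightarrow> (\<forall>c<n. a c = b c)"
proof -
  have "A = B \<longleftrightarrow> (\<forall>c<n. col A c = col B c)"
    using A B by (auto simp: shape_def intro!: mat_col_eqI)
  then show ?thesis using shape_col_eq_iff[OF n A B] by simp
qed

lemma shape_diff:
  assumes "shape n s A a" "shape n s B b"
  shows "shape n s (A - B) (\<lambda>c. a c - b c)"
  using assms by (auto simp: shape_def)

lemma shape_shift:
  assumes "shape n 0 A a"
  shows "shape n 1 A (\<lambda>c. fps_X * a c)"
  using assms by (simp add: shape_def fls_nth_X_mult del: fps_to_fls_nth)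

text \<open>A matrix whose columns all carry the same series \<open>d\<close> is J times a series in
  the inverse of J, and acts on columns as multiplication by z d.\<close>

lemma shape_mult:
  assumes n: "n > 0" and D: "shape n 1 D (\<lambda>_. d)" and M: "shape n 0 M q"
  shows "shape n 1 (D * M) (\<lambda>c. d * q c)"
  unfolding shape_def
proof (intro conjI allI impI)
  have carr: "D \<in> carrier_mat n n" "M \<in> carrier_mat n n" using D M by (auto simp: shape_def)
  then show "D * M \<in> carrier_mat n n" by simp
  fix r c k assume r: "r < n" and c: "c < n"
  define F where "F t = fls_nth (fps_to_fls d) (t - int r + 1) *
      fls_nth (fps_to_fls (q c)) (int c + int n * k - t)" for t
  have D0: "fls_nth (D $$ (r, l)) i = 0" if "i < - 1" "l < n" for i l
  proof -
    have "int n * i \<le> int n * - 2" using that by (intro mult_left_mono) auto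
    then have "int n * i + int l - int r + 1 < 0" using that r by linarith
    then show ?thesis using shape_nth[OF D r that(2), of i] by simp
  qed
  have M0: "fls_nth (M $$ (l, c)) i = 0" if "i < 0" "l < n" for i l
  proof -
    have "int n * i \<le> int n * - 1" using that by (intro mult_left_mono) auto
    then have "int n * i + int c - int l + 0 < 0" using that c by linarith
    then show ?thesis using shape_nth[OF M that(2) c, of i] by simp
  qed
  have "fls_nth ((D * M) $$ (r, c)) k = (\<Sum>l<n. fls_nth (D $$ (r, l) * M $$ (l, c)) k)"
    using index_mult_mat_sum[OF carr r c] by (simp add: fls_nth_sum)
  also have "\<dots> = (\<Sum>l<n. \<Sum>j\<in>{- 1..<k + 1}. F (int n * j + int l))"
  proof (intro sum.cong refl)
    fix l assume "l \<in> {..<n}"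
    then have l: "l < n" by simp
    have "fls_nth (D $$ (r, l) * M $$ (l, c)) k =
        (\<Sum>j\<in>{- 1..<k + 1}. fls_nth (D $$ (r, l)) j * fls_nth (M $$ (l, c)) (k - j))"
      using D0 M0 l by (intro fls_times_nth_superset[of "- 1" _ 0]) auto
    also have "\<dots> = (\<Sum>j\<in>{- 1..<k + 1}. F (int n * j + int l))"
      unfolding F_def shape_nth[OF D r l] shape_nth[OF M l c]
      by (intro sum.cong refl arg_cong2[of _ _ _ _ times] arg_cong[of _ _ "fls_nth _"])
        (simp_all add: algebra_simps)
    finally show "fls_nth (D $$ (r, l) * M $$ (l, c)) k = \<dots>" .
  qed
  also have "\<dots> = (\<Sum>t\<in>{- int n..<int n * (k + 1)}. F t)"
    using sum_int_blocks[OF n, of F "- 1" "k + 1"] by simp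
  also have "\<dots> = (\<Sum>i\<in>{- int n - int r + 1..<int n * (k + 1) - int r + 1}.
      fls_nth (fps_to_fls d) i * fls_nth (fps_to_fls (q c)) (int n * k + int c - int r + 1 - i))"
    by (rule sum.reindex_bij_witness[of _ "\<lambda>i. i + int r - 1" "\<lambda>t. t - int r + 1"])
      (auto simp: F_def algebra_simps)
  also have "\<dots> = fls_nth (fps_to_fls d * fps_to_fls (q c)) (int n * k + int c - int r + 1)"
    using r c by (intro fls_times_nth_superset[of 0 _ 0, symmetric]) (auto simp: algebra_simps)
  finally show "fls_nth ((D * M) $$ (r, c)) k =
      fls_nth (fps_to_fls (d * q c)) (int n * k + int c - int r + 1)"
    by (simp only: fls_times_fps_to_fls)
qed

section \<open>J, its inverse and its powers\<close>

lemma Jmat_carrier [simp]: "Jmat n \<in> carrier_mat n n"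
  by (simp add: Jmat_def munit_def bmat_def)

lemma Jmat_index:
  "r < n \<Longrightarrow> c < n \<Longrightarrow> Jmat n $$ (r, c) =
    (if r = 0 \<and> c = n - 1 then fls_X_inv else 0) + (if r = Suc c then 1 else 0)"
  by (simp add: Jmat_def munit_def bmat_def)

lemma Jmat_nth:
  assumes "r < n" "c < n"
  shows "fls_nth (Jmat n $$ (r, c)) k = (if int n * k + int c - int r = - 1 then 1 else 0)"
proof -
  consider "k = 0" | "k = - 1" | "k \<ge> 1" | "k \<le> - 2" by linarith
  then show ?thesis
  proof cases
    case 3
    then have "int n * 1 \<le> int n * k" by (intro mult_left_mono) auto
    then have "int n * k + int c - int r \<noteq> - 1" using assms by linarith
    then show ?thesis using assms 3 by (simp add: Jmat_index)
  next
    case 4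
    then have "int n * k \<le> int n * - 2" by (intro mult_left_mono) auto
    then have "int n * k + int c - int r \<noteq> - 1" using assms by linarith
    then show ?thesis using assms 4 by (simp add: Jmat_index)
  qed (use assms in \<open>auto simp: Jmat_index\<close>)
qed

definition Jinv :: "nat \<Rightarrow> real fls mat" where
  "Jinv n = Matrix.mat n n (\<lambda>(r, c). (if c = Suc r then 1 else 0) +
     (if r = n - 1 \<and> c = 0 then fls_X else 0))"

lemma mult_Jinv_index:
  assumes P: "P \<in> carrier_mat n n" and r: "r < n" and c: "c < n"
  shows "(P * Jinv n) $$ (r, c) =
    (if c = 0 then P $$ (r, n - 1) * fls_X else P $$ (r, c - 1))"
proof -
  have "Jinv n \<in> carrier_mat n n" by (simp add: Jinv_def)
  then have "(P * Jinv n) $$ (r, c) = (\<Sum>l<n. P $$ (r, l) * Jinv n $$ (l, c))"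
    by (rule index_mult_mat_sum[OF P _ r c])
  also have "\<dots> = (\<Sum>l<n. if l = (if c = 0 then n - 1 else c - 1)
      then (if c = 0 then P $$ (r, n - 1) * fls_X else P $$ (r, c - 1)) else 0)"
    using c by (intro sum.cong) (auto simp: Jinv_def)
  finally show ?thesis using c by auto
qed

lemma minv_Jmat:
  assumes "n > 0"
  shows "minv (Jmat n) = Jinv n"
proof (rule minv_eqI[of _ n])
  show "Jinv n \<in> carrier_mat n n" by (simp add: Jinv_def)
  show "Jmat n * Jinv n = 1\<^sub>m n"
  proof (rule eq_matI)
    fix r c assume "r < dim_row (1\<^sub>m n :: real fls mat)" "c < dim_col (1\<^sub>m n :: real fls mat)"
    then have "r < n" "c < n" by auto
    then show "(Jmat n * Jinv n) $$ (r, c) = 1\<^sub>m n $$ (r, c)"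
      by (subst mult_Jinv_index) (auto simp: Jmat_index fls_X_inv_times_conv_shift fls_eq_iff)
  qed (simp_all add: Jinv_def Jmat_def munit_def bmat_def)
qed simp

lemma Jinv_power_nth:
  assumes n: "n > 0"
  shows "Jinv n ^\<^sub>m i \<in> carrier_mat n n" and
    "r < n \<Longrightarrow> c < n \<Longrightarrow>
      fls_nth ((Jinv n ^\<^sub>m i) $$ (r, c)) k = (if int n * k + int c - int r = int i then 1 else 0)"
proof -
  have carr: "Jinv n ^\<^sub>m i \<in> carrier_mat n n" for i
    by (rule pow_carrier_mat) (simp add: Jinv_def)
  then show "Jinv n ^\<^sub>m i \<in> carrier_mat n n" .
  have one: "int n * k + int c - int r = 0 \<longleftrightarrow> k = 0 \<and> r = c" if "r < n" "c < n" for r c k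
  proof -
    consider "k = 0" | "k \<ge> 1" | "k \<le> - 1" by linarith
    then show ?thesis
    proof cases
      case 2
      then have "int n * 1 \<le> int n * k" by (intro mult_left_mono) auto
      then have "int n * k + int c - int r \<noteq> 0" using that by linarith
      then show ?thesis using 2 by simp
    next
      case 3
      then have "int n * k \<le> int n * - 1" by (intro mult_left_mono) auto
      then have "int n * k + int c - int r \<noteq> 0" using that by linarith
      then show ?thesis using 3 by simp
    qed auto
  qed
  show "fls_nth ((Jinv n ^\<^sub>m i) $$ (r, c)) k = (if int n * k + int c - int r = int i then 1 else 0)"
    if "r < n" "c < n"
    using that
  proof (induction i arbitrary: c k)
    case 0
    then show ?case using one[of r c k] by (auto simp: Jinv_def)
  next
    case (Suc i)
    show ?case
    proof (cases "c = 0")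
      case True
      have "fls_nth ((Jinv n ^\<^sub>m Suc i) $$ (r, c)) k = fls_nth ((Jinv n ^\<^sub>m i) $$ (r, n - 1)) (k - 1)"
        using True Suc.prems mult_Jinv_index[OF carr[of i], of r c] by (simp add: fls_times_both_shifted_simp fls_X_times_conv_shift)
      also have "\<dots> = (if int n * (k - 1) + int (n - 1) - int r = int i then 1 else 0)"
        using Suc.IH[of "n - 1" "k - 1"] Suc.prems by simp
      finally show ?thesis using True n by (auto simp: algebra_simps)
    next
      case False
      then show ?thesis
        using Suc.IH[of "c - 1" k] Suc.prems mult_Jinv_index[OF carr[of i], of r c]
        by (auto simp: of_nat_diff)
    qed
  qed
qed

text \<open>For a given entry and a given power of \<lambda> at most one power of J contributes, so
  the sum collapses to a single coefficient.\<close>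

lemma Jseries_coeff_eq:
  assumes n: "n > 0" and r: "r < n" "c < n"
  shows "Jseries_coeff n f r c k = fls_nth (fps_to_fls (Abs_fps f)) (int n * k + int c - int r)"
proof -
  let ?m = "int n * k + int c - int r"
  have "{i. fls_nth ((minv (Jmat n) ^\<^sub>m i) $$ (r, c)) k \<noteq> 0} = {i. ?m = int i}"
    by (simp add: minv_Jmat[OF n] Jinv_power_nth(2)[OF n r])
  also have "\<dots> = (if ?m < 0 then {} else {nat ?m})" by auto
  finally show ?thesis
    unfolding Jseries_coeff_def by (simp add: minv_Jmat[OF n] Jinv_power_nth(2)[OF n r])
qed

lemma Jmat_plus_Jseries:
  assumes n: "n > 0" and r: "r < n" "c < n"
  shows "fls_nth (Jmat n $$ (r, c)) k + Jseries_coeff n f r c k =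
    fls_nth (fps_to_fls (1 + fps_X * Abs_fps f)) (int n * k + int c - int r + 1)"
  unfolding Jmat_nth[OF r] Jseries_coeff_eq[OF assms]
  by (auto simp: nat_add_distrib)

lemma shape_exists: "\<exists>D. shape n 1 D (\<lambda>_. d)"
proof -
  define D where "D = Matrix.mat n n (\<lambda>(r, c).
    Abs_fls (\<lambda>k. fls_nth (fps_to_fls d) (int n * k + int c - int r + 1)))"
  have "fls_nth (Abs_fls (\<lambda>k. fls_nth (fps_to_fls d) (int n * k + int c - int r + 1))) k =
      fls_nth (fps_to_fls d) (int n * k + int c - int r + 1)" if "r < n" "c < n" for r c k
  proof (rule nth_Abs_fls_lower_bound[of "- 1"], intro allI impI)
    fix i :: int assume "i < - 1"
    then have "int n * i \<le> int n * - 2" by (intro mult_left_mono) auto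
    then have "int n * i + int c - int r + 1 < 0" using that by linarith
    then show "fls_nth (fps_to_fls d) (int n * i + int c - int r + 1) = 0" by simp
  qed
  then have "shape n 1 D (\<lambda>_. d)" by (simp add: shape_def D_def)
  then show ?thesis by blast
qed

text \<open>Right multiplication by J + u shifts columns; the last column receives \<lambda> times
  the first one, that is z^n Q_0, together with the potential.\<close>

lemma shape_mult_Jmat:
  assumes n: "n > 0" and M: "shape n 0 M q" and U: "U \<in> carrier_mat n n"
    and U': "\<And>r c. r < n \<Longrightarrow> c < n \<Longrightarrow> U $$ (r, c) = (if c = n - 1 then a r else 0)"
  shows "shape n 1 (M * (Jmat n + map_mat fls_const U))
    (\<lambda>c. if c = n - 1 then q 0 + (\<Sum>i<n. pot n a i * q i) else q (Suc c))"
  unfolding shape_def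
proof (intro conjI allI impI)
  have M': "M \<in> carrier_mat n n" using M by (simp add: shape_def)
  have N: "Jmat n + map_mat fls_const U \<in> carrier_mat n n" using U by simp
  show "M * (Jmat n + map_mat fls_const U) \<in> carrier_mat n n" using M' N by simp
  fix r c k assume r: "r < n" and c: "c < n"
  have "(M * (Jmat n + map_mat fls_const U)) $$ (r, c) =
      (\<Sum>l<n. M $$ (r, l) * (Jmat n + map_mat fls_const U) $$ (l, c))"
    by (rule index_mult_mat_sum[OF M' N r c])
  also have "\<dots> = (\<Sum>l<n. (if l = 0 then (if c = n - 1 then M $$ (r, l) * fls_X_inv else 0) else 0)
      + (if l = Suc c then M $$ (r, l) else 0)
      + (if c = n - 1 then M $$ (r, l) * fls_const (a l) else 0))"
    using c U U' by (intro sum.cong refl) (auto simp: Jmat_index algebra_simps)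
  also have "\<dots> = (if c = n - 1 then M $$ (r, 0) * fls_X_inv + (\<Sum>l<n. M $$ (r, l) * fls_const (a l))
      else M $$ (r, Suc c))"
    using n c by (auto simp: sum.distrib)
  finally have eq: "(M * (Jmat n + map_mat fls_const U)) $$ (r, c) = \<dots>" .
  show "fls_nth ((M * (Jmat n + map_mat fls_const U)) $$ (r, c)) k =
      fls_nth (fps_to_fls (if c = n - 1 then q 0 + (\<Sum>i<n. pot n a i * q i) else q (Suc c)))
        (int n * k + int c - int r + 1)"
  proof (cases "c = n - 1")
    case True
    have idx: "int n * k + int c - int r + 1 = int n * (k + 1) - int r"
      using n True by (simp add: algebra_simps of_nat_diff)
    have pot: "fls_nth (fps_to_fls (pot n a i * q i)) (int n * (k + 1) - int r) =
        fls_nth (M $$ (r, i)) k * a i" if "i < n" for i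
      unfolding fls_nth_pot_mult using shape_nth[OF M r that, of k] that
      by (simp add: algebra_simps of_nat_diff del: fps_to_fls_nth)
    have "fls_nth ((M * (Jmat n + map_mat fls_const U)) $$ (r, c)) k =
        fls_nth (M $$ (r, 0)) (k + 1) + (\<Sum>l<n. fls_nth (M $$ (r, l)) k * a l)"
      unfolding eq using True by (simp add: fls_X_inv_times_conv_shift fls_nth_sum)
    also have "\<dots> = fls_nth (fps_to_fls (q 0)) (int n * (k + 1) - int r)
        + (\<Sum>i<n. fls_nth (fps_to_fls (pot n a i * q i)) (int n * (k + 1) - int r))"
      using shape_nth[OF M r n, of "k + 1"] pot by simp
    also have "\<dots> = fls_nth (fps_to_fls (q 0 + (\<Sum>i<n. pot n a i * q i))) (int n * (k + 1) - int r)"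
      by (simp add: fps_sum_nth)
    finally show ?thesis unfolding idx using True by (simp only: simp_thms if_True)
  next
    case False
    then show ?thesis using shape_nth[OF M r, of "Suc c" k] c unfolding eq
      by (simp add: algebra_simps del: fps_to_fls_nth)
  qed
qed

section \<open>Series over smooth functions and their values at a point\<close>

lemma (in comm_ring_hom) coeffwise_hom: "comm_ring_hom (coeffwise hom)"
  by standard (auto simp: fps_eq_iff fps_mult_nth hom_distribs)

lemma (in comm_ring_hom) coeffwise_hom_X [simp]: "coeffwise hom fps_X = fps_X"
  by (simp add: fps_eq_iff fps_X_def)

lemma (in comm_ring_hom) coeffwise_pot: "coeffwise hom (pot n u i) = pot n (\<lambda>i. hom (u i)) i"
proof -
  interpret H: comm_ring_hom "coeffwise hom" by (rule coeffwise_hom)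
  have "coeffwise hom (fps_const a) = fps_const (hom a)" for a by (simp add: fps_eq_iff)
  then show ?thesis by (simp add: pot_def H.hom_mult H.hom_power)
qed

interpretation val: comm_ring_hom "\<lambda>f. val f x"
  by standard simp_all

interpretation vals: comm_ring_hom "coeffwise (\<lambda>f. val f x)"
  by (rule val.coeffwise_hom)

text \<open>\<open>minv\<close> needs a field, so matrix identities are established for real Laurent
  series at each point and lifted back here.\<close>

lemma vals_eqI: "(\<And>x. coeffwise (\<lambda>f. val f x) f = coeffwise (\<lambda>f. val f x) g) \<Longrightarrow> f = g"
  by (auto simp: fps_eq_iff intro!: smooth_fun_eqI)

text \<open>Recovers the coefficients T_k from the column series. The guard
  \<open>r \<le> c + n * k\<close> protects the natural-number subtraction, and for
  \<open>k = 0\<close> it is upper triangularity.\<close>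

definition tmat :: "nat \<Rightarrow> (nat \<Rightarrow> smooth_fun fps) \<Rightarrow> nat \<Rightarrow> real \<Rightarrow> real mat" where
  "tmat n Q k = fun_mat n (\<lambda>r c. if r \<le> c + n * k then fps_nth (Q c) (c + n * k - r) else 0)"

lemma tmat_cong: "(\<And>c. c < n \<Longrightarrow> Q c = Q' c) \<Longrightarrow> tmat n Q = tmat n Q'"
  unfolding tmat_def by (intro ext fun_mat_cong[THEN fun_cong]) auto

lemma shape_mseries_tmat:
  "shape n 0 (mseries n (tmat n Q) x) (\<lambda>c. coeffwise (\<lambda>f. val f x) (Q c))"
  unfolding shape_def
proof (intro conjI allI impI)
  show "mseries n (tmat n Q) x \<in> carrier_mat n n" by (simp add: mseries_def)
  fix r c k assume r: "r < n" and c: "c < n"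
  have "mseries n (tmat n Q) x $$ (r, c) = fps_to_fls (Abs_fps (\<lambda>i. tmat n Q i x $$ (r, c)))"
    using r c by (simp add: mseries_def)
  also have "fls_nth \<dots> k = fls_nth (fps_to_fls (coeffwise (\<lambda>f. val f x) (Q c))) (int n * k + int c - int r + 0)"
  proof (cases "k < 0")
    case True
    then have "int n * k \<le> int n * - 1" by (intro mult_left_mono) auto
    then have "int n * k + int c - int r < 0" using c by linarith
    then show ?thesis using True by simp
  next
    case False
    then obtain k' where k: "k = int k'" using nonneg_int_cases by (metis not_less)
    have m: "int n * k + int c - int r = int (c + n * k') - int r" by (simp add: k)
    then have "nat (int n * k + int c - int r) = c + n * k' - r"
      by (simp add: nat_diff_distrib' del: of_nat_add)
    moreover have "int n * k + int c - int r < 0 \<longleftrightarrow> \<not> r \<le> c + n * k'" unfolding m by linarith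
    ultimately show ?thesis using r c k by (simp add: tmat_def)
  qed
  finally show "fls_nth (mseries n (tmat n Q) x $$ (r, c)) k =
      fls_nth (fps_to_fls (coeffwise (\<lambda>f. val f x) (Q c))) (int n * k + int c - int r + 0)" .
qed

lemma mderiv_tmat: "mderiv n (tmat n Q i) = tmat n (\<lambda>c. coeffwise dx (Q c)) i"
  unfolding tmat_def by (rule ext, subst mderiv_fun_mat, rule fun_mat_cong[THEN fun_cong]) auto

text \<open>The constant term of the determinant is the determinant of the unitriangular
  T_0.\<close>

lemma det_mseries_tmat:
  assumes "\<And>c. c < n \<Longrightarrow> fps_nth (Q c) 0 = 1"
  shows "det (mseries n (tmat n Q) x) \<noteq> 0"
proof -
  define P where "P = Matrix.mat n n (\<lambda>(r, c). Abs_fps (\<lambda>i. tmat n Q i x $$ (r, c)))"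
  interpret F: comm_ring_hom "fps_to_fls :: real fps \<Rightarrow> real fls"
    by standard (simp_all add: fls_times_fps_to_fls)
  interpret Z: comm_ring_hom "\<lambda>f :: real fps. fps_nth f 0"
    by standard (simp_all add: fps_mult_nth)
  have P0: "map_mat (\<lambda>f. fps_nth f 0) P = tmat n Q 0 x"
    by (rule eq_matI) (auto simp: P_def tmat_def)
  have "upper_triangular (tmat n Q 0 x)"
    by (auto simp: upper_triangular_def tmat_def)
  moreover have "diag_mat (tmat n Q 0 x) = replicate n 1"
    using assms by (intro nth_equalityI) (auto simp: diag_mat_def tmat_def)
  ultimately have "det (tmat n Q 0 x) = 1"
    by (subst det_upper_triangular[of _ n]) (auto simp: tmat_def)
  then have "fps_nth (det P) 0 = 1" using Z.hom_det[of P] P0 by simp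
  then have "det P \<noteq> 0" by auto
  moreover have "mseries n (tmat n Q) x = map_mat fps_to_fls P"
    by (rule eq_matI) (auto simp: mseries_def P_def)
  ultimately show ?thesis using F.hom_det[of P] by simp
qed

section \<open>The gauge equation as equations for column series\<close>

lemma gauge_carrier:
  assumes "det (mseries n T x) \<noteq> 0" "u x \<in> carrier_mat n n"
  shows "gauge n u T x \<in> carrier_mat n n"
proof -
  have M: "mseries n T' x \<in> carrier_mat n n" for T' by (simp add: mseries_def)
  show ?thesis
    unfolding gauge_def using M[of T] M[of "\<lambda>i. mderiv n (T i)"] minv_props(3)[OF M assms(1)] by auto
qed

text \<open>Clears the inverse of T, after which both sides can be compared column by
  column.\<close>

lemma gauge_eq_iff:
  assumes det: "det (mseries n T x) \<noteq> 0" and u: "u x \<in> carrier_mat n n" and D: "D \<in> carrier_mat n n"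
  shows "gauge n u T x = D \<longleftrightarrow> D * mseries n T x =
    mseries n T x * (Jmat n + map_mat fls_const (u x)) - mseries n (\<lambda>i. mderiv n (T i)) x"
proof -
  define M where "M = mseries n T x"
  define M' where "M' = mseries n (\<lambda>i. mderiv n (T i)) x"
  define N where "N = Jmat n + map_mat fls_const (u x)"
  have carr: "M \<in> carrier_mat n n" "M' \<in> carrier_mat n n" "N \<in> carrier_mat n n" "M * N \<in> carrier_mat n n"
    "M * N - M' \<in> carrier_mat n n"
    using u by (auto simp: M_def M'_def N_def mseries_def)
  note inv = minv_props[OF carr(1), folded M_def, OF det[folded M_def]]
  have g: "gauge n u T x = (M * N - M') * minv M"
    unfolding gauge_def M_def[symmetric] M'_def[symmetric] N_def[symmetric]
    by (rule minus_mult_distrib_mat[symmetric]) (use carr inv in auto)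
  show ?thesis
    unfolding M_def[symmetric] M'_def[symmetric] N_def[symmetric] g
  proof
    assume "(M * N - M') * minv M = D"
    then have "D * M = (M * N - M') * minv M * M" by simp
    also have "\<dots> = (M * N - M') * (minv M * M)"
      by (rule assoc_mult_mat) (use carr inv in auto)
    finally show "D * M = M * N - M'" using carr inv by simp
  next
    assume "D * M = M * N - M'"
    then have "(M * N - M') * minv M = D * M * minv M" by simp
    also have "\<dots> = D * (M * minv M)" by (rule assoc_mult_mat) (use carr inv D in auto)
    finally show "(M * N - M') * minv M = D" using D inv by simp
  qed
qed

definition next_col :: "nat \<Rightarrow> (nat \<Rightarrow> 'a::comm_ring_1) \<Rightarrow> (nat \<Rightarrow> 'a fps) \<Rightarrow> nat \<Rightarrow> 'a fps" where
  "next_col n u Q c = (if c = n - 1 then Q 0 + (\<Sum>i<n. pot n u i * Q i) else Q (Suc c))"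

lemma gauge_tmat_iff:
  assumes n: "n > 0" and u: "u \<in> Cinf n (Vn n)" and Q: "\<And>c. c < n \<Longrightarrow> fps_nth (Q c) 0 = 1"
  shows "(\<forall>r<n. \<forall>c<n. \<forall>k. fls_nth (gauge n u (tmat n Q) x $$ (r, c)) k =
        fls_nth (Jmat n $$ (r, c)) k + Jseries_coeff n (\<lambda>i. val (fps_nth h i) x) r c k) \<longleftrightarrow>
    (\<forall>c<n. coeffwise (\<lambda>f. val f x) (zstep dx h (Q c)) =
        coeffwise (\<lambda>f. val f x) (next_col n (last_col n u) Q c))" (is "?L \<longleftrightarrow> ?R")
proof -
  let ?v = "coeffwise (\<lambda>f. val f x)"
  let ?M = "mseries n (tmat n Q) x"
  let ?d = "1 + fps_X * ?v h"
  have ux: "u x \<in> carrier_mat n n" using u by (simp add: Cinf_def)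
  have det: "det ?M \<noteq> 0" by (rule det_mseries_tmat[OF Q])
  have d: "1 + fps_X * Abs_fps (\<lambda>i. val (fps_nth h i) x) = ?d"
    by (simp add: coeffwise_def)
  have L: "?L \<longleftrightarrow> shape n 1 (gauge n u (tmat n Q) x) (\<lambda>_. ?d)"
    unfolding shape_def d[symmetric]
    using gauge_carrier[OF det, of u, OF ux] by (simp add: Jmat_plus_Jseries[OF n] del: fps_to_fls_nth)
  have M: "shape n 0 ?M (\<lambda>c. ?v (Q c))" by (rule shape_mseries_tmat)
  have M': "shape n 1 (mseries n (\<lambda>i. mderiv n (tmat n Q i)) x) (\<lambda>c. fps_X * ?v (coeffwise dx (Q c)))"
    unfolding mderiv_tmat by (rule shape_shift[OF shape_mseries_tmat])
  have "u x $$ (r, c) = (if c = n - 1 then val (last_col n u r) x else 0)" if "r < n" "c < n" for r c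
    using val_entry[OF u that, of x] entry_Vn[OF u that] by (auto simp: last_col_def)
  moreover have nxt: "(\<lambda>c. ?v (next_col n (last_col n u) Q c)) = (\<lambda>c. if c = n - 1
      then ?v (Q 0) + (\<Sum>i<n. pot n (\<lambda>r. val (last_col n u r) x) i * ?v (Q i)) else ?v (Q (Suc c)))"
    by (rule ext) (simp add: next_col_def vals.hom_add vals.hom_mult vals.hom_sum val.coeffwise_pot)
  ultimately have "shape n 1 (?M * (Jmat n + map_mat fls_const (u x))) (\<lambda>c. ?v (next_col n (last_col n u) Q c))"
    unfolding nxt by (intro shape_mult_Jmat[OF n M ux]) auto
  from shape_diff[OF this M']
  have rhs: "shape n 1 (?M * (Jmat n + map_mat fls_const (u x)) - mseries n (\<lambda>i. mderiv n (tmat n Q i)) x)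
      (\<lambda>c. ?v (next_col n (last_col n u) Q c) - fps_X * ?v (coeffwise dx (Q c)))"
    .
  have step: "?v (zstep dx h (Q c)) = ?d * ?v (Q c) + fps_X * ?v (coeffwise dx (Q c))" for c
    by (simp add: zstep_def vals.hom_add vals.hom_mult vals.hom_sum vals.hom_one algebra_simps)
  have R: "?R \<longleftrightarrow> (\<forall>c<n. ?d * ?v (Q c) = ?v (next_col n (last_col n u) Q c) - fps_X * ?v (coeffwise dx (Q c)))"
    unfolding step eq_diff_eq ..
  show ?thesis unfolding L R
  proof
    assume sh: "shape n 1 (gauge n u (tmat n Q) x) (\<lambda>_. ?d)"
    have "gauge n u (tmat n Q) x * ?M =
        ?M * (Jmat n + map_mat fls_const (u x)) - mseries n (\<lambda>i. mderiv n (tmat n Q i)) x"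
      using gauge_eq_iff[OF det, of u, OF ux gauge_carrier[OF det, of u, OF ux]] by blast
    then show "\<forall>c<n. ?d * ?v (Q c) = ?v (next_col n (last_col n u) Q c) - fps_X * ?v (coeffwise dx (Q c))"
      using shape_eq_iff[OF n shape_mult[OF n sh M] rhs] by simp
  next
    assume eq: "\<forall>c<n. ?d * ?v (Q c) = ?v (next_col n (last_col n u) Q c) - fps_X * ?v (coeffwise dx (Q c))"
    \<comment> \<open>Conversely, the required right-hand side is built as a matrix, and
      invertibility of T identifies it with the gauge transform.\<close>
    obtain D where D: "shape n 1 D (\<lambda>_. ?d)" using shape_exists by blast
    then have "D \<in> carrier_mat n n" by (simp add: shape_def)
    moreover have "D * ?M = ?M * (Jmat n + map_mat fls_const (u x)) - mseries n (\<lambda>i. mderiv n (tmat n Q i)) x"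
      using shape_eq_iff[OF n shape_mult[OF n D M] rhs] eq by simp
    ultimately have "gauge n u (tmat n Q) x = D" using gauge_eq_iff[OF det, of u, OF ux] by blast
    then show "shape n 1 (gauge n u (tmat n Q) x) (\<lambda>_. ?d)" using D by simp
  qed
qed

lemma shape_one: "n > 0 \<Longrightarrow> shape n 0 (1\<^sub>m n) (\<lambda>_. 1)"
  using Jinv_power_nth(2)[of n _ _ 0]
  by (auto simp: shape_def Jinv_def)

lemma normalizes_tmat_iff:
  assumes n: "n > 0" and u: "u \<in> Cinf n (Vn n)"
  shows "normalizes n u (tmat n Q) (\<lambda>i. val (fps_nth h i)) \<longleftrightarrow>
    (\<forall>c<n. fps_nth (Q c) 0 = 1) \<and> Q 0 = 1 \<and>
    (\<forall>c<n. zstep dx h (Q c) = next_col n (last_col n u) Q c)"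
proof -
  have smooth: "(\<forall>i. tmat n Q i \<in> Cinf n (carrier_mat n n)) \<and> (\<forall>i. smooth_S1 (val (fps_nth h i)))"
    by (auto simp: tmat_def intro!: fun_mat_in_Cinf)
  have tri: "(\<forall>x. upper_triangular (tmat n Q 0 x) \<and> (\<forall>r<n. tmat n Q 0 x $$ (r, r) = 1)) \<longleftrightarrow>
      (\<forall>c<n. fps_nth (Q c) 0 = 1)"
  proof -
    have "(\<forall>x. \<forall>r<n. tmat n Q 0 x $$ (r, r) = 1) \<longleftrightarrow> (\<forall>c<n. fps_nth (Q c) 0 = 1)"
      by (auto simp: tmat_def intro!: smooth_fun_eqI)
    moreover have "upper_triangular (tmat n Q 0 x)" for x
      by (auto simp: upper_triangular_def tmat_def)
    ultimately show ?thesis by simp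
  qed
  have "col (mseries n (tmat n Q) x) 0 = unit_vec n 0 \<longleftrightarrow> coeffwise (\<lambda>f. val f x) (Q 0) = 1" for x
    unfolding col_one[OF n, symmetric]
    by (rule shape_col_eq_iff[OF n shape_mseries_tmat shape_one[OF n] n])
  moreover have "(\<forall>x. coeffwise (\<lambda>f. val f x) (Q 0) = 1) \<longleftrightarrow> Q 0 = 1"
  proof
    assume "\<forall>x. coeffwise (\<lambda>f. val f x) (Q 0) = 1"
    then show "Q 0 = 1" by (intro vals_eqI) (simp only: vals.hom_one)
  qed (simp only: vals.hom_one simp_thms)
  ultimately have col: "(\<forall>x. col (mseries n (tmat n Q) x) 0 = unit_vec n 0) \<longleftrightarrow> Q 0 = 1"
    by (simp only:)
  have gauge: "(\<forall>x. \<forall>r<n. \<forall>c<n. \<forall>k. fls_nth (gauge n u (tmat n Q) x $$ (r, c)) k =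
        fls_nth (Jmat n $$ (r, c)) k + Jseries_coeff n (\<lambda>i. val (fps_nth h i) x) r c k) \<longleftrightarrow>
     (\<forall>c<n. zstep dx h (Q c) = next_col n (last_col n u) Q c)" if "\<forall>c<n. fps_nth (Q c) 0 = 1"
  proof -
    have "(\<forall>x. \<forall>c<n. coeffwise (\<lambda>f. val f x) (zstep dx h (Q c)) =
        coeffwise (\<lambda>f. val f x) (next_col n (last_col n u) Q c)) \<longleftrightarrow>
       (\<forall>c<n. zstep dx h (Q c) = next_col n (last_col n u) Q c)"
    proof
      assume "\<forall>c<n. zstep dx h (Q c) = next_col n (last_col n u) Q c"
      then show "\<forall>x. \<forall>c<n. coeffwise (\<lambda>f. val f x) (zstep dx h (Q c)) =
        coeffwise (\<lambda>f. val f x) (next_col n (last_col n u) Q c)" by metis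
    qed (intro allI impI vals_eqI, blast)
    moreover have "fps_nth (Q c) 0 = 1" if "c < n" for c using \<open>\<forall>c<n. fps_nth (Q c) 0 = 1\<close> that by blast
    ultimately show ?thesis using gauge_tmat_iff[OF n u, of Q _ h] by (simp only:)
  qed
  show ?thesis
  proof (cases "\<forall>c<n. fps_nth (Q c) 0 = 1")
    case True
    show ?thesis unfolding normalizes_def tri col gauge[OF True]
      by (simp only: smooth[THEN conjunct1] smooth[THEN conjunct2] simp_thms)
  next
    case False
    then show ?thesis unfolding normalizes_def tri by (simp only: simp_thms)
  qed
qed

text \<open>Column \<open>c\<close> has no power of z above \<open>c\<close> exactly because T_0 is
  upper triangular: positions below row \<open>c + n * k\<close> exist only for
  \<open>k = 0\<close>.\<close>

lemma tmat_exists: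
  assumes n: "n > 0" and T: "\<And>i. T i \<in> Cinf n (carrier_mat n n)"
    and tri: "\<And>x. upper_triangular (T 0 x)"
  obtains Q where "T = tmat n Q"
proof
  \<comment> \<open>The exponent \<open>int c - int m\<close> of z equals
    \<open>int r - int n * int k\<close>, so its residue is the row and minus its quotient is
    \<open>k\<close>.\<close>
  define Q where "Q c = Abs_fps (\<lambda>m. entry (T (nat (- ((int c - int m) div int n))))
    (nat ((int c - int m) mod int n)) c)" for c
  have ent: "entry (T k) r c = (if r \<le> c + n * k then fps_nth (Q c) (c + n * k - r) else 0)"
    if "r < n" "c < n" for r c k
  proof (cases "r \<le> c + n * k")
    case True
    then have m: "int c - int (c + n * k - r) = int r + int n * - int k" by (simp add: of_nat_diff)
    have "(int r + int n * - int k) div int n = - int k" "(int r + int n * - int k) mod int n = int r"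
      using that n by (simp_all add: div_mult_self2 del: mult_minus_right)
    then have "fps_nth (Q c) (c + n * k - r) = entry (T k) r c"
      unfolding Q_def fps_nth_Abs_fps m by (simp only: minus_minus nat_int)
    then show ?thesis using True by simp
  next
    case False
    then have "k = 0" using that by (cases k) auto
    moreover have "entry (T 0) r c = 0"
    proof (rule smooth_fun_eqI)
      fix x
      have "T 0 x \<in> carrier_mat n n" using T[of 0] by (simp add: Cinf_def)
      then have "T 0 x $$ (r, c) = 0"
        using tri[of x] that False \<open>k = 0\<close> by (auto simp: upper_triangular_def)
      then show "val (entry (T 0) r c) x = val 0 x" using val_entry[OF T that] by simp
    qed
    ultimately show ?thesis using False by simp
  qed
  show "T = tmat n Q"
  proof
    fix k
    have "T k = fun_mat n (entry (T k))" using fun_mat_entry[OF T] by simp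
    also have "\<dots> = tmat n Q k" unfolding tmat_def by (intro fun_mat_cong ent)
    finally show "T k = tmat n Q k" .
  qed
qed

text \<open>The first column is 1 and each column equation before the last produces the next column,
  so the columns are \<open>fdb\<close>; the last column equation is the Riccati equation.\<close>

lemma normalizes_iff:
  assumes n: "n > 0" and u: "u \<in> Cinf n (Vn n)"
  shows "normalizes n u T f \<longleftrightarrow> (\<exists>h. riccati dx n (last_col n u) h \<and>
    f = (\<lambda>i. val (fps_nth h i)) \<and> T = tmat n (fdb dx h))"
proof
  assume N: "normalizes n u T f"
  have "T i \<in> Cinf n (carrier_mat n n)" "upper_triangular (T 0 x)" for i x
    using N by (simp_all add: normalizes_def)
  then obtain Q where Q: "T = tmat n Q"
    by (rule tmat_exists[OF n])
  define h where "h = Abs_fps (\<lambda>i. Smooth (f i))"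
  have f: "f = (\<lambda>i. val (fps_nth h i))"
    using N by (auto simp: h_def normalizes_def)
  have "normalizes n u (tmat n Q) (\<lambda>i. val (fps_nth h i))" using N Q f by simp
  then have Q0: "Q 0 = 1" and step: "\<And>c. c < n \<Longrightarrow> zstep dx h (Q c) = next_col n (last_col n u) Q c"
    unfolding normalizes_tmat_iff[OF n u] by simp_all
  have fdb: "Q c = fdb dx h c" if "c < n" for c
    using that
  proof (induction c)
    case (Suc c)
    then show ?case using step[of c] by (auto simp: next_col_def)
  qed (use Q0 in simp)
  obtain m where m: "n = Suc m" using n by (cases n) auto
  have "fdb dx h n = zstep dx h (Q m)" using fdb[of m] m by simp
  also have "\<dots> = next_col n (last_col n u) Q m" using step[of m] m by simp
  also have "\<dots> = 1 + (\<Sum>i<n. pot n (last_col n u) i * fdb dx h i)"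
    using Q0 fdb by (simp add: next_col_def m)
  finally have "riccati dx n (last_col n u) h" by (simp add: riccati_def)
  moreover have "T = tmat n (fdb dx h)" unfolding Q using fdb by (rule tmat_cong)
  ultimately show "\<exists>h. riccati dx n (last_col n u) h \<and>
    f = (\<lambda>i. val (fps_nth h i)) \<and> T = tmat n (fdb dx h)" using f by blast
next
  assume "\<exists>h. riccati dx n (last_col n u) h \<and> f = (\<lambda>i. val (fps_nth h i)) \<and> T = tmat n (fdb dx h)"
  then obtain h where h: "riccati dx n (last_col n u) h"
    "f = (\<lambda>i. val (fps_nth h i))" "T = tmat n (fdb dx h)" by blast
  have "zstep dx h (fdb dx h c) = next_col n (last_col n u) (fdb dx h) c" if "c < n" for c
  proof -
    have "fdb dx h (Suc c) = next_col n (last_col n u) (fdb dx h) c"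
      using h(1) that n by (auto simp: next_col_def riccati_def simp del: fdb.simps(2))
    then show ?thesis by simp
  qed
  then show "normalizes n u T f"
    unfolding h(2,3) normalizes_tmat_iff[OF n u] by simp
qed

lemma of_nat_smooth_inverse:
  assumes "n > 0"
  shows "of_nat n * const_fun (1 / of_nat n) = 1"
  using assms by (intro smooth_fun_eqI) simp

lemma fcoeff_eq:
  assumes n: "n > 0" and u: "u \<in> Cinf n (Vn n)" and h: "riccati dx n (last_col n u) h"
  shows "fcoeff n u j = val (fps_nth h j)"
proof -
  have uniq: "h' = h" if "riccati dx n (last_col n u) h'" for h'
    using riccati_unique_solution[OF of_nat_smooth_inverse[OF n], of dx "last_col n u"] h that
    by (metis (full_types))
  have "Tser n u = tmat n (fdb dx h)"
    unfolding Tser_def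
  proof (rule the_equality)
    show "\<exists>f. normalizes n u (tmat n (fdb dx h)) f"
      unfolding normalizes_iff[OF n u] using h by blast
  next
    fix T assume "\<exists>f. normalizes n u T f"
    then show "T = tmat n (fdb dx h)" unfolding normalizes_iff[OF n u] using uniq by metis
  qed
  then have "fcoeff n u = (THE f. normalizes n u (tmat n (fdb dx h)) f)"
    by (simp only: fcoeff_def)
  also have "\<dots> = (\<lambda>i. val (fps_nth h i))"
  proof (rule the_equality)
    show "normalizes n u (tmat n (fdb dx h)) (\<lambda>i. val (fps_nth h i))"
      unfolding normalizes_iff[OF n u] using h by blast
  next
    fix f assume "normalizes n u (tmat n (fdb dx h)) f"
    then show "f = (\<lambda>i. val (fps_nth h i))" unfolding normalizes_iff[OF n u] using uniq by metis
  qed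
  finally have "fcoeff n u = (\<lambda>i. val (fps_nth h i))" .
  then show ?thesis by simp
qed

section \<open>The gradients of the Hamiltonians\<close>

text \<open>The indeterminate is the deformation parameter and counts as a constant. Evaluating it
  at a real number therefore commutes with the derivations.\<close>

abbreviation dx_poly :: "smooth_fun poly \<Rightarrow> smooth_fun poly" where
  "dx_poly \<equiv> map_poly dx"

lemma coeff_dx_poly: "coeff (dx_poly p) i = dx (coeff p i)"
  by (simp add: coeff_map_poly)

interpretation dx_poly: derivation dx_poly
  by standard (auto simp: poly_eq_iff coeff_dx_poly dx_simps coeff_mult sum.distrib)

lemma comm_ring_hom_poly_const: "comm_ring_hom (\<lambda>p. poly p (const_fun a))"
  by standard auto

lemma dx_poly_const: "dx (poly p (const_fun a)) = poly (dx_poly p) (const_fun a)"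
  by (induction p) (auto simp: map_poly_pCons dx_simps)

lemma (in comm_ring_hom) coeffwise_zstep:
  assumes "\<And>a. hom (D a) = D' (hom a)"
  shows "coeffwise hom (zstep D h f) = zstep D' (coeffwise hom h) (coeffwise hom f)"
proof -
  interpret H: comm_ring_hom "coeffwise hom" by (rule coeffwise_hom)
  have "coeffwise hom (coeffwise D f) = coeffwise D' (coeffwise hom f)"
    using assms by (simp add: fps_eq_iff)
  then show ?thesis by (simp add: zstep_def H.hom_add H.hom_mult)
qed

lemma (in comm_ring_hom) coeffwise_fdb:
  assumes "\<And>a. hom (D a) = D' (hom a)"
  shows "coeffwise hom (fdb D h c) = fdb D' (coeffwise hom h) c"
proof (induction c)
  case 0
  interpret H: comm_ring_hom "coeffwise hom" by (rule coeffwise_hom)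
  show ?case by (simp add: H.hom_one)
qed (simp add: coeffwise_zstep[of D D', OF assms])

lemma (in comm_ring_hom) riccati_hom:
  assumes D: "\<And>a. hom (D a) = D' (hom a)" and h: "riccati D n u h"
  shows "riccati D' n (\<lambda>i. hom (u i)) (coeffwise hom h)"
proof -
  interpret H: comm_ring_hom "coeffwise hom" by (rule coeffwise_hom)
  have "fdb D' (coeffwise hom h) n = coeffwise hom (fdb D h n)"
    by (rule coeffwise_fdb[of D D', OF D, symmetric])
  also have "fdb D h n = 1 + (\<Sum>i<n. pot n u i * fdb D h i)" using h by (simp add: riccati_def)
  also have "coeffwise hom \<dots> = 1 + (\<Sum>i<n. pot n (\<lambda>i. hom (u i)) i * fdb D' (coeffwise hom h) i)"
    by (simp add: H.hom_add H.hom_one H.hom_sum H.hom_mult coeffwise_pot coeffwise_fdb[of D D', OF D])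
  finally show ?thesis by (simp add: riccati_def)
qed

lemma riccati_cong: "(\<And>i. i < n \<Longrightarrow> u i = u' i) \<Longrightarrow> riccati D n u h \<longleftrightarrow> riccati D n u' h"
  by (simp add: riccati_def pot_def)

text \<open>The integral is itself a real polynomial in \<epsilon>, by linearity.\<close>

lemma DERIV_circ_integral_poly:
  "((\<lambda>\<epsilon>. circ_integral (poly p (const_fun \<epsilon>))) has_real_derivative circ_integral (coeff p 1)) (at 0)"
proof (induction p)
  case (pCons c p)
  have "((\<lambda>\<epsilon>. circ_integral c + \<epsilon> * circ_integral (poly p (const_fun \<epsilon>))) has_real_derivative
      0 + (1 * circ_integral (poly p (const_fun 0)) + circ_integral (coeff p 1) * 0)) (at 0)"
    by (intro DERIV_add DERIV_const DERIV_mult pCons.IH DERIV_ident)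
  then show ?case
    by (simp add: circ_integral_add circ_integral_cmult const_fun_hom poly_0_coeff_0)
qed simp

section \<open>Coefficients of the resolvent\<close>

locale resolvent = potential +
  fixes h :: "smooth_fun fps" and R :: "nat \<Rightarrow> smooth_fun fps"
  assumes riccati_h: "riccati dx n u h" and dual_rows_R: "dual_rows dx n u h R"
begin

text \<open>The rank-one entry carries z^(c-r), so its coefficient at z^-j sits at index j + c - r.
  The index is an integer because \<open>j - n\<close> is needed with \<open>j < n\<close>.\<close>

definition res :: "int \<Rightarrow> fmat" where
  "res j r c = of_nat n * fls_nth (fps_to_fls (R r * fdb dx h c)) (j + int c - int r)"

definition grad :: "nat \<Rightarrow> nat \<Rightarrow> smooth_fun" where
  "grad j c = res (int j) (n - 1) c"

text \<open>Taking coefficient 1 in \<epsilon> is a derivation over taking coefficient 0, so it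
  turns the Riccati equation for \<open>hp\<close> into the hypotheses of
  \<open>variation_identity\<close>. The total derivative there integrates to zero.\<close>

lemma variation_integral:
  assumes w: "w (n - 1) = 0"
    and hp: "riccati dx_poly n (\<lambda>i. [:u i, w i:]) hp"
    and h: "coeffwise (\<lambda>p. coeff p 0) hp = h"
  shows "of_nat n * circ_integral (coeff (fps_nth hp j) 1) = circ_integral (\<Sum>r<n - 1. grad j r * w r)"
proof -
  let ?c0 = "coeffwise (\<lambda>p :: smooth_fun poly. coeff p 0)"
  let ?c1 = "coeffwise (\<lambda>p :: smooth_fun poly. coeff p 1)"
  interpret C0: comm_ring_hom "\<lambda>p :: smooth_fun poly. coeff p 0"
    by standard (auto simp: coeff_mult_0)
  interpret C0': comm_ring_hom ?c0 by (rule C0.coeffwise_hom)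
  define Y where "Y c = ?c1 (fdb dx_poly hp c)" for c
  have c0: "?c0 (fdb dx_poly hp c) = fdb dx h c" for c
    using C0.coeffwise_fdb[of dx_poly dx hp c] h by (simp add: coeff_dx_poly)
  have c1_add: "?c1 (f + g) = ?c1 f + ?c1 g" for f g by (simp add: fps_eq_iff)
  have c1_sum: "?c1 (sum f A) = (\<Sum>i\<in>A. ?c1 (f i))" for f A
    by (simp add: fps_eq_iff fps_sum_nth coeff_sum)
  have c1_mult: "?c1 (f * g) = ?c0 f * ?c1 g + ?c1 f * ?c0 g" for f g
    by (simp add: fps_eq_iff fps_mult_nth coeff_sum coeff_mult sum.distrib)
  have c1_X: "?c1 fps_X = 0" by (simp add: fps_eq_iff fps_X_def)
  have c1_pot: "?c1 (pot n (\<lambda>i. [:u i, w i:]) i) = pot n w i" for i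
    by (auto simp: fps_eq_iff pot_def fps_X_power_nth)
  have "fps_X * ?c1 hp = (\<Sum>i<n. pot n w i * (R (n - 1) * fdb dx h i))
      - fps_X * coeffwise dx (\<Sum>c<n. Y c * R c)"
  proof (rule dx.variation_identity[OF dual_rows_R n_pos])
    show "Y 0 = 0" by (simp add: Y_def fps_eq_iff)
    show "Y (Suc c) = zstep dx h (Y c) + fps_X * ?c1 hp * fdb dx h c" for c
    proof -
      have "?c1 (coeffwise dx_poly f) = coeffwise dx (?c1 f)" for f
        by (simp add: fps_eq_iff coeff_dx_poly)
      then show ?thesis
        by (simp add: Y_def zstep_def c1_add c1_mult c1_X c0 h C0.coeffwise_hom_X algebra_simps del: One_nat_def)
    qed
    have "Y n = ?c1 (1 + (\<Sum>i<n. pot n (\<lambda>i. [:u i, w i:]) i * fdb dx_poly hp i))"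
      using hp by (simp add: Y_def riccati_def)
    also have "?c1 1 = 0" by (simp add: fps_eq_iff)
    then have "?c1 (1 + (\<Sum>i<n. pot n (\<lambda>i. [:u i, w i:]) i * fdb dx_poly hp i)) =
        (\<Sum>i<n. pot n w i * fdb dx h i) + (\<Sum>i<n. pot n u i * Y i)"
      by (simp add: c1_add c1_sum c1_mult c1_pot c0 C0.coeffwise_pot Y_def sum.distrib add.commute del: One_nat_def)
    finally show "Y n = (\<Sum>i<n. pot n w i * fdb dx h i) + (\<Sum>i<n. pot n u i * Y i)" .
  qed
  from arg_cong[OF this, of "\<lambda>f. fls_nth (fps_to_fls f) (int (Suc j))"]
  have "coeff (fps_nth hp j) 1 =
      fls_nth (fps_to_fls (\<Sum>i<n. pot n w i * (R (n - 1) * fdb dx h i))) (int (Suc j))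
      - dx (fps_nth (\<Sum>c<n. Y c * R c) j)"
    by (simp del: One_nat_def of_nat_Suc)
  then have "circ_integral (coeff (fps_nth hp j) 1) =
      circ_integral (fls_nth (fps_to_fls (\<Sum>i<n. pot n w i * (R (n - 1) * fdb dx h i))) (int (Suc j)))"
    by (simp add: circ_integral_diff)
  also have "fls_nth (fps_to_fls (\<Sum>i<n. pot n w i * (R (n - 1) * fdb dx h i))) (int (Suc j)) =
      (\<Sum>i<n. fls_nth (fps_to_fls (pot n w i * (R (n - 1) * fdb dx h i))) (int (Suc j)))"
    by (simp add: fps_sum_nth)
  \<comment> \<open>\<open>pot\<close> lowers the index by \<open>n - i\<close>, and
    \<open>Suc j - (n - i)\<close> is the index that \<open>res\<close> uses in row
    \<open>n - 1\<close>.\<close>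
  also have "\<dots> = (\<Sum>i<n. w i * fls_nth (fps_to_fls (R (n - 1) * fdb dx h i)) (int j + int i - int (n - 1)))"
    unfolding fls_nth_pot_mult using n_pos
    by (intro sum.cong refl) (simp add: of_nat_diff algebra_simps del: fps_to_fls_nth)
  also have "\<dots> = (\<Sum>i<n - 1. w i * fls_nth (fps_to_fls (R (n - 1) * fdb dx h i)) (int j + int i - int (n - 1)))"
    using w n_pos by (cases n) auto
  finally have "of_nat n * circ_integral (coeff (fps_nth hp j) 1) = circ_integral (const_fun (of_nat n) *
      (\<Sum>i<n - 1. w i * fls_nth (fps_to_fls (R (n - 1) * fdb dx h i)) (int j + int i - int (n - 1))))"
    by (simp only: circ_integral_cmult)
  then show ?thesis
    by (simp only: const_fun_hom grad_def res_def sum_distrib_left mult_ac)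
qed

text \<open>Coefficient extraction from \<open>resolvent_step\<close>. Both places where J wraps
  around carry \<lambda> = z^n and hence refer to \<open>res (j + int n)\<close>; together they form
  \<open>ecom\<close>.\<close>

lemma dcom_res:
  assumes r: "r < n" and c: "c < n"
  shows "dcom n u (res j) r c + ecom n (res (j + int n)) r c = 0"
proof -
  let ?F = "\<lambda>f. of_nat n * fls_nth (fps_to_fls f) (j + int c - int r + 1)"
  have 1: "?F ((if r = 0 then R (n - 1) else R (r - 1)) * fdb dx h c) =
      (if r = 0 then res (j + int n) (n - 1) c else res j (r - 1) c)"
    using n_pos by (auto simp: res_def of_nat_diff algebra_simps simp del: fps_to_fls_nth)
  have 2: "?F (pot n u r * (R (n - 1) * fdb dx h c)) = u r * res j (n - 1) c"
    unfolding fls_nth_pot_mult using r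
    by (simp add: res_def of_nat_diff algebra_simps del: fps_to_fls_nth)
  have nat: "dx (of_nat n * f) = of_nat n * dx f" for f
    using dx_const_fun[of "of_nat n"] by (simp add: dx_simps const_fun_hom)
  have 3: "?F (fps_X * coeffwise dx (R r * fdb dx h c)) = dx (res j r c)"
    by (simp add: fls_nth_X_mult res_def nat del: fps_to_fls_nth) (simp add: nat)
  have 4: "?F (R r * fdb dx h (Suc c)) =
      (if c = n - 1 then (\<Sum>k<n. res j r k * u k) + res (j + int n) r 0 else res j r (Suc c))"
  proof (cases "c = n - 1")
    case True
    then have "fdb dx h (Suc c) = 1 + (\<Sum>i<n. pot n u i * fdb dx h i)"
      using riccati_h n_pos by (simp add: riccati_def del: fdb.simps(2))
    then have "R r * fdb dx h (Suc c) = R r + (\<Sum>i<n. pot n u i * (R r * fdb dx h i))"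
      by (simp add: algebra_simps sum_distrib_left)
    moreover have "fls_nth (fps_to_fls (sum f A)) m = (\<Sum>i\<in>A. fls_nth (fps_to_fls (f i)) m)"
      for f :: "nat \<Rightarrow> smooth_fun fps" and A m by (simp add: fps_sum_nth)
    moreover have "?F (pot n u i * (R r * fdb dx h i)) = res j r i * u i" if "i < n" for i
      unfolding fls_nth_pot_mult using that n_pos True
      by (simp add: res_def of_nat_diff algebra_simps del: fps_to_fls_nth)
    moreover have "?F (R r) = res (j + int n) r 0"
      using n_pos True by (simp add: res_def of_nat_diff algebra_simps del: fps_to_fls_nth)
    ultimately show ?thesis
      using True by (simp add: fls_plus_nth distrib_left sum_distrib_left del: fps_to_fls_nth fdb.simps(2))
  next
    case False
    then show ?thesis by (simp add: res_def algebra_simps del: fps_to_fls_nth fdb.simps(2))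
  qed
  have "?F (a + b + d) = ?F a + ?F b + ?F d" for a b d
    by (simp add: distrib_left)
  from arg_cong[OF dx.resolvent_step[OF riccati_h dual_rows_R r, of c], of ?F, unfolded this 1 2 3 4]
  show ?thesis
    using r c by (auto simp: dcom_def fmat_mult_bu_left fmat_mult_bu_right ecom_eq algebra_simps)
qed

text \<open>The trace of the rank-one matrix is n times the normalization sum, which has no term
  beyond the constant one.\<close>

lemma fmat_trace_res: "j > 0 \<Longrightarrow> fmat_trace n (res j) = 0"
proof -
  assume j: "j > 0"
  have "fmat_trace n (res j) = of_nat n * fls_nth (fps_to_fls (\<Sum>k<n. fdb dx h k * R k)) j"
    using j by (simp add: fmat_trace_def res_def fps_sum_nth mult.commute flip: sum_distrib_left)
  then show ?thesis using dual_rows_R j by (simp add: dual_rows_def)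
qed

text \<open>Strictly below the diagonal the \<open>ecom\<close> term of \<open>dcom_res\<close>
  vanishes. The rows that \<open>gstep\<close> consults, \<open>r\<close>, \<open>r - 1\<close> and
  \<open>n - 1\<close>, stay on or below the diagonal of the previous column.\<close>

lemma res_giter:
  assumes "c \<le> r" "r < n"
  shows "res j r c = giter n u (\<lambda>r. res j r 0) r c"
  using assms
proof (induction c arbitrary: r)
  case (Suc c)
  have "dcom n u (res j) r c = 0"
    using dcom_res[of r c j] ecom_eq[of r n "res (j + int n)" c] Suc.prems by auto
  then have "res j r (Suc c) = gstep n u (\<lambda>r. res j r c) r"
    using Suc.prems by (simp add: dcom_column)
  also have "\<dots> = gstep n u (\<lambda>r. giter n u (\<lambda>r. res j r 0) r c) r"
    using Suc.IH[of r] Suc.IH[of "r - 1"] Suc.IH[of "n - 1"] Suc.prems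
    by (simp add: gstep_def[of n u "\<lambda>r. res j r c"] gstep_def[of n u "\<lambda>r. giter n u _ r c"])
  finally show ?case by simp
qed simp

text \<open>\<open>res\<close> has a commutator with a first row that need not vanish, so it is
  replaced by the matrix generated from its first column. The two agree on and below the diagonal,
  which is enough for last row and trace.\<close>

lemma is_P_grad:
  assumes "j > 0"
  shows "is_P n u (grad j) (giter n u (\<lambda>r. res (int j) r 0))"
proof (rule is_P_giterI)
  fix c assume "c < n - 1"
  then show "giter n u (\<lambda>r. res (int j) r 0) (n - 1) c = grad j c"
    using res_giter[of c "n - 1" "int j"] n_pos by (simp add: grad_def)
next
  have "fmat_trace n (giter n u (\<lambda>r. res (int j) r 0)) = fmat_trace n (res (int j))"
    unfolding fmat_trace_def by (intro sum.cong refl res_giter[symmetric]) auto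
  then show "fmat_trace n (giter n u (\<lambda>r. res (int j) r 0)) = 0" using fmat_trace_res assms by simp
qed

text \<open>Negative indices give 0. At index 0 the entry is n times the constant term of
  \<open>R (n - 1)\<close>, which \<open>dual_rows\<close> fixes as 1/n.\<close>

lemma grad_leading:
  assumes "0 < j" "j < n"
  shows "c < n - 1 - j \<Longrightarrow> grad j c = 0" and "grad j (n - 1 - j) = 1"
proof -
  show "grad j c = 0" if "c < n - 1 - j"
    using that assms by (simp add: grad_def res_def)
  have "int j + int (n - 1 - j) - int (n - 1) = 0" using assms by (simp add: of_nat_diff)
  then show "grad j (n - 1 - j) = 1"
    using dual_rows_R by (simp add: grad_def res_def dual_rows_def)
qed

end

section \<open>The kernel of \<open>J\<^sub>1\<close>\<close>

context potential
begin

text \<open>The radical of the form, stated for rows of smooth functions.\<close>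

definition in_ker :: "(nat \<Rightarrow> smooth_fun) \<Rightarrow> bool" where
  "in_ker \<xi> \<longleftrightarrow> (\<exists>C. is_P n u \<xi> C \<and>
     (\<forall>\<eta> C'. is_P n u \<eta> C' \<longrightarrow> circ_integral (fmat_trace n (fmat_mult n (ecom n C) C')) = 0))"

lemma in_ker_diff_cmult:
  assumes "in_ker \<xi>" "in_ker \<zeta>"
  shows "in_ker (\<lambda>c. \<xi> c - const_fun a * \<zeta> c)"
proof -
  obtain C where C: "is_P n u \<xi> C"
    and C0: "\<And>\<eta> C'. is_P n u \<eta> C' \<Longrightarrow> circ_integral (fmat_trace n (fmat_mult n (ecom n C) C')) = 0"
    using assms(1) unfolding in_ker_def by blast
  obtain E where E: "is_P n u \<zeta> E"
    and E0: "\<And>\<eta> C'. is_P n u \<eta> C' \<Longrightarrow> circ_integral (fmat_trace n (fmat_mult n (ecom n E) C')) = 0"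
    using assms(2) unfolding in_ker_def by blast
  have "fmat_trace n (fmat_mult n (ecom n (\<lambda>r c. C r c - const_fun a * E r c)) C') =
      fmat_trace n (fmat_mult n (ecom n C) C') - const_fun a * fmat_trace n (fmat_mult n (ecom n E) C')" for C'
    unfolding fmat_trace_mult_ecom[OF n_pos] sum_distrib_left sum_subtractf[symmetric]
    by (intro sum.cong refl) (simp add: algebra_simps)
  then have "circ_integral (fmat_trace n (fmat_mult n (ecom n (\<lambda>r c. C r c - const_fun a * E r c)) C')) = 0"
    if "is_P n u \<eta> C'" for \<eta> C'
    using C0[OF that] E0[OF that] by (simp add: circ_integral_diff circ_integral_cmult)
  then show ?thesis
    using is_P_diff[OF C is_P_cmult[OF E]] unfolding in_ker_def by blast
qed

lemma in_ker_0: "in_ker (\<lambda>c. 0)"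
proof -
  have "is_P n u (\<lambda>c. 0) (\<lambda>r c. 0)"
    by (simp add: is_P_def fmat_trace_def dcom_def fmat_mult_def)
  then show ?thesis
    unfolding in_ker_def by (intro exI[of _ "\<lambda>r c. 0"]) (simp add: fmat_trace_mult_ecom[OF n_pos])
qed

lemma in_ker_sum:
  assumes "\<And>j. j \<in> A \<Longrightarrow> in_ker (G j)"
  shows "in_ker (\<lambda>c. \<Sum>j\<in>A. const_fun (a j) * G j c)"
  using assms
proof (induction A rule: infinite_finite_induct)
  case (insert j A)
  then have "in_ker (\<lambda>c. (\<Sum>j\<in>A. const_fun (a j) * G j c) - const_fun (- a j) * G j c)"
    by (intro in_ker_diff_cmult) auto
  moreover have "const_fun (- a j) = - const_fun (a j)" by (rule smooth_fun_eqI) simp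
  ultimately show ?case using insert.hyps by (simp add: add.commute)
qed (auto simp: in_ker_0)

lemma dx_eq_0_imp_const:
  assumes "dx f = 0"
  obtains a where "f = const_fun a"
proof
  show "f = const_fun (val f 0)"
  proof (rule smooth_fun_eqI)
    fix x
    have "\<forall>y. DERIV (val f) y :> 0" using val_DERIV[of f] assms by simp
    then show "val f x = val (const_fun (val f 0)) x" using DERIV_isconst_all by simp
  qed
qed

lemma in_ker_leading_const:
  assumes "in_ker \<xi>" and k: "k < n - 1" and \<xi>: "\<And>c. c < k \<Longrightarrow> \<xi> c = 0"
  obtains a where "\<xi> k = const_fun a"
proof -
  obtain C where C: "is_P n u \<xi> C"
    and C0: "\<And>\<eta> C'. is_P n u \<eta> C' \<Longrightarrow> circ_integral (fmat_trace n (fmat_mult n (ecom n C) C')) = 0"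
    using assms(1) unfolding in_ker_def by blast
  \<comment> \<open>This choice turns the leading term of the form into n times the integral of a
    square.\<close>
  define \<eta> where "\<eta> c = (if c = n - 2 - k then dx (\<xi> k) else 0)" for c
  obtain C' where C': "is_P n u \<eta> C'" using is_P_exists by blast
  have "of_nat n * circ_integral (dx (\<xi> k) * \<eta> (n - 2 - k)) = 0"
    using first_form_leading[OF k C \<xi> C'] C0[OF C'] by (simp add: \<eta>_def)
  then have "dx (\<xi> k) = 0"
    using n_pos by (intro circ_integral_square_eq_0) (simp add: \<eta>_def)
  then show thesis using dx_eq_0_imp_const that by blast
qed

end

context resolvent
begin

lemma in_ker_grad:
  assumes j: "0 < j" "j < n"
  shows "in_ker (grad j)"
  unfolding in_ker_def
proof (intro exI conjI allI impI)
  let ?C = "giter n u (\<lambda>r. res (int j) r 0)"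
  show "is_P n u (grad j) ?C" by (rule is_P_grad[OF j(1)])
  fix \<eta> C' assume C': "is_P n u \<eta> C'"
  let ?K = "res (int j - int n)"
  \<comment> \<open>The generated matrix and \<open>res\<close> share last row and first column, all
    that \<open>fmat_trace_mult_ecom\<close> sees.\<close>
  have "?C (n - 1) c = res (int j) (n - 1) c" if "c < n" for c
    using res_giter[of c "n - 1" "int j"] that by simp
  then have "fmat_trace n (fmat_mult n (ecom n ?C) C') = fmat_trace n (fmat_mult n (ecom n (res (int j))) C')"
    unfolding fmat_trace_mult_ecom[OF n_pos] by (intro sum.cong refl) (simp del: One_nat_def)
  also have "\<dots> = - fmat_trace n (fmat_mult n (dcom n u ?K) C')"
  proof -
    have "ecom n (res (int j)) r c = - dcom n u ?K r c" if "r < n" "c < n" for r c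
      using dcom_res[OF that, of "int j - int n"] by (simp add: add_eq_0_iff)
    then show ?thesis by (simp add: fmat_trace_def fmat_mult_def sum_negf)
  qed
  finally have "circ_integral (fmat_trace n (fmat_mult n (ecom n ?C) C')) = circ_integral (fmat_trace n (fmat_mult n ?K (dcom n u C')))"
    by (simp add: circ_integral_minus circ_integral_trace_dcom)
  also have "fmat_trace n (fmat_mult n ?K (dcom n u C')) = 0"
    using j by (intro fmat_trace_mult_dcom_is_P[OF C']) (simp add: res_def)
  finally show "circ_integral (fmat_trace n (fmat_mult n (ecom n ?C) C')) = 0" by simp
qed

lemma in_ker_span_grad:
  assumes "in_ker \<xi>"
  obtains a where "\<And>c. c < n - 1 \<Longrightarrow> \<xi> c = (\<Sum>j\<in>{1..n - 1}. const_fun (a j) * grad j c)"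
proof -
  have "\<exists>a. \<forall>c<n - 1. \<xi> c = (\<Sum>j\<in>{1..n - 1}. const_fun (a j) * grad j c)"
    if "in_ker \<xi>" "d \<le> n - 1" "\<And>c. c < n - 1 - d \<Longrightarrow> \<xi> c = 0" for d \<xi>
    using that
  proof (induction d arbitrary: \<xi>)
    case 0
    then show ?case by (intro exI[of _ "\<lambda>j. 0"]) (simp add: const_fun_hom)
  next
    case (Suc d)
    \<comment> \<open>\<open>k\<close> is the first column where \<xi> may be nonzero; by
      \<open>grad_leading\<close> it is also the column where \<open>grad (Suc d)\<close> starts,
      with entry 1.\<close>
    define k where "k = n - 1 - Suc d"
    have k: "k < n - 1" "n - 1 - d = Suc k" "n - 1 - Suc d = k" using Suc.prems(2) by (auto simp: k_def)
    have j: "0 < Suc d" "Suc d < n" using Suc.prems(2) by auto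
    have "\<xi> c = 0" if "c < k" for c using Suc.prems(3) k(3) that by simp
    then obtain \<beta> where \<beta>: "\<xi> k = const_fun \<beta>"
      by (rule in_ker_leading_const[OF Suc.prems(1) k(1)])
    define \<zeta> where "\<zeta> c = \<xi> c - const_fun \<beta> * grad (Suc d) c" for c
    have \<zeta>: "in_ker \<zeta>"
      unfolding \<zeta>_def by (rule in_ker_diff_cmult[OF Suc.prems(1) in_ker_grad[OF j]])
    have \<zeta>0: "\<zeta> c = 0" if "c < n - 1 - d" for c
    proof (cases "c = k")
      case True
      then show ?thesis using grad_leading(2)[OF j] k \<beta> by (simp add: \<zeta>_def)
    next
      case False
      then have "c < n - 1 - Suc d" using that k by simp
      then show ?thesis using grad_leading(1)[OF j] Suc.prems(3) by (simp add: \<zeta>_def)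
    qed
    obtain a where a: "\<forall>c<n - 1. \<zeta> c = (\<Sum>j\<in>{1..n - 1}. const_fun (a j) * grad j c)"
      using Suc.IH[OF \<zeta> Suc_leD[OF Suc.prems(2)] \<zeta>0] by blast
    have "\<xi> c = (\<Sum>j\<in>{1..n - 1}. const_fun (a j + (if j = Suc d then \<beta> else 0)) * grad j c)"
      if "c < n - 1" for c
    proof -
      have "(\<Sum>j\<in>{1..n - 1}. const_fun (a j + (if j = Suc d then \<beta> else 0)) * grad j c) =
          (\<Sum>j\<in>{1..n - 1}. const_fun (a j) * grad j c)
          + (\<Sum>j\<in>{1..n - 1}. if j = Suc d then const_fun \<beta> * grad j c else 0)"
        unfolding sum.distrib[symmetric]
        by (intro sum.cong refl) (simp add: const_fun_hom distrib_right)
      also have "\<dots> = \<zeta> c + const_fun \<beta> * grad (Suc d) c" using a that j by simp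
      finally show ?thesis by (simp add: \<zeta>_def)
    qed
    then show ?case by (intro exI[of _ "\<lambda>j. a j + (if j = Suc d then \<beta> else 0)"] allI impI)
  qed
  from this[OF assms, of "n - 1"]
  obtain a where "\<forall>c<n - 1. \<xi> c = (\<Sum>j\<in>{1..n - 1}. const_fun (a j) * grad j c)" by auto
  then show thesis using that by blast
qed

end

section \<open>Back to functionals and matrix-valued functions\<close>

lemma is_P_cong: "(\<And>c. c < n - 1 \<Longrightarrow> v c = v' c) \<Longrightarrow> is_P n u v C \<longleftrightarrow> is_P n u v' C"
  by (simp add: is_P_def)

lemma J1op_eq_0_iff_in_ker:
  assumes n: "n > 0" and u: "u \<in> Cinf n (Vn n)"
  shows "J1op n u (of_row n \<xi>) = (\<lambda>x. 0\<^sub>m n n) \<longleftrightarrow> potential.in_ker n (last_col n u) \<xi>"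
proof -
  interpret potential n "last_col n u" by (rule potential_last_col[OF n u])
  have P: "is_P n (last_col n u) (last_row n (of_row n \<eta>)) C \<longleftrightarrow> is_P n (last_col n u) \<eta> C" for \<eta> C
    by (rule is_P_cong) (rule last_row_of_row)
  show ?thesis unfolding J1op_eq_0_iff[OF n u of_row_in_Vnt]
  proof
    assume J: "\<forall>\<eta>\<in>Cinf n (Vnt n). form1 n u (of_row n \<xi>) \<eta> = 0"
    obtain C where C: "is_P n (last_col n u) \<xi> C" using is_P_exists by blast
    have "circ_integral (fmat_trace n (fmat_mult n (ecom n C) C')) = 0" if "is_P n (last_col n u) \<eta> C'" for \<eta> C'
      using form1_eq[OF n u of_row_in_Vnt of_row_in_Vnt, unfolded P, OF C that] J of_row_in_Vnt by simp
    then show "in_ker \<xi>" using C unfolding in_ker_def by blast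
  next
    assume "in_ker \<xi>"
    then obtain C where C: "is_P n (last_col n u) \<xi> C"
      and C0: "\<And>\<eta> C'. is_P n (last_col n u) \<eta> C' \<Longrightarrow> circ_integral (fmat_trace n (fmat_mult n (ecom n C) C')) = 0"
      unfolding in_ker_def by blast
    show "\<forall>\<eta>\<in>Cinf n (Vnt n). form1 n u (of_row n \<xi>) \<eta> = 0"
    proof
      fix \<eta> assume \<eta>: "\<eta> \<in> Cinf n (Vnt n)"
      obtain C' where C': "is_P n (last_col n u) (last_row n \<eta>) C'" using is_P_exists by blast
      show "form1 n u (of_row n \<xi>) \<eta> = 0"
        using form1_eq[OF n u of_row_in_Vnt \<eta>, of \<xi> C C'] C C' C0 P by simp
    qed
  qed
qed

text \<open>Evaluation at \<epsilon> sends the formal solution \<open>hp\<close> to a solution for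
  the perturbed potential, and \<open>fcoeff_eq\<close> reads the coefficients from any
  solution.\<close>

lemma Hfun_perturbed:
  assumes n: "n > 0" and u: "u \<in> Cinf n (Vn n)" and v: "v \<in> Cinf n (Vn n)"
    and hp: "riccati dx_poly n (\<lambda>i. [:last_col n u i, last_col n v i:]) hp"
  shows "Hfun n j (\<lambda>x. u x + \<epsilon> \<cdot>\<^sub>m v x) =
    of_nat n * circ_integral (poly (fps_nth hp j) (const_fun \<epsilon>))"
proof -
  let ?w = "\<lambda>r. last_col n u r + const_fun \<epsilon> * last_col n v r"
  interpret H: comm_ring_hom "\<lambda>p. poly p (const_fun \<epsilon>)" by (rule comm_ring_hom_poly_const)
  have eq: "(\<lambda>x. u x + \<epsilon> \<cdot>\<^sub>m v x) = of_col n ?w"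
  proof
    fix x
    have "of_col n (last_col n u) x + \<epsilon> \<cdot>\<^sub>m of_col n (last_col n v) x = of_col n ?w x"
      by (rule eq_matI) (auto simp: of_col_def)
    then show "u x + \<epsilon> \<cdot>\<^sub>m v x = of_col n ?w x" by (simp add: of_col_last_col u v)
  qed
  have last: "last_col n w (n - 1) = 0" if "w \<in> Cinf n (Vn n)" for w
    using potential.u_last[OF potential_last_col[OF n that]] .
  have "last_col n (of_col n ?w) i = ?w i" if "i < n" for i
    using that last[OF of_col_in_Vn] last[OF u] last[OF v] last_col_of_col[of i n ?w]
    by (cases "i = n - 1") auto
  moreover have "riccati dx n (\<lambda>i. poly [:last_col n u i, last_col n v i:] (const_fun \<epsilon>))
      (coeffwise (\<lambda>p. poly p (const_fun \<epsilon>)) hp)"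
    by (rule H.riccati_hom[OF _ hp]) (simp add: dx_poly_const)
  ultimately have "riccati dx n (last_col n (of_col n ?w)) (coeffwise (\<lambda>p. poly p (const_fun \<epsilon>)) hp)"
    by (simp cong: riccati_cong)
  from fcoeff_eq[OF n of_col_in_Vn this, of j] show ?thesis
    unfolding eq Hfun_def by (simp add: circ_integral.rep_eq)
qed

lemma has_gradient_Hfun:
  assumes n: "n > 0" and u: "u \<in> Cinf n (Vn n)" and R: "resolvent n (last_col n u) h R"
  shows "has_gradient n (Hfun n j) u (of_row n (resolvent.grad n h R j))"
  unfolding has_gradient_def
proof (intro conjI ballI)
  interpret resolvent n "last_col n u" h R by (rule R)
  show "of_row n (grad j) \<in> Cinf n (Vnt n)" by (rule of_row_in_Vnt)
  fix v assume v: "v \<in> Cinf n (Vn n)"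
  have "of_nat n * [:const_fun (1 / of_nat n):] = (1 :: smooth_fun poly)"
    using of_nat_smooth_inverse[OF n] by (simp add: of_nat_poly one_pCons mult.commute)
  then obtain hp where hp: "riccati dx_poly n (\<lambda>i. [:last_col n u i, last_col n v i:]) hp"
    using riccati_unique_solution by blast
  \<comment> \<open>At \<epsilon> = 0 the formal solution solves the unperturbed equation, so
    uniqueness applies.\<close>
  have "coeffwise (\<lambda>p. coeff p 0) hp = h"
  proof -
    interpret H: comm_ring_hom "\<lambda>p. poly p (const_fun 0)" by (rule comm_ring_hom_poly_const)
    have "riccati dx n (last_col n u) (coeffwise (\<lambda>p. poly p (const_fun 0)) hp)"
    proof -
      have "riccati dx n (\<lambda>i. poly [:last_col n u i, last_col n v i:] (const_fun 0))
          (coeffwise (\<lambda>p. poly p (const_fun 0)) hp)"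
        by (rule H.riccati_hom[OF _ hp]) (simp add: dx_poly_const)
      then show ?thesis by (simp add: const_fun_hom)
    qed
    moreover have "\<exists>!h. riccati dx n (last_col n u) h"
      by (rule riccati_unique_solution[OF of_nat_smooth_inverse[OF n]])
    ultimately have "coeffwise (\<lambda>p. poly p (const_fun 0)) hp = h" using riccati_h by blast
    then show ?thesis by (simp add: const_fun_hom poly_0_coeff_0)
  qed
  moreover have "last_col n v (n - 1) = 0"
    using potential.u_last[OF potential_last_col[OF n v]] .
  ultimately have "of_nat n * circ_integral (coeff (fps_nth hp j) 1) =
      circ_integral (\<Sum>r<n - 1. grad j r * last_col n v r)"
    using variation_integral[OF _ hp] by blast
  also have "\<dots> = pairing (of_row n (grad j)) (of_col n (last_col n v))"
    by (rule pairing_of_row_of_col[OF n, symmetric])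
  finally have "of_nat n * circ_integral (coeff (fps_nth hp j) 1) = pairing (of_row n (grad j)) v"
    by (simp add: of_col_last_col[OF v])
  moreover have "((\<lambda>\<epsilon>. of_nat n * circ_integral (poly (fps_nth hp j) (const_fun \<epsilon>))) has_real_derivative
      of_nat n * circ_integral (coeff (fps_nth hp j) 1)) (at 0)"
    by (rule DERIV_cmult[OF DERIV_circ_integral_poly])
  ultimately show "((\<lambda>\<epsilon>. Hfun n j (\<lambda>x. u x + \<epsilon> \<cdot>\<^sub>m v x)) has_real_derivative
      pairing (of_row n (grad j)) v) (at 0)"
    by (simp add: Hfun_perturbed[OF n u v hp])
qed

theorem theorem5p12:
  fixes n :: nat and u :: "real \<Rightarrow> real mat"
  assumes "n \<ge> 2" and "u \<in> Cinf n (Vn n)"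
  shows "(\<forall>j\<in>{1..n - 1}. J1op n u (gradient n (Hfun n j) u) = (\<lambda>x. 0\<^sub>m n n))
    \<and> (\<forall>j\<in>{1..n - 1}. \<forall>F g. has_gradient n F u g \<longrightarrow> poisson1 n (Hfun n j) F u = 0)
    \<and> J1ker n u = fun_span n {1..n - 1} (\<lambda>j. gradient n (Hfun n j) u)"
proof -
  have n: "n > 0" and u: "u \<in> Cinf n (Vn n)" using assms by auto
  interpret potential n "last_col n u" by (rule potential_last_col[OF n u])
  obtain h where h: "riccati dx n (last_col n u) h"
    using riccati_unique_solution[OF of_nat_smooth_inverse[OF n]] by blast
  obtain R where R: "dual_rows dx n (last_col n u) h R"
    using dual_rows_exist[OF of_nat_smooth_inverse[OF n]] by blast
  interpret resolvent n "last_col n u" h R by unfold_locales (rule h, rule R)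
  have grad: "gradient n (Hfun n j) u = of_row n (grad j)" for j
    by (rule gradient_eq[OF n has_gradient_Hfun[OF n u]]) (rule resolvent_axioms)
  have ker: "in_ker (grad j)" if "j \<in> {1..n - 1}" for j
    using that by (intro in_ker_grad) auto
  have J1: "J1op n u (gradient n (Hfun n j) u) = (\<lambda>x. 0\<^sub>m n n)" if "j \<in> {1..n - 1}" for j
    unfolding grad J1op_eq_0_iff_in_ker[OF n u] by (rule ker[OF that])
  \<comment> \<open>The bracket is the form evaluated at two gradients, and the gradient of
    \<open>H_j\<close> lies in its radical.\<close>
  have poisson: "poisson1 n (Hfun n j) F u = 0" if j: "j \<in> {1..n - 1}" and g: "has_gradient n F u g"
    for j F g
    using J1[OF j] g gradient_eq[OF n g]
    unfolding poisson1_def grad J1op_eq_0_iff[OF n u of_row_in_Vnt] by (simp add: has_gradient_def)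
  have span: "(\<lambda>x. Matrix.mat n n (\<lambda>(r, c). \<Sum>j\<in>{1..n - 1}. a j * gradient n (Hfun n j) u x $$ (r, c))) =
      of_row n (\<lambda>c. \<Sum>j\<in>{1..n - 1}. const_fun (a j) * grad j c)" for a
    unfolding grad by (rule ext, rule eq_matI) (auto simp: of_row_def)
  have "J1ker n u = fun_span n {1..n - 1} (\<lambda>j. gradient n (Hfun n j) u)"
  proof (intro equalityI subsetI)
    fix \<xi> assume "\<xi> \<in> J1ker n u"
    then have \<xi>: "\<xi> \<in> Cinf n (Vnt n)" and "J1op n u \<xi> = (\<lambda>x. 0\<^sub>m n n)" by (auto simp: J1ker_def)
    then have "in_ker (last_row n \<xi>)"
      using J1op_eq_0_iff_in_ker[OF n u, of "last_row n \<xi>"] by (simp add: of_row_last_row)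
    then obtain a where
      "\<And>c. c < n - 1 \<Longrightarrow> last_row n \<xi> c = (\<Sum>j\<in>{1..n - 1}. const_fun (a j) * grad j c)"
      using in_ker_span_grad by blast
    then have "of_row n (last_row n \<xi>) = of_row n (\<lambda>c. \<Sum>j\<in>{1..n - 1}. const_fun (a j) * grad j c)"
      by (rule of_row_cong)
    then have "\<xi> = of_row n (\<lambda>c. \<Sum>j\<in>{1..n - 1}. const_fun (a j) * grad j c)"
      by (simp add: of_row_last_row[OF \<xi>])
    then show "\<xi> \<in> fun_span n {1..n - 1} (\<lambda>j. gradient n (Hfun n j) u)"
      unfolding fun_span_def span by blast
  next
    fix \<xi> assume "\<xi> \<in> fun_span n {1..n - 1} (\<lambda>j. gradient n (Hfun n j) u)"
    then obtain a where \<xi>: "\<xi> = of_row n (\<lambda>c. \<Sum>j\<in>{1..n - 1}. const_fun (a j) * grad j c)"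
      unfolding fun_span_def span by blast
    have "in_ker (\<lambda>c. \<Sum>j\<in>{1..n - 1}. const_fun (a j) * grad j c)"
      by (rule in_ker_sum[OF ker])
    then show "\<xi> \<in> J1ker n u"
      unfolding J1ker_def \<xi> using J1op_eq_0_iff_in_ker[OF n u] of_row_in_Vnt by blast
  qed
  with J1 poisson show ?thesis by blast
qed

end
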